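(* Let $(M_1^{n_1},g_1)$ be a compact Riemannian manifold, $f$ a positive smooth function on $M_1$, and $(M_2^{n_2},F_2)$ a weakly Berwald Finsler manifold. Suppose the Finsler warped product $M=M_1\times_f M_2$ is Einstein with Ricci scalar $\lambda(x_1,x_2)$, that $n_1=1$ or $n_2=1$, and that $\lambda$ is non-negative on $M$ (or non-positive on $M$). Then $f$ is constant, i.e. $M$ is simply a Riemannian product of two Finsler manifolds, and $M$ is a weakly Berwald manifold.
   Context: Manifolds are connected. A Finsler metric on a smooth manifold $M$ is a continuous $F:TM\to[0,\infty)$, smooth on $TM^0=TM\setminus\{0\}$, positively 1-homogeneous on fibers, with $g_{ij}=\frac12\frac{\partial^2F^2}{\partial y^i\partial y^j}$ positive definite on $TM^0$. Spray coefficients: $G^i=\frac14 g^{i\ell}\{[F^2]_{x^ky^\ell}y^k-[F^2]_{x^\ell}\}$. $(M,F)$ is weakly Berwald if $E_{ij}=\frac12\frac{\partial^2}{\partial y^i\partial y^j}\big(\frac{\partial G^s}{\partial y^s}\big)$ vanishes identically. Riemann curvature: $R^i_k=2\frac{\partial G^i}{\partial x^k}-y^j\frac{\partial^2G^i}{\partial x^j\partial y^k}+2G^j\frac{\partial^2G^i}{\partial y^j\partial y^k}-\frac{\partial G^i}{\partial y^j}\frac{\partial G^j}{\partial y^k}$; Ricci curvature: $\operatorname{Ric}=\sum_i R^i_i$, and $\operatorname{Ric}_{ij}=\frac12\frac{\partial^2\operatorname{Ric}}{\partial y^i\partial y^j}$. $(M,F)$ is Einstein with Ricci scalar $\lambda$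 if $\operatorname{Ric}(x,y)=\lambda(x)F^2(x,y)$, i.e. $\operatorname{Ric}_{ij}=\lambda g_{ij}$, for a function $\lambda=\lambda(x)$ on $M$. The Finsler warped product $M=M_1\times_f M_2$ of a base $(M_1,F_1)$ and fiber $(M_2,F_2)$ with warping function $f>0$ smooth on $M_1$ is $M_1\times M_2$ with $F^2(x_1,y_1,x_2,y_2)=F_1^2(x_1,y_1)+f^2(x_1)F_2^2(x_2,y_2)$ on $TM_1^0\times TM_2^0$, with geometric quantities (Ricci, Berwald curvature, etc.) computed there. It is called trivial, or a Riemannian product of two Finsler manifolds, if $f$ is constant. *)

theory Defs
  imports "HOL-Analysis.Analysis"
begin

section \<open>Smooth functions on open subsets of Euclidean spaces\<close>

text \<open>Intended for open \<open>S\<close> only.\<close>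

primrec Ck_on ::
  "nat \<Rightarrow> 'a::euclidean_space set \<Rightarrow> ('a \<Rightarrow> 'b::real_normed_vector) \<Rightarrow> bool" where
  "Ck_on 0 S h \<longleftrightarrow> continuous_on S h"
| "Ck_on (Suc k) S h \<longleftrightarrow>
     (\<forall>x\<in>S. h differentiable (at x)) \<and> (\<forall>v. Ck_on k S (\<lambda>x. frechet_derivative h (at x) v))"

definition smooth_on ::
  "'a::euclidean_space set \<Rightarrow> ('a \<Rightarrow> 'b::real_normed_vector) \<Rightarrow> bool" where
  "smooth_on S h \<longleftrightarrow> (\<forall>k. Ck_on k S h)"

section \<open>Smooth manifolds and their tangent bundles\<close>

text \<open>
  A chart is a pair of a domain and a coordinate map into a Euclidean space \<open>'e\<close>, so that the
  dimension of the manifold is \<open>DIM('e)\<close> and coordinate indices range over \<open>Basis :: 'e set\<close>.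
  The atlas need not be maximal: the curvature conditions below are invariant under coordinate
  changes, so the choice of a compatible atlas does not matter.

  The field \<open>chart_at\<close> selects a reference chart around each point. The tangent space at
  \<open>p\<close> is the model space \<open>'e\<close>, where a tangent vector is identified with its components in
  the chart \<open>chart_at M p\<close>; thus \<open>TM\<close> is \<open>topspace (mtop M) \<times> UNIV\<close> as a set, and its smooth
  structure is given by the charts \<open>tangent_lift\<close> below.
\<close>

type_synonym ('a, 'e) chart = "'a set \<times> ('a \<Rightarrow> 'e)"

record ('a, 'e) manifold =
  mtop :: "'a topology"
  atlas :: "('a, 'e) chart set"
  chart_at :: "'a \<Rightarrow> ('a, 'e) chart"

definition chart_image :: "('a, 'e) chart \<Rightarrow> 'e set" where
  "chart_image c = snd c ` fst c"

definition chart_inv :: "('a, 'e) chart \<Rightarrow> 'e \<Rightarrow> 'a" where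
  "chart_inv c = inv_into (fst c) (snd c)"

definition smooth_manifold :: "('a, 'e::euclidean_space) manifold \<Rightarrow> bool" where
  "smooth_manifold M \<longleftrightarrow>
     topspace (mtop M) \<noteq> {} \<and> connected_space (mtop M) \<and>
     Hausdorff_space (mtop M) \<and> second_countable (mtop M) \<and>
     (\<forall>c\<in>atlas M. openin (mtop M) (fst c) \<and> open (chart_image c) \<and>
        homeomorphic_map (subtopology (mtop M) (fst c)) (top_of_set (chart_image c)) (snd c)) \<and>
     (\<forall>c\<in>atlas M. \<forall>d\<in>atlas M. smooth_on (snd c ` (fst c \<inter> fst d)) (snd d \<circ> chart_inv c)) \<and>
     (\<forall>p\<in>topspace (mtop M). chart_at M p \<in> atlas M \<and> p \<in> fst (chart_at M p))"

definition smooth_fun_on_manifold ::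
  "('a, 'e::euclidean_space) manifold \<Rightarrow> ('a \<Rightarrow> real) \<Rightarrow> bool" where
  "smooth_fun_on_manifold M f \<longleftrightarrow> (\<forall>c\<in>atlas M. smooth_on (chart_image c) (f \<circ> chart_inv c))"

text \<open>
  \<open>tangent_lift M c (x, y)\<close> is the tangent vector \<open>\<Sum>i. y\<^sup>i \<partial>/\<partial>x\<^sup>i\<close> at the point with coordinates \<open>x\<close>
  in the chart \<open>c\<close>: its components are moved to the reference chart by the Jacobian of the
  coordinate change.
\<close>

definition tangent_lift ::
  "('a, 'e::euclidean_space) manifold \<Rightarrow> ('a, 'e) chart \<Rightarrow> 'e \<times> 'e \<Rightarrow> 'a \<times> 'e" where
  "tangent_lift M c z =
     (let p = chart_inv c (fst z)
      in (p, frechet_derivative (snd (chart_at M p) \<circ> chart_inv c) (at (fst z)) (snd z)))"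

text \<open>The coordinates \<open>(x, y)\<close> in the chart \<open>c\<close> of the tangent vectors belonging to \<open>T\<close>.\<close>

definition tangent_dom ::
  "('a, 'e::euclidean_space) manifold \<Rightarrow> ('a \<times> 'e) set \<Rightarrow> ('a, 'e) chart \<Rightarrow> ('e \<times> 'e) set" where
  "tangent_dom M T c = {z. fst z \<in> chart_image c \<and> tangent_lift M c z \<in> T}"

definition tangent_bundle :: "('a, 'e::euclidean_space) manifold \<Rightarrow> ('a \<times> 'e) set" where
  "tangent_bundle M = topspace (mtop M) \<times> UNIV"

definition slit_tangent_bundle :: "('a, 'e::euclidean_space) manifold \<Rightarrow> ('a \<times> 'e) set" where
  "slit_tangent_bundle M = topspace (mtop M) \<times> (UNIV - {0})"

section \<open>Spray, Berwald and Ricci curvature in local coordinates\<close>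

text \<open>
  Throughout, \<open>L\<close> is the local expression of \<open>F\<^sup>2\<close> as a function of \<open>z = (x, y)\<close>, and
  \<open>pdx i\<close>, \<open>pdy i\<close> are the partial derivatives with respect to \<open>x\<^sup>i\<close> and \<open>y\<^sup>i\<close>.
\<close>

definition pdx :: "'e::euclidean_space \<Rightarrow> ('e \<times> 'e \<Rightarrow> real) \<Rightarrow> 'e \<times> 'e \<Rightarrow> real" where
  "pdx i H z = frechet_derivative H (at z) (i, 0)"

definition pdy :: "'e::euclidean_space \<Rightarrow> ('e \<times> 'e \<Rightarrow> real) \<Rightarrow> 'e \<times> 'e \<Rightarrow> real" where
  "pdy i H z = frechet_derivative H (at z) (0, i)"

definition fund_tensor ::
  "('e::euclidean_space \<times> 'e \<Rightarrow> real) \<Rightarrow> 'e \<Rightarrow> 'e \<Rightarrow> 'e \<times> 'e \<Rightarrow> real" where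
  "fund_tensor L i j z = (1 / 2) * pdy i (pdy j L) z"

text \<open>The inverse matrix \<open>g\<^sup>i\<^sup>l\<close>, as the matrix of the inverse of the linear map given by \<open>g\<^sub>i\<^sub>j\<close>.\<close>

definition fund_tensor_inv ::
  "('e::euclidean_space \<times> 'e \<Rightarrow> real) \<Rightarrow> 'e \<Rightarrow> 'e \<Rightarrow> 'e \<times> 'e \<Rightarrow> real" where
  "fund_tensor_inv L i l z =
     inv (\<lambda>v. \<Sum>a\<in>Basis. \<Sum>b\<in>Basis. (fund_tensor L a b z * (v \<bullet> b)) *\<^sub>R a) l \<bullet> i"

definition spray ::
  "('e::euclidean_space \<times> 'e \<Rightarrow> real) \<Rightarrow> 'e \<Rightarrow> 'e \<times> 'e \<Rightarrow> real" where
  "spray L i z = (1 / 4) * (\<Sum>l\<in>Basis. fund_tensor_inv L i l z *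
     ((\<Sum>k\<in>Basis. pdx k (pdy l L) z * (snd z \<bullet> k)) - pdx l L z))"

definition mean_berwald ::
  "('e::euclidean_space \<times> 'e \<Rightarrow> real) \<Rightarrow> 'e \<Rightarrow> 'e \<Rightarrow> 'e \<times> 'e \<Rightarrow> real" where
  "mean_berwald L i j z =
     (1 / 2) * pdy i (pdy j (\<lambda>w. \<Sum>s\<in>Basis. pdy s (spray L s) w)) z"

definition riemann_curv ::
  "('e::euclidean_space \<times> 'e \<Rightarrow> real) \<Rightarrow> 'e \<Rightarrow> 'e \<Rightarrow> 'e \<times> 'e \<Rightarrow> real" where
  "riemann_curv L i k z =
     2 * pdx k (spray L i) z
     - (\<Sum>j\<in>Basis. (snd z \<bullet> j) * pdx j (pdy k (spray L i)) z)
     + 2 * (\<Sum>j\<in>Basis. spray L j z * pdy j (pdy k (spray L i)) z)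
     - (\<Sum>j\<in>Basis. pdy j (spray L i) z * pdy k (spray L j) z)"

definition ricci_curv :: "('e::euclidean_space \<times> 'e \<Rightarrow> real) \<Rightarrow> 'e \<times> 'e \<Rightarrow> real" where
  "ricci_curv L z = (\<Sum>i\<in>Basis. riemann_curv L i i z)"

section \<open>Finsler and Riemannian manifolds\<close>

definition local_sq ::
  "('a, 'e::euclidean_space) manifold \<Rightarrow> ('a \<times> 'e \<Rightarrow> real) \<Rightarrow> ('a, 'e) chart \<Rightarrow> 'e \<times> 'e \<Rightarrow> real" where
  "local_sq M F c z = (F (tangent_lift M c z))\<^sup>2"

definition finsler_manifold ::
  "('a, 'e::euclidean_space) manifold \<Rightarrow> ('a \<times> 'e \<Rightarrow> real) \<Rightarrow> bool" where
  "finsler_manifold M F \<longleftrightarrow>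
     smooth_manifold M \<and>
     (\<forall>u\<in>tangent_bundle M. F u \<ge> 0) \<and>
     (\<forall>p\<in>topspace (mtop M). \<forall>v. \<forall>r>0. F (p, r *\<^sub>R v) = r * F (p, v)) \<and>
     (\<forall>c\<in>atlas M.
        continuous_on (tangent_dom M (tangent_bundle M) c) (F \<circ> tangent_lift M c) \<and>
        smooth_on (tangent_dom M (slit_tangent_bundle M) c) (F \<circ> tangent_lift M c) \<and>
        (\<forall>z\<in>tangent_dom M (slit_tangent_bundle M) c. \<forall>v. v \<noteq> 0 \<longrightarrow>
           (\<Sum>i\<in>Basis. \<Sum>j\<in>Basis.
              fund_tensor (local_sq M F c) i j z * (v \<bullet> i) * (v \<bullet> j)) > 0))"

definition riemannian_manifold ::
  "('a, 'e::euclidean_space) manifold \<Rightarrow> ('a \<Rightarrow> 'e \<Rightarrow> 'e \<Rightarrow> real) \<Rightarrow> bool" where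
  "riemannian_manifold M g \<longleftrightarrow>
     smooth_manifold M \<and>
     (\<forall>p\<in>topspace (mtop M). bilinear (g p) \<and> (\<forall>v w. g p v w = g p w v) \<and>
        (\<forall>v. v \<noteq> 0 \<longrightarrow> g p v v > 0)) \<and>
     (\<forall>c\<in>atlas M. \<forall>i\<in>Basis. \<forall>j\<in>Basis.
        smooth_on (chart_image c)
          (\<lambda>x. g (chart_inv c x) (snd (tangent_lift M c (x, i))) (snd (tangent_lift M c (x, j)))))"

definition riemannian_norm :: "('a \<Rightarrow> 'e \<Rightarrow> 'e \<Rightarrow> real) \<Rightarrow> 'a \<times> 'e \<Rightarrow> real" where
  "riemannian_norm g u = sqrt (g (fst u) (snd u) (snd u))"

text \<open>
  The following two conditions are relative to a set \<open>T\<close> of tangent vectors on which \<open>F\<close> is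
  smooth: the slit tangent bundle for a Finsler manifold, and \<open>product_slit\<close> below for a
  Finsler warped product.
\<close>

definition weakly_berwald ::
  "('a, 'e::euclidean_space) manifold \<Rightarrow> ('a \<times> 'e) set \<Rightarrow> ('a \<times> 'e \<Rightarrow> real) \<Rightarrow> bool" where
  "weakly_berwald M T F \<longleftrightarrow>
     (\<forall>c\<in>atlas M. \<forall>z\<in>tangent_dom M T c. \<forall>i\<in>Basis. \<forall>j\<in>Basis.
        mean_berwald (local_sq M F c) i j z = 0)"

definition einstein ::
  "('a, 'e::euclidean_space) manifold \<Rightarrow> ('a \<times> 'e) set \<Rightarrow> ('a \<times> 'e \<Rightarrow> real) \<Rightarrow> ('a \<Rightarrow> real) \<Rightarrow> bool"
  where
  "einstein M T F lam \<longleftrightarrow>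
     (\<forall>c\<in>atlas M. \<forall>z\<in>tangent_dom M T c.
        ricci_curv (local_sq M F c) z = lam (chart_inv c (fst z)) * local_sq M F c z)"

section \<open>Finsler warped products\<close>

definition product_chart :: "('a, 'e) chart \<Rightarrow> ('b, 'f) chart \<Rightarrow> ('a \<times> 'b, 'e \<times> 'f) chart" where
  "product_chart c d = (fst c \<times> fst d, map_prod (snd c) (snd d))"

definition product_manifold ::
  "('a, 'e) manifold \<Rightarrow> ('b, 'f) manifold \<Rightarrow> ('a \<times> 'b, 'e \<times> 'f) manifold" where
  "product_manifold M1 M2 =
     \<lparr>mtop = prod_topology (mtop M1) (mtop M2),
      atlas = {product_chart c d |c d. c \<in> atlas M1 \<and> d \<in> atlas M2},
      chart_at = (\<lambda>p. product_chart (chart_at M1 (fst p)) (chart_at M2 (snd p)))\<rparr>"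

text \<open>
  With these charts the tangent space of the product at \<open>(x1, x2)\<close> is the product of the tangent
  spaces of the factors; the next set is \<open>TM1\<^sup>0 \<times> TM2\<^sup>0\<close>.
\<close>

definition product_slit ::
  "('a, 'e::euclidean_space) manifold \<Rightarrow> ('b, 'f::euclidean_space) manifold \<Rightarrow>
     (('a \<times> 'b) \<times> ('e \<times> 'f)) set" where
  "product_slit M1 M2 =
     {((x1, x2), (y1, y2)) |x1 x2 y1 y2.
        (x1, y1) \<in> slit_tangent_bundle M1 \<and> (x2, y2) \<in> slit_tangent_bundle M2}"

definition warped_metric ::
  "('a \<Rightarrow> real) \<Rightarrow> ('a \<times> 'e \<Rightarrow> real) \<Rightarrow> ('b \<times> 'f \<Rightarrow> real) \<Rightarrow> ('a \<times> 'b) \<times> ('e \<times> 'f) \<Rightarrow> real" where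
  "warped_metric f F1 F2 =
     (\<lambda>((x1, x2), (y1, y2)). sqrt ((F1 (x1, y1))\<^sup>2 + (f x1)\<^sup>2 * (F2 (x2, y2))\<^sup>2))"

end

theory Submission
  imports Defs
begin

text \<open>
  Write \<open>L = A + f\<^sup>2 P\<close> for the local expression of the squared metric. The spray coefficients of the
  warped product are \<open>G\<^sup>i = G\<^sub>1\<^sup>i - (1/2) f f\<^sup>i P\<close> and \<open>G\<^sup>a = G\<^sub>2\<^sup>a + u y\<^sup>a\<close> with \<open>u = f\<^sub>k y\<^sup>k / f\<close>, so their
  divergence is the sum of those of the factors and of \<open>n\<^sub>2 u\<close>; as \<open>u\<close> and the divergence of the
  Riemannian spray are linear in \<open>y\<close>, the product is weakly Berwald. The Ricci curvature is
  \<open>Ric\<^sub>1 + Ric\<^sub>2 - (n\<^sub>2 / f) Hess f (y, y) - P (f \<Delta>f + (n\<^sub>2 - 1) |\<nabla>f|\<^sup>2)\<close>. In dimension one the Ricci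
  curvature of a Finsler metric vanishes by Euler's identities. If \<open>n\<^sub>2 = 1\<close>, rescaling the fibre
  direction in the Einstein equation gives \<open>\<Delta>f = - \<lambda> f\<close>; if \<open>n\<^sub>1 = 1\<close>, rescaling the base direction gives
  \<open>Hess f (y, y) = - \<lambda> f A / n\<^sub>2\<close>. In both cases \<open>f\<close> is a sub- or supersolution of an elliptic equation without
  zeroth-order term on a compact connected manifold, hence constant by the strong maximum principle.
\<close>

section \<open>Smooth functions\<close>

text \<open>The product metric is smooth only where both velocities are nonzero, so the Einstein
  equation cannot be split by setting one velocity to zero. Its terms are separated by homogeneity
  instead: doubling one velocity multiplies some terms by 4 and fixes the others, and a subtraction
  isolates the first kind. Dimension one matters here because the Ricci curvature of a factor has
  the same degree 2 in the velocity as its metric; unless it vanishes it survives the subtraction.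
  For a one-dimensional fibre the gradient square disappears as well, which leaves an equation
  linear in \<open>f\<close>. Since \<open>f > 0\<close>, the term \<open>- \<lambda> f\<close> can
  stay on the right-hand side as an inhomogeneity whose sign is that of \<open>- \<lambda>\<close>;
  this is why the operator has no zeroth-order term. The function \<open>\<lambda>\<close> may vary
  along the fibre, but one fixed fibre point already turns the equation into one on the base. The
  maximum principle is local, so each chart brings its own elliptic operator and the operators of
  different charts are never compared. Compactness provides a maximum point, and connectedness
  spreads the maximal value.\<close>

lemma frechet_derivative_eqI:
  "(h has_derivative h') (at x) \<Longrightarrow> frechet_derivative h (at x) = h'"
  using frechet_derivative_at by metis

lemma differentiable_transform_open:
  assumes "h differentiable (at x)" "open S" "x \<in> S" "\<And>y. y \<in> S \<Longrightarrow> h y = k y"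
  shows "k differentiable (at x)"
  using assms unfolding differentiable_def by (meson has_derivative_transform_within_open)

text \<open>A derivative at a point of an open set depends only on the values on that set. The
  closure rules below rest on this: they compute a derivative by a formula valid on \<open>S\<close>
  only and then transfer the class of the formula.\<close>

lemma Ck_on_cong:
  assumes "open S" "\<And>x. x \<in> S \<Longrightarrow> h x = h' x" "Ck_on k S h"
  shows "Ck_on k S h'"
  using assms(2,3)
proof (induction k arbitrary: h h')
  case 0
  then show ?case by (auto cong: continuous_on_cong)
next
  case (Suc k)
  have d: "h differentiable (at x)" if "x \<in> S" for x using Suc.prems(2) that by simp
  have "frechet_derivative h (at x) = frechet_derivative h' (at x)" if "x \<in> S" for x
    using frechet_derivative_transform_within_open[OF d[OF that] assms(1) that] Suc.prems(1) by blast
  moreover have "h' differentiable (at x)" if "x \<in> S" for x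
    using differentiable_transform_open[OF d[OF that] assms(1) that] Suc.prems(1) by blast
  ultimately show ?case
    using Suc.prems(2) Suc.IH by (metis (mono_tags, lifting) Ck_on.simps(2))
qed

lemma Ck_on_Suc_imp_Ck_on: "Ck_on (Suc k) S h \<Longrightarrow> Ck_on k S h"
proof (induction k arbitrary: h)
  case 0
  then show ?case
    by (auto intro!: continuous_at_imp_continuous_on differentiable_imp_continuous_within)
next
  case (Suc k)
  then show ?case by (metis Ck_on.simps(2))
qed

lemma Ck_on_subset: "Ck_on k S h \<Longrightarrow> T \<subseteq> S \<Longrightarrow> Ck_on k T h"
  by (induction k arbitrary: h) (auto intro: continuous_on_subset)

lemma Ck_on_const: "Ck_on k S (\<lambda>x. c)"
  by (induction k arbitrary: c) (auto simp: frechet_derivative_const)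

lemma Ck_on_bounded_linear:
  assumes "bounded_linear h" shows "Ck_on k S h"
proof (cases k)
  case 0
  then show ?thesis using linear_continuous_on[OF assms] by simp
next
  case (Suc k')
  have hd: "(h has_derivative h) (at x)" for x by (rule bounded_linear_imp_has_derivative[OF assms])
  show ?thesis
    unfolding Suc Ck_on.simps frechet_derivative_eqI[OF hd]
    using hd Ck_on_const by (blast intro: differentiableI)
qed

lemma Ck_on_add:
  assumes "open S" "Ck_on k S h" "Ck_on k S h'"
  shows "Ck_on k S (\<lambda>x. h x + h' x)"
  using assms(2,3)
proof (induction k arbitrary: h h')
  case 0
  then show ?case by (auto intro: continuous_on_add)
next
  case (Suc k)
  have "frechet_derivative (\<lambda>x. h x + h' x) (at x) v =
    frechet_derivative h (at x) v + frechet_derivative h' (at x) v" if "x \<in> S" for x v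
    using Suc.prems that
    by (subst frechet_derivative_eqI[OF has_derivative_add])
      (auto simp: frechet_derivative_works[symmetric])
  note D = this
  have "Ck_on k S (\<lambda>x. frechet_derivative (\<lambda>x. h x + h' x) (at x) v)" for v
    by (rule Ck_on_cong[OF assms(1) D[symmetric]]) (use Suc in auto)
  then show ?case using Suc.prems by (auto intro: differentiable_add)
qed

lemma Ck_on_mult:
  fixes h h' :: "'a::euclidean_space \<Rightarrow> real"
  assumes "open S" "Ck_on k S h" "Ck_on k S h'"
  shows "Ck_on k S (\<lambda>x. h x * h' x)"
  using assms(2,3)
proof (induction k arbitrary: h h')
  case 0
  then show ?case by (auto intro: continuous_on_mult)
next
  case (Suc k)
  have D: "frechet_derivative (\<lambda>x. h x * h' x) (at x) v =
    h x * frechet_derivative h' (at x) v + frechet_derivative h (at x) v * h' x" if "x \<in> S" for x v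
    using Suc.prems that
    by (subst frechet_derivative_eqI[OF has_derivative_mult])
      (auto simp: frechet_derivative_works[symmetric])
  have "Ck_on k S (\<lambda>x. h x * frechet_derivative h' (at x) v + frechet_derivative h (at x) v * h' x)" for v
    using Suc.prems Ck_on_Suc_imp_Ck_on[OF Suc.prems(1)] Ck_on_Suc_imp_Ck_on[OF Suc.prems(2)]
    by (intro Ck_on_add assms(1) Suc.IH) auto
  from Ck_on_cong[OF assms(1) D[symmetric] this] show ?case
    using Suc.prems by (auto intro: differentiable_mult)
qed

lemma Ck_on_inverse:
  fixes h :: "'a::euclidean_space \<Rightarrow> real"
  assumes "open S" "Ck_on k S h" "\<And>x. x \<in> S \<Longrightarrow> h x \<noteq> 0"
  shows "Ck_on k S (\<lambda>x. inverse (h x))"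
  using assms(2)
proof (induction k)
  case 0
  then show ?case using assms(3) by (auto intro: continuous_on_inverse)
next
  case (Suc k)
  \<comment> \<open>Written through \<open>inverse (h x)\<close> again, so that the induction
    hypothesis covers these factors.\<close>
  have D: "frechet_derivative (\<lambda>x. inverse (h x)) (at x) v =
    (-1) * (inverse (h x) * frechet_derivative h (at x) v * inverse (h x))" if "x \<in> S" for x v
  proof -
    have "(h has_derivative frechet_derivative h (at x)) (at x)"
      using Suc.prems that by (simp add: frechet_derivative_works[symmetric])
    from frechet_derivative_eqI[OF Deriv.has_derivative_inverse[OF assms(3)[OF that] this]]
    show ?thesis by simp
  qed
  have "Ck_on k S (\<lambda>x. (-1) * (inverse (h x) * frechet_derivative h (at x) v * inverse (h x)))" for v
    using Suc Ck_on_Suc_imp_Ck_on[OF Suc.prems]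
    by (intro Ck_on_mult assms(1) Ck_on_const Suc.IH) auto
  from Ck_on_cong[OF assms(1) D[symmetric] this] show ?case
    using Suc.prems assms(3) by (auto intro: differentiable_inverse)
qed

text \<open>For linear \<open>T\<close> the derivative in direction \<open>v\<close> is the
  derivative of \<open>h\<close> in the constant direction \<open>T v\<close>, composed with
  \<open>T\<close>, so the induction closes. The projections of product coordinates onto base and
  fibre are such maps.\<close>

lemma Ck_on_compose_bounded_linear:
  assumes "bounded_linear T" "open S" "T ` S \<subseteq> R" "Ck_on k R h"
  shows "Ck_on k S (\<lambda>x. h (T x))"
  using assms(4)
proof (induction k arbitrary: h)
  case 0
  then show ?case
    using assms(3) continuous_on_compose2[OF _ linear_continuous_on[OF assms(1)]] by auto
next
  case (Suc k)
  have hd: "((\<lambda>x. h (T x)) has_derivative (\<lambda>v. frechet_derivative h (at (T x)) (T v))) (at x)"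
    if "x \<in> S" for x
    using Suc.prems assms(3) that
    by (intro has_derivative_compose[OF bounded_linear_imp_has_derivative[OF assms(1)]])
      (auto simp: frechet_derivative_works[symmetric])
  have "Ck_on k S (\<lambda>x. frechet_derivative h (at (T x)) (T v))" for v
    using Suc by auto
  from Ck_on_cong[OF assms(2) _ this] have "Ck_on k S (\<lambda>x. frechet_derivative (\<lambda>x. h (T x)) (at x) v)" for v
    using frechet_derivative_eqI[OF hd] by simp
  then show ?case using hd by (auto intro: differentiableI)
qed

lemma smooth_on_cong:
  "open S \<Longrightarrow> (\<And>x. x \<in> S \<Longrightarrow> h x = h' x) \<Longrightarrow> smooth_on S h \<Longrightarrow> smooth_on S h'"
  unfolding smooth_on_def using Ck_on_cong by blast

lemma smooth_on_subset: "smooth_on S h \<Longrightarrow> T \<subseteq> S \<Longrightarrow> smooth_on T h"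
  unfolding smooth_on_def using Ck_on_subset by blast

lemma smooth_on_differentiable: "smooth_on S h \<Longrightarrow> x \<in> S \<Longrightarrow> h differentiable (at x)"
  unfolding smooth_on_def by (metis Ck_on.simps(2))

lemma smooth_on_continuous_on: "smooth_on S h \<Longrightarrow> continuous_on S h"
  unfolding smooth_on_def by (metis Ck_on.simps(1))

lemma smooth_on_frechet_derivative:
  "smooth_on S h \<Longrightarrow> smooth_on S (\<lambda>x. frechet_derivative h (at x) v)"
  unfolding smooth_on_def by (metis Ck_on.simps(2))

lemma smooth_on_const: "smooth_on S (\<lambda>x. c)"
  unfolding smooth_on_def using Ck_on_const by blast

lemma smooth_on_bounded_linear: "bounded_linear h \<Longrightarrow> smooth_on S h"
  unfolding smooth_on_def using Ck_on_bounded_linear by blast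

lemma smooth_on_add:
  "open S \<Longrightarrow> smooth_on S h \<Longrightarrow> smooth_on S h' \<Longrightarrow> smooth_on S (\<lambda>x. h x + h' x)"
  unfolding smooth_on_def using Ck_on_add by blast

lemma smooth_on_mult:
  fixes h h' :: "'a::euclidean_space \<Rightarrow> real"
  shows "open S \<Longrightarrow> smooth_on S h \<Longrightarrow> smooth_on S h' \<Longrightarrow> smooth_on S (\<lambda>x. h x * h' x)"
  unfolding smooth_on_def using Ck_on_mult by blast

lemma smooth_on_minus:
  fixes h :: "'a::euclidean_space \<Rightarrow> real"
  shows "open S \<Longrightarrow> smooth_on S h \<Longrightarrow> smooth_on S (\<lambda>x. - h x)"
  using smooth_on_mult[OF _ smooth_on_const[of S "-1"], of h] by simp

lemma smooth_on_diff:
  fixes h h' :: "'a::euclidean_space \<Rightarrow> real"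
  shows "open S \<Longrightarrow> smooth_on S h \<Longrightarrow> smooth_on S h' \<Longrightarrow> smooth_on S (\<lambda>x. h x - h' x)"
  using smooth_on_add[OF _ _ smooth_on_minus, of S h h'] by simp

lemma smooth_on_power:
  fixes h :: "'a::euclidean_space \<Rightarrow> real"
  shows "open S \<Longrightarrow> smooth_on S h \<Longrightarrow> smooth_on S (\<lambda>x. h x ^ n)"
  by (induction n) (auto intro: smooth_on_const smooth_on_mult)

lemma smooth_on_sum:
  "open S \<Longrightarrow> (\<And>i. i \<in> I \<Longrightarrow> smooth_on S (h i)) \<Longrightarrow> smooth_on S (\<lambda>x. \<Sum>i\<in>I. h i x)"
  by (induction I rule: infinite_finite_induct) (auto intro: smooth_on_const smooth_on_add)

lemma smooth_on_inverse:
  fixes h :: "'a::euclidean_space \<Rightarrow> real"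
  shows "open S \<Longrightarrow> smooth_on S h \<Longrightarrow> (\<And>x. x \<in> S \<Longrightarrow> h x \<noteq> 0) \<Longrightarrow> smooth_on S (\<lambda>x. inverse (h x))"
  unfolding smooth_on_def using Ck_on_inverse by blast

lemma smooth_on_divide:
  fixes h :: "'a::euclidean_space \<Rightarrow> real"
  assumes "open S" "smooth_on S h" "smooth_on S h'" "\<And>x. x \<in> S \<Longrightarrow> h' x \<noteq> 0"
  shows "smooth_on S (\<lambda>x. h x / h' x)"
  using smooth_on_mult[OF assms(1,2) smooth_on_inverse[OF assms(1,3,4)]]
  by (simp add: divide_inverse)

lemma smooth_on_compose_bounded_linear:
  "bounded_linear T \<Longrightarrow> open S \<Longrightarrow> T ` S \<subseteq> R \<Longrightarrow> smooth_on R h \<Longrightarrow> smooth_on S (\<lambda>x. h (T x))"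
  unfolding smooth_on_def using Ck_on_compose_bounded_linear by blast

section \<open>Inverse matrices\<close>

text \<open>Since \<open>q\<close> vanishes at \<open>z\<close>, the increment of \<open>p\<close>
  enters only multiplied by a quantity of first order, so continuity of \<open>p\<close> suffices.
  This makes inverse matrices differentiable at a stage where their entries are known only to be
  continuous.\<close>

lemma has_derivative_mult_vanishing:
  fixes p q :: "'a::real_normed_vector \<Rightarrow> real"
  assumes p: "continuous (at z) p" and q: "(q has_derivative q') (at z)" and q0: "q z = 0"
  shows "((\<lambda>w. p w * q w) has_derivative (\<lambda>v. p z * q' v)) (at z)"
proof -
  have bl: "bounded_linear q'" using q by (rule has_derivative_bounded_linear)
  have lim: "((\<lambda>w. (q w - q' (w - z)) / norm (w - z)) \<longlongrightarrow> 0) (at z)"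
    by (rule tendsto_norm_zero_cancel) (use q q0 in \<open>simp add: has_derivative_iff_norm norm_divide\<close>)
  obtain K where K: "\<And>v. norm (q' v) \<le> norm v * K" using bounded_linear.bounded[OF bl] by blast
  have pz: "((\<lambda>w. p w - p z) \<longlongrightarrow> 0) (at z)"
    using p by (simp add: continuous_at LIM_zero isCont_def)
  have A: "((\<lambda>w. p w * ((q w - q' (w - z)) / norm (w - z))) \<longlongrightarrow> p z * 0) (at z)"
    using p lim by (intro tendsto_mult) (auto simp: continuous_at isCont_def)
  have B: "((\<lambda>w. (p w - p z) * (q' (w - z) / norm (w - z))) \<longlongrightarrow> 0) (at z)"
  proof (rule Lim_null_comparison)
    show "((\<lambda>w. norm (p w - p z) * \<bar>K\<bar>) \<longlongrightarrow> 0) (at z)"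
      using tendsto_mult_left_zero[OF tendsto_norm_zero[OF pz]] by simp
    have "norm (q' (w - z) / norm (w - z)) \<le> \<bar>K\<bar>" for w
    proof (cases "w = z")
      case False
      have "norm (q' (w - z)) \<le> norm (w - z) * \<bar>K\<bar>"
        using K[of "w - z"] by (smt (verit, best) mult_left_mono norm_ge_zero)
      then show ?thesis using False by (simp add: norm_divide divide_le_eq mult.commute)
    qed (auto simp: linear_0[OF bounded_linear.linear[OF bl]])
    then show "\<forall>\<^sub>F w in at z. norm ((p w - p z) * (q' (w - z) / norm (w - z))) \<le> norm (p w - p z) * \<bar>K\<bar>"
      unfolding norm_mult by (intro always_eventually allI mult_left_mono) auto
  qed
  have "((\<lambda>w. (p w * q w - p z * q z - p z * q' (w - z)) / norm (w - z)) \<longlongrightarrow> 0) (at z)"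
    by (rule tendsto_eq_rhs[OF tendsto_cong[THEN iffD1, OF _ tendsto_add[OF A B]]])
      (auto intro!: always_eventually simp: q0 diff_divide_distrib left_diff_distrib right_diff_distrib)
  then have "((\<lambda>w. norm (p w * q w - p z * q z - p z * q' (w - z)) / norm (w - z)) \<longlongrightarrow> 0) (at z)"
    using tendsto_norm_zero by (fastforce simp: norm_divide)
  then show ?thesis
    unfolding has_derivative_iff_norm by (auto intro: bounded_linear_const_mult[OF bl])
qed

definition matrix_map :: "('e::euclidean_space \<Rightarrow> 'e \<Rightarrow> real) \<Rightarrow> 'e \<Rightarrow> 'e" where
  "matrix_map m v = (\<Sum>a\<in>Basis. \<Sum>b\<in>Basis. (m a b * (v \<bullet> b)) *\<^sub>R a)"

lemma linear_matrix_map: "linear (matrix_map m)"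
  unfolding matrix_map_def
  by (rule linearI)
    (simp_all add: inner_add_left algebra_simps scaleR_add_left sum.distrib scaleR_sum_right)

lemma matrix_map_inner: "i \<in> Basis \<Longrightarrow> matrix_map m v \<bullet> i = (\<Sum>b\<in>Basis. m i b * (v \<bullet> b))"
  unfolding matrix_map_def scaleR_sum_left[symmetric] by simp

lemma norm_matrix_map_le: "norm (matrix_map m v) \<le> (\<Sum>a\<in>Basis. \<Sum>b\<in>Basis. \<bar>m a b\<bar>) * norm v"
proof -
  have "norm (matrix_map m v) \<le> (\<Sum>a\<in>Basis. \<Sum>b\<in>Basis. norm ((m a b * (v \<bullet> b)) *\<^sub>R (a::'a)))"
    unfolding matrix_map_def by (intro order.trans[OF norm_sum] sum_mono norm_sum)
  also have "\<dots> \<le> (\<Sum>a\<in>Basis. \<Sum>b\<in>(Basis::'a set). \<bar>m a b\<bar> * norm v)"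
    by (intro sum_mono) (auto simp: abs_mult Basis_le_norm intro!: mult_left_mono)
  finally show ?thesis by (simp add: sum_distrib_right)
qed

lemma matrix_map_diff: "matrix_map m v - matrix_map m' v = matrix_map (\<lambda>a b. m a b - m' a b) v"
  unfolding matrix_map_def
  by (simp add: algebra_simps scaleR_left.diff sum_subtractf)

lemma inj_matrix_map_imp_bij: "inj (matrix_map m) \<Longrightarrow> bij (matrix_map m)"
  by (simp add: bij_def linear_injective_imp_surjective linear_matrix_map)

lemma linear_inv_matrix_map: "inj (matrix_map m) \<Longrightarrow> linear (inv (matrix_map m))"
  by (metis inj_linear_imp_inv_linear linear_matrix_map)

context
  fixes m :: "'z::euclidean_space \<Rightarrow> 'e::euclidean_space \<Rightarrow> 'e \<Rightarrow> real" and S :: "'z set"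
  assumes S: "open S" and inj: "\<And>z. z \<in> S \<Longrightarrow> inj (matrix_map (m z))"
begin

text \<open>The identity \<open>N(w) - N(z) = - N(w) (M(w) - M(z)) N(z)\<close> for inverse
  matrices, in entries. Continuity, differentiability and smoothness of the inverse are all derived
  from it, in this order and without determinants.\<close>

lemma inv_matrix_map_diff:
  assumes "z \<in> S" "w \<in> S"
  shows "inv (matrix_map (m w)) l \<bullet> i - inv (matrix_map (m z)) l \<bullet> i =
    - (\<Sum>a\<in>Basis. \<Sum>b\<in>Basis. (inv (matrix_map (m w)) a \<bullet> i) *
         ((m w a b - m z a b) * (inv (matrix_map (m z)) l \<bullet> b)))"
proof -
  let ?n = "\<lambda>z. inv (matrix_map (m z))"
  have lin: "linear (?n w)" using linear_inv_matrix_map inj assms by blast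
  have s: "matrix_map (m z) (?n z l) = l"
    using inj_matrix_map_imp_bij[OF inj[OF assms(1)]] by (simp add: bij_is_surj surj_f_inv_f)
  have "?n w (matrix_map (m w) (?n z l)) = ?n z l" using inj[OF assms(2)] by simp
  then have "?n w l - ?n z l = - ?n w (matrix_map (m w) (?n z l) - matrix_map (m z) (?n z l))"
    using s linear_diff[OF lin] by simp
  also have "\<dots> = - (\<Sum>a\<in>Basis. \<Sum>b\<in>Basis. ((m w a b - m z a b) * (?n z l \<bullet> b)) *\<^sub>R ?n w a)"
    unfolding matrix_map_diff
    by (simp add: matrix_map_def linear_sum[OF lin] linear_scale[OF lin])
  finally have "(?n w l - ?n z l) \<bullet> i = (- (\<Sum>a\<in>Basis. \<Sum>b\<in>Basis. ((m w a b - m z a b) * (?n z l \<bullet> b)) *\<^sub>R ?n w a)) \<bullet> i"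
    by simp
  then show ?thesis
    by (simp add: inner_diff_left inner_sum_left mult_ac)
qed

text \<open>Injectivity gives \<open>B * norm v \<le> norm (M v)\<close> at \<open>z\<close>. A
  perturbation of the entries smaller than \<open>B / 2\<close> uses up at most half of this bound,
  so the inverses near \<open>z\<close> are bounded by \<open>2 / B\<close>, and the difference
  formula tends to zero.\<close>

lemma continuous_inv_matrix_map:
  assumes z: "z \<in> S" and cont: "\<And>a b. a \<in> Basis \<Longrightarrow> b \<in> Basis \<Longrightarrow> continuous (at z) (\<lambda>w. m w a b)"
  shows "continuous (at z) (\<lambda>w. inv (matrix_map (m w)) l \<bullet> i)"
proof -
  let ?n = "\<lambda>z. inv (matrix_map (m z))"
  let ?d = "\<lambda>w. \<Sum>a\<in>Basis. \<Sum>b\<in>Basis. \<bar>m w a b - m z a b\<bar>"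
  have mt: "((\<lambda>w. m w a b - m z a b) \<longlongrightarrow> 0) (at z)" if "a \<in> Basis" "b \<in> Basis" for a b
    using cont[OF that] by (simp add: continuous_at LIM_zero isCont_def)
  have d0: "(?d \<longlongrightarrow> 0) (at z)"
    by (rule tendsto_eq_rhs, rule tendsto_sum, rule tendsto_sum, rule tendsto_rabs_zero[OF mt]) auto
  obtain B where B: "B > 0" "\<And>v. B * norm v \<le> norm (matrix_map (m z) v)"
    using linear_inj_bounded_below_pos[OF linear_matrix_map inj[OF z]] by blast
  have ev: "\<forall>\<^sub>F w in at z. w \<in> S \<and> ?d w < B / 2"
  proof (rule eventually_conj)
    show "\<forall>\<^sub>F w in at z. w \<in> S" using S z by (rule eventually_at_in_open')
    show "\<forall>\<^sub>F w in at z. ?d w < B / 2" using order_tendstoD(2)[OF d0, of "B/2"] B(1) by simp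
  qed
  have bd: "norm (?n w a) \<le> 2 / B * norm a" if "w \<in> S" "?d w < B / 2" for w a
  proof -
    have "B * norm (?n w a) \<le> norm (matrix_map (m z) (?n w a))" by (rule B)
    also have "\<dots> \<le> norm (matrix_map (m w) (?n w a)) + norm (matrix_map (m w) (?n w a) - matrix_map (m z) (?n w a))"
      by norm
    also have "matrix_map (m w) (?n w a) = a"
      using inj_matrix_map_imp_bij[OF inj[OF that(1)]] by (simp add: bij_is_surj surj_f_inv_f)
    also have "norm (a - matrix_map (m z) (?n w a)) \<le> ?d w * norm (?n w a)"
      using norm_matrix_map_le[of "\<lambda>a b. m w a b - m z a b" "?n w a"] \<open>matrix_map (m w) (?n w a) = a\<close>
      by (simp add: matrix_map_diff[symmetric])
    also have "\<dots> \<le> B / 2 * norm (?n w a)" using that(2) by (intro mult_right_mono) auto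
    finally have "B / 2 * norm (?n w a) \<le> norm a" by (simp add: algebra_simps)
    then show ?thesis using B(1) by (simp add: field_simps)
  qed
  have t0: "((\<lambda>w. (?n w a \<bullet> i) * ((m w a b - m z a b) * c)) \<longlongrightarrow> 0) (at z)"
    if ab: "a \<in> Basis" "b \<in> Basis" for a b c
  proof (rule Lim_null_comparison)
    show "((\<lambda>w. (2 / B * norm a * norm i) * norm ((m w a b - m z a b) * c)) \<longlongrightarrow> 0) (at z)"
      by (intro tendsto_mult_right_zero tendsto_norm_zero tendsto_mult_left_zero mt ab)
    show "\<forall>\<^sub>F w in at z. norm ((?n w a \<bullet> i) * ((m w a b - m z a b) * c)) \<le>
        (2 / B * norm a * norm i) * norm ((m w a b - m z a b) * c)"
      using ev
    proof (rule eventually_mono)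
      fix w assume w: "w \<in> S \<and> ?d w < B / 2"
      have "norm (?n w a \<bullet> i) \<le> norm (?n w a) * norm i" by (simp add: Cauchy_Schwarz_ineq2)
      also have "\<dots> \<le> 2 / B * norm a * norm i" using bd[of w a] w by (intro mult_right_mono) auto
      finally show "norm ((?n w a \<bullet> i) * ((m w a b - m z a b) * c)) \<le>
        (2 / B * norm a * norm i) * norm ((m w a b - m z a b) * c)"
        unfolding norm_mult by (intro mult_right_mono) auto
    qed
  qed
  have "((\<lambda>w. - (\<Sum>a\<in>Basis. \<Sum>b\<in>Basis. (?n w a \<bullet> i) * ((m w a b - m z a b) * (?n z l \<bullet> b)))) \<longlongrightarrow> 0) (at z)"
    by (rule tendsto_eq_rhs, rule tendsto_minus, rule tendsto_sum, rule tendsto_sum, rule t0) auto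
  then have "((\<lambda>w. ?n w l \<bullet> i - ?n z l \<bullet> i) \<longlongrightarrow> 0) (at z)"
  proof (rule Lim_transform_eventually)
    show "\<forall>\<^sub>F w in at z. - (\<Sum>a\<in>Basis. \<Sum>b\<in>Basis. (?n w a \<bullet> i) * ((m w a b - m z a b) * (?n z l \<bullet> b))) = ?n w l \<bullet> i - ?n z l \<bullet> i"
      using ev inv_matrix_map_diff[OF z] by (auto elim: eventually_mono)
  qed
  then show ?thesis using LIM_zero_cancel by (auto simp: continuous_at isCont_def)
qed

text \<open>In the difference formula the inverse at \<open>w\<close> is so far only continuous, but
  it is multiplied by \<open>m w a b - m z a b\<close>, which vanishes at \<open>z\<close>.\<close>

lemma has_derivative_inv_matrix_map:
  assumes z: "z \<in> S"
    and diff: "\<And>a b. a \<in> Basis \<Longrightarrow> b \<in> Basis \<Longrightarrow> (\<lambda>w. m w a b) differentiable (at z)"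
  shows "((\<lambda>w. inv (matrix_map (m w)) l \<bullet> i) has_derivative
    (\<lambda>v. - (\<Sum>a\<in>Basis. \<Sum>b\<in>Basis. (inv (matrix_map (m z)) a \<bullet> i) *
         (frechet_derivative (\<lambda>w. m w a b) (at z) v * (inv (matrix_map (m z)) l \<bullet> b))))) (at z)"
    (is "(?h has_derivative ?h') _")
proof -
  let ?n = "\<lambda>z. inv (matrix_map (m z))"
  let ?r = "\<lambda>w. ?n z l \<bullet> i + - (\<Sum>a\<in>Basis. \<Sum>b\<in>Basis. (?n w a \<bullet> i) * ((m w a b - m z a b) * (?n z l \<bullet> b)))"
  have c: "continuous (at z) (\<lambda>w. ?n w a \<bullet> i)" for a
    using diff by (intro continuous_inv_matrix_map z differentiable_imp_continuous_within)
  have p: "((\<lambda>w. (?n w a \<bullet> i) * ((m w a b - m z a b) * (?n z l \<bullet> b))) has_derivative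
    (\<lambda>v. (?n z a \<bullet> i) * (frechet_derivative (\<lambda>w. m w a b) (at z) v * (?n z l \<bullet> b)))) (at z)"
    if "a \<in> Basis" "b \<in> Basis" for a b
  proof (rule has_derivative_mult_vanishing[OF c])
    show "((\<lambda>w. (m w a b - m z a b) * (?n z l \<bullet> b)) has_derivative
      (\<lambda>v. frechet_derivative (\<lambda>w. m w a b) (at z) v * (?n z l \<bullet> b))) (at z)"
      using diff[OF that, unfolded frechet_derivative_works]
      by (auto intro!: derivative_eq_intros)
  qed simp
  have "(?r has_derivative (\<lambda>v. 0 + ?h' v)) (at z)"
    by (intro has_derivative_add has_derivative_const has_derivative_minus has_derivative_sum p)
  then show ?thesis
    by (rule has_derivative_transform_within_open[OF _ S z, THEN has_derivative_eq_rhs])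
      (use inv_matrix_map_diff[OF z] in \<open>auto simp: algebra_simps\<close>)
qed

text \<open>The derivative is a polynomial in entries of the inverse and derivatives of
  \<open>m\<close>, so class \<open>k\<close> for all entries at once yields class
  \<open>k + 1\<close>.\<close>

lemma smooth_on_inv_matrix_map:
  assumes sm: "\<And>a b. a \<in> Basis \<Longrightarrow> b \<in> Basis \<Longrightarrow> smooth_on S (\<lambda>w. m w a b)"
  shows "smooth_on S (\<lambda>w. inv (matrix_map (m w)) l \<bullet> i)"
  unfolding smooth_on_def
proof
  fix k
  have hd: "((\<lambda>w. inv (matrix_map (m w)) l \<bullet> i) has_derivative
    (\<lambda>v. - (\<Sum>a\<in>Basis. \<Sum>b\<in>Basis. (inv (matrix_map (m z)) a \<bullet> i) *
         (frechet_derivative (\<lambda>w. m w a b) (at z) v * (inv (matrix_map (m z)) l \<bullet> b))))) (at z)"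
    if "z \<in> S" for z l i
    by (rule has_derivative_inv_matrix_map[OF that smooth_on_differentiable[OF sm that]])
  have Ck_sum: "Ck_on k S (\<lambda>x. \<Sum>i\<in>I. h i x)" if "\<And>i. i \<in> I \<Longrightarrow> Ck_on k S (h i)"
    for k and I :: "'e set" and h :: "'e \<Rightarrow> 'z \<Rightarrow> real"
    using that by (induction I rule: infinite_finite_induct) (auto intro: Ck_on_const Ck_on_add S)
  show "Ck_on k S (\<lambda>w. inv (matrix_map (m w)) l \<bullet> i)"
  proof (induction k arbitrary: l i)
    case 0
    then show ?case
      using hd by (auto intro!: continuous_at_imp_continuous_on has_derivative_continuous)
  next
    case (Suc k)
    have "Ck_on k S (\<lambda>z. (-1) * (\<Sum>a\<in>Basis. \<Sum>b\<in>Basis. (inv (matrix_map (m z)) a \<bullet> i) *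
         (frechet_derivative (\<lambda>w. m w a b) (at z) v * (inv (matrix_map (m z)) l \<bullet> b))))" for v
      using sm[THEN smooth_on_frechet_derivative] unfolding smooth_on_def
      by (intro Ck_on_mult Ck_on_const S Ck_sum Suc.IH) auto
    from Ck_on_cong[OF S _ this]
    have "Ck_on k S (\<lambda>z. frechet_derivative (\<lambda>w. inv (matrix_map (m w)) l \<bullet> i) (at z) v)" for v
      using frechet_derivative_eqI[OF hd] by simp
    then show ?case using differentiableI[OF hd] by simp
  qed
qed

end

section \<open>Partial derivatives\<close>

text \<open>Both functions have the same derivatives at \<open>z\<close>, possibly none, and
  \<open>frechet_derivative\<close> chooses from that set; hence no differentiability is
  assumed.\<close>

lemma frechet_derivative_cong_open:
  assumes "open S" "z \<in> S" "\<And>w. w \<in> S \<Longrightarrow> H w = K w"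
  shows "frechet_derivative H (at z) = frechet_derivative K (at z)"
proof -
  have "(H has_derivative D) (at z) \<longleftrightarrow> (K has_derivative D) (at z)" for D
    using has_derivative_transform_within_open[OF _ assms(1,2), of H D UNIV K]
      has_derivative_transform_within_open[OF _ assms(1,2), of K D UNIV H] assms(3) by auto
  then show ?thesis unfolding frechet_derivative_def by simp
qed

lemma pdx_cong:
  "open S \<Longrightarrow> z \<in> S \<Longrightarrow> (\<And>w. w \<in> S \<Longrightarrow> H w = K w) \<Longrightarrow> pdx i H z = pdx i K z"
  unfolding pdx_def using frechet_derivative_cong_open by metis

lemma pdy_cong:
  "open S \<Longrightarrow> z \<in> S \<Longrightarrow> (\<And>w. w \<in> S \<Longrightarrow> H w = K w) \<Longrightarrow> pdy i H z = pdy i K z"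
  unfolding pdy_def using frechet_derivative_cong_open by metis

context
  fixes H K :: "'a::euclidean_space \<Rightarrow> real" and z :: 'a
  assumes H: "H differentiable (at z)" and K: "K differentiable (at z)"
begin

lemma frechet_derivative_add:
  "frechet_derivative (\<lambda>w. H w + K w) (at z) v = frechet_derivative H (at z) v + frechet_derivative K (at z) v"
  using frechet_derivative_eqI[OF has_derivative_add[OF H[unfolded frechet_derivative_works] K[unfolded frechet_derivative_works]]]
  by simp

lemma frechet_derivative_mult:
  "frechet_derivative (\<lambda>w. H w * K w) (at z) v = H z * frechet_derivative K (at z) v + frechet_derivative H (at z) v * K z"
  using frechet_derivative_eqI[OF has_derivative_mult[OF H[unfolded frechet_derivative_works] K[unfolded frechet_derivative_works]]]
  by simp

end

lemma frechet_derivative_sum: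
  fixes H :: "'i \<Rightarrow> 'a::euclidean_space \<Rightarrow> real"
  assumes "\<And>i. i \<in> I \<Longrightarrow> H i differentiable (at z)"
  shows "frechet_derivative (\<lambda>w. \<Sum>i\<in>I. H i w) (at z) v = (\<Sum>i\<in>I. frechet_derivative (H i) (at z) v)"
proof -
  have "((\<lambda>w. \<Sum>i\<in>I. H i w) has_derivative (\<lambda>v. \<Sum>i\<in>I. frechet_derivative (H i) (at z) v)) (at z)"
    using assms by (intro has_derivative_sum) (simp add: frechet_derivative_works)
  from frechet_derivative_eqI[OF this] show ?thesis by simp
qed

lemmas pd_add = frechet_derivative_add[where v = "(i, 0 :: 'e)" for i :: "'e::euclidean_space", folded pdx_def]
  frechet_derivative_add[where v = "(0 :: 'e, i)" for i :: "'e::euclidean_space", folded pdy_def]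
lemmas pd_mult = frechet_derivative_mult[where v = "(i, 0 :: 'e)" for i :: "'e::euclidean_space", folded pdx_def]
  frechet_derivative_mult[where v = "(0 :: 'e, i)" for i :: "'e::euclidean_space", folded pdy_def]
lemmas pd_sum = frechet_derivative_sum[where v = "(i, 0 :: 'e)" for i :: "'e::euclidean_space", folded pdx_def]
  frechet_derivative_sum[where v = "(0 :: 'e, i)" for i :: "'e::euclidean_space", folded pdy_def]
lemma pd_const [simp]: "pdx i (\<lambda>w. c) z = 0" "pdy i (\<lambda>w. c) z = 0"
  by (simp_all add: pdx_def pdy_def)

lemma pd_cmult:
  fixes H :: "'a::euclidean_space \<times> 'a \<Rightarrow> real"
  assumes "H differentiable (at z)"
  shows "pdx i (\<lambda>w. c * H w) z = c * pdx i H z" "pdy i (\<lambda>w. c * H w) z = c * pdy i H z"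
  using pd_mult[where i = i and H = "\<lambda>_. c", OF differentiable_const assms] by simp_all

lemma pd_fibre_coord [simp]:
  "pdx i (\<lambda>w. snd w \<bullet> j) z = 0" "pdy i (\<lambda>w. snd w \<bullet> j) z = i \<bullet> j"
proof -
  have "((\<lambda>w. snd w \<bullet> j) has_derivative (\<lambda>v. snd v \<bullet> j)) (at z)"
    by (auto intro!: derivative_eq_intros)
  from frechet_derivative_eqI[OF this]
  show "pdx i (\<lambda>w. snd w \<bullet> j) z = 0" "pdy i (\<lambda>w. snd w \<bullet> j) z = i \<bullet> j"
    by (simp_all add: pdx_def pdy_def)
qed

lemma smooth_on_pdx: "smooth_on S H \<Longrightarrow> smooth_on S (pdx i H)"
  unfolding pdx_def[abs_def] by (rule smooth_on_frechet_derivative)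

lemma smooth_on_pdy: "smooth_on S H \<Longrightarrow> smooth_on S (pdy i H)"
  unfolding pdy_def[abs_def] by (rule smooth_on_frechet_derivative)

lemma smooth_on_fibre_coord: "smooth_on S (\<lambda>w. snd w \<bullet> j)"
  by (rule smooth_on_bounded_linear[OF bounded_linear_compose[OF bounded_linear_inner_left bounded_linear_snd]])

lemma smooth_on_base:
  assumes "open S" "fst ` S \<subseteq> U" "smooth_on U h"
  shows "smooth_on S (\<lambda>w. h (fst w))"
  by (rule smooth_on_compose_bounded_linear[OF bounded_linear_fst assms])

lemmas smooth_intros = smooth_on_const smooth_on_add smooth_on_diff smooth_on_minus smooth_on_mult smooth_on_power
  smooth_on_sum smooth_on_divide smooth_on_pdx smooth_on_pdy smooth_on_fibre_coord

text \<open>Positive homogeneity in the fibre, away from the zero section, where a Finsler metric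
  need not be smooth.\<close>

definition homogeneous_on :: "nat \<Rightarrow> 'e::euclidean_space set \<Rightarrow> ('e \<times> 'e \<Rightarrow> real) \<Rightarrow> bool" where
  "homogeneous_on k U H \<longleftrightarrow> (\<forall>x\<in>U. \<forall>y. \<forall>t>0. y \<noteq> 0 \<longrightarrow> H (x, t *\<^sub>R y) = t ^ k * H (x, y))"

lemma homogeneous_onD:
  "homogeneous_on k U H \<Longrightarrow> x \<in> U \<Longrightarrow> y \<noteq> 0 \<Longrightarrow> t > 0 \<Longrightarrow> H (x, t *\<^sub>R y) = t ^ k * H (x, y)"
  by (simp add: homogeneous_on_def)

text \<open>Differentiate both sides of the homogeneity relation at \<open>(x, y)\<close>. The fibre
  part of the direction is scaled too: \<open>v = 0\<close> shows that \<open>pdx\<close> keeps the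
  degree, \<open>u = 0\<close> that \<open>pdy\<close> lowers it by one.\<close>

lemma frechet_derivative_homogeneous:
  assumes U: "open U" and H: "smooth_on (U \<times> - {0}) H" "homogeneous_on k U H"
    and z: "x \<in> U" "y \<noteq> 0" "t > 0"
  shows "frechet_derivative H (at (x, t *\<^sub>R y)) (u, t *\<^sub>R v) = t ^ k * frechet_derivative H (at (x, y)) (u, v)"
proof -
  let ?T = "\<lambda>w::'a \<times> 'a. (fst w, t *\<^sub>R snd w)"
  have bl: "bounded_linear ?T" 
    by (intro bounded_linear_Pair bounded_linear_fst bounded_linear_compose[OF bounded_linear_scaleR_right bounded_linear_snd])
  have oW: "open (U \<times> - {0::'a})" using U by (intro open_Times open_Compl) auto
  have d: "H differentiable (at (x, t *\<^sub>R y))" "H differentiable (at (x, y))"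
    using smooth_on_differentiable[OF H(1)] z by auto
  have "((\<lambda>w. H (?T w)) has_derivative (\<lambda>v. frechet_derivative H (at (?T (x, y))) (?T v))) (at (x, y))"
    using d by (intro has_derivative_compose[OF bounded_linear_imp_has_derivative[OF bl]])
      (simp add: frechet_derivative_works[symmetric])
  moreover have "((\<lambda>w. t ^ k * H w) has_derivative (\<lambda>v. t ^ k * frechet_derivative H (at (x, y)) v)) (at (x, y))"
    using d(2) by (intro has_derivative_mult_right) (simp add: frechet_derivative_works[symmetric])
  moreover have "H (?T w) = t ^ k * H w" if "w \<in> U \<times> - {0}" for w
    using that homogeneous_onD[OF H(2), of "fst w" "snd w", OF _ _ z(3)] by (simp add: mem_Times_iff)
  ultimately show ?thesis
    using frechet_derivative_cong_open[OF oW, of "(x, y)" "\<lambda>w. H (?T w)" "\<lambda>w. t ^ k * H w"] z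
    by (auto simp: frechet_derivative_eqI fun_eq_iff)
qed

lemma homogeneous_on_pdx:
  assumes "open U" "smooth_on (U \<times> - {0}) H" "homogeneous_on k U H"
  shows "homogeneous_on k U (pdx i H)"
  unfolding homogeneous_on_def pdx_def
  using frechet_derivative_homogeneous[OF assms, of _ _ _ i 0] by simp

lemma homogeneous_on_pdy:
  assumes "open U" "smooth_on (U \<times> - {0}) H" "homogeneous_on (Suc k) U H"
  shows "homogeneous_on k U (pdy i H)"
  unfolding homogeneous_on_def pdy_def
proof (intro ballI allI impI)
  fix x y :: 'a and t :: real assume z: "x \<in> U" "0 < t" "y \<noteq> 0"
  have "linear (frechet_derivative H (at (x, t *\<^sub>R y)))"
    using z by (intro linear_frechet_derivative smooth_on_differentiable[OF assms(2)]) auto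
  from linear_scale[OF this, of t "(0, i)"]
  have "t * frechet_derivative H (at (x, t *\<^sub>R y)) (0, i) = t * (t ^ k * frechet_derivative H (at (x, y)) (0, i))"
    using frechet_derivative_homogeneous[OF assms z(1,3,2), of 0 i] by (auto simp: mult.assoc)
  then show "frechet_derivative H (at (x, t *\<^sub>R y)) (0, i) = t ^ k * frechet_derivative H (at (x, y)) (0, i)"
    using z(2) by (subst (asm) mult_left_cancel) auto
qed

lemma euler_identity:
  assumes H: "smooth_on (U \<times> - {0}) H" "homogeneous_on k U H" and z: "x \<in> U" "y \<noteq> 0"
  shows "(\<Sum>i\<in>Basis. (y \<bullet> i) * pdy i H (x, y)) = real k * H (x, y)"
proof -
  have d: "H differentiable (at (x, y))" using smooth_on_differentiable[OF H(1)] z by auto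
  have "((\<lambda>s::real. H (x, s *\<^sub>R y)) has_derivative (\<lambda>s. frechet_derivative H (at (x, 1 *\<^sub>R y)) (0, s *\<^sub>R y))) (at 1)"
  proof (rule has_derivative_compose[where f = "\<lambda>s. (x, s *\<^sub>R y)" and f' = "\<lambda>s. (0, s *\<^sub>R y)"])
    show "((\<lambda>s::real. (x, s *\<^sub>R y)) has_derivative (\<lambda>s. (0, s *\<^sub>R y))) (at 1)"
      by (auto intro!: derivative_eq_intros)
    show "(H has_derivative frechet_derivative H (at (x, 1 *\<^sub>R y))) (at (x, 1 *\<^sub>R y))"
      using d by (simp add: frechet_derivative_works[symmetric])
  qed
  moreover have "((\<lambda>s::real. s ^ k * H (x, y)) has_derivative (\<lambda>s. s * real k * H (x, y))) (at 1)"
    by (auto intro!: derivative_eq_intros)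
  moreover have "H (x, s *\<^sub>R y) = s ^ k * H (x, y)" if "s \<in> {0<..}" for s
    using that z H(2) by (auto simp: homogeneous_on_def)
  ultimately have "frechet_derivative H (at (x, y)) (0, 1 *\<^sub>R y) = 1 * real k * H (x, y)"
    using frechet_derivative_cong_open[of "{0<..}" 1 "\<lambda>s. H (x, s *\<^sub>R y)" "\<lambda>s. s ^ k * H (x, y)"]
    by (auto simp: frechet_derivative_eqI fun_eq_iff dest: spec[where x = 1])
  moreover have "frechet_derivative H (at (x, y)) (0, y) = (\<Sum>i\<in>Basis. (y \<bullet> i) * pdy i H (x, y))"
  proof -
    have lin: "linear (frechet_derivative H (at (x, y)))" by (rule linear_frechet_derivative[OF d])
    have "(0, y) = (\<Sum>i\<in>Basis. (y \<bullet> i) *\<^sub>R (0::'a, i))"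
      by (simp add: prod_eq_iff fst_sum snd_sum euclidean_representation)
    then show ?thesis
      by (simp only: linear_sum[OF lin] linear_scale[OF lin] pdy_def real_scaleR_def)
  qed
  ultimately show ?thesis by simp
qed

section \<open>Finsler metrics in a coordinate domain\<close>

lemma fund_tensor_inv_eq:
  "fund_tensor_inv L i l z = inv (matrix_map (\<lambda>a b. fund_tensor L a b z)) l \<bullet> i"
  unfolding fund_tensor_inv_def matrix_map_def[abs_def] ..

lemma inj_matrix_map_pos:
  assumes "\<And>v. v \<noteq> 0 \<Longrightarrow> (\<Sum>i\<in>Basis. \<Sum>j\<in>Basis. m i j * (v \<bullet> i) * (v \<bullet> j)) > 0"
  shows "inj (matrix_map m)"
proof (subst linear_injective_0[OF linear_matrix_map], intro allI impI, rule ccontr)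
  fix v assume v: "matrix_map m v = 0" "v \<noteq> 0"
  have "0 = (\<Sum>i\<in>Basis. (v \<bullet> i) * (matrix_map m v \<bullet> i))" using v(1) by simp
  also have "\<dots> = (\<Sum>i\<in>Basis. \<Sum>j\<in>Basis. m i j * (v \<bullet> i) * (v \<bullet> j))"
    by (simp add: matrix_map_inner sum_distrib_left mult_ac)
  finally show False using assms[OF v(2)] by simp
qed

text \<open>In the trace the inner derivative always hits the spray coefficient of its own index, so
  all second derivatives collapse into first derivatives of the spray divergence \<open>D\<close>.
  For the warped product only first derivatives of the spray and of \<open>D\<close> then have to be
  computed.\<close>

lemma ricci_curv_eq_divergence:
  assumes S: "open S" "z \<in> S" and G: "\<And>i. i \<in> Basis \<Longrightarrow> smooth_on S (spray L i)"
  defines "D \<equiv> \<lambda>w. \<Sum>s\<in>Basis. pdy s (spray L s) w"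
  shows "ricci_curv L z = 2 * (\<Sum>i\<in>Basis. pdx i (spray L i) z) - (\<Sum>j\<in>Basis. (snd z \<bullet> j) * pdx j D z)
    + 2 * (\<Sum>j\<in>Basis. spray L j z * pdy j D z)
    - (\<Sum>i\<in>Basis. \<Sum>j\<in>Basis. pdy j (spray L i) z * pdy i (spray L j) z)"
proof -
  have d: "pdy i (spray L i) differentiable (at z)" if "i \<in> Basis" for i
    using smooth_on_differentiable[OF smooth_on_pdy[OF G[OF that]] S(2)] .
  have 1: "pdx j D z = (\<Sum>i\<in>Basis. pdx j (pdy i (spray L i)) z)" for j
    unfolding D_def by (rule pd_sum) (rule d)
  have 2: "pdy j D z = (\<Sum>i\<in>Basis. pdy j (pdy i (spray L i)) z)" for j
    unfolding D_def by (rule pd_sum) (rule d)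
  show ?thesis
    unfolding ricci_curv_def riemann_curv_def 1 2 sum_subtractf sum.distrib sum_distrib_left
    by (subst (1 2) sum.swap) (simp add: mult_ac)
qed

text \<open>\<open>P\<close> is the square of a Finsler metric, expressed in a single chart.\<close>

locale finsler_chart =
  fixes U :: "'e::euclidean_space set" and P :: "'e \<times> 'e \<Rightarrow> real"
  assumes open_U: "open U"
    and smooth: "smooth_on (U \<times> - {0}) P"
    and homogeneous: "homogeneous_on 2 U P"
    and pos: "\<And>x y v. x \<in> U \<Longrightarrow> y \<noteq> 0 \<Longrightarrow> v \<noteq> 0 \<Longrightarrow>
      (\<Sum>i\<in>Basis. \<Sum>j\<in>Basis. fund_tensor P i j (x, y) * (v \<bullet> i) * (v \<bullet> j)) > 0"
begin

lemma open_slit: "open (U \<times> - {0::'e})"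
  using open_U by (intro open_Times open_Compl) auto

lemma smooth_fund_tensor: "smooth_on (U \<times> - {0}) (fund_tensor P i j)"
  unfolding fund_tensor_def[abs_def] by (intro smooth_intros open_slit smooth)

lemma inj_fund_tensor: "z \<in> U \<times> - {0} \<Longrightarrow> inj (matrix_map (\<lambda>a b. fund_tensor P a b z))"
  using pos[of "fst z" "snd z"] by (intro inj_matrix_map_pos) (auto simp: mem_Times_iff)

lemma smooth_fund_tensor_inv: "smooth_on (U \<times> - {0}) (fund_tensor_inv P i l)"
  unfolding fund_tensor_inv_eq[abs_def]
  by (intro smooth_on_inv_matrix_map open_slit smooth_fund_tensor inj_fund_tensor)

lemma smooth_spray: "smooth_on (U \<times> - {0}) (spray P i)"
  unfolding spray_def[abs_def] by (intro smooth_intros open_slit smooth smooth_fund_tensor_inv)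

lemma smooth_divergence: "smooth_on (U \<times> - {0}) (\<lambda>w. \<Sum>s\<in>Basis. pdy s (spray P s) w)"
  by (intro smooth_intros open_slit smooth_spray)

lemma homogeneous_pdy: "homogeneous_on 1 U (pdy i P)"
  using homogeneous_on_pdy[OF open_U smooth] homogeneous by (simp add: numeral_2_eq_2)

lemma fund_tensor_homogeneous:
  "x \<in> U \<Longrightarrow> y \<noteq> 0 \<Longrightarrow> t > 0 \<Longrightarrow> fund_tensor P i j (x, t *\<^sub>R y) = fund_tensor P i j (x, y)"
  using homogeneous_on_pdy[OF open_U smooth_on_pdy[OF smooth], of 0 j i] homogeneous_pdy[of j]
  by (simp add: fund_tensor_def homogeneous_on_def)

lemma spray_homogeneous: "homogeneous_on 2 U (spray P i)"
  unfolding homogeneous_on_def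
proof (intro ballI allI impI)
  fix x y :: 'e and t :: real assume z: "x \<in> U" "0 < t" "y \<noteq> 0"
  have ginv: "fund_tensor_inv P i l (x, t *\<^sub>R y) = fund_tensor_inv P i l (x, y)" for l
    using z by (simp add: fund_tensor_inv_eq fund_tensor_homogeneous)
  have 1: "pdx k (pdy l P) (x, t *\<^sub>R y) = t * pdx k (pdy l P) (x, y)" for k l
    using homogeneous_on_pdx[OF open_U smooth_on_pdy[OF smooth] homogeneous_pdy] z
    by (simp add: homogeneous_on_def)
  have 2: "pdx l P (x, t *\<^sub>R y) = t ^ 2 * pdx l P (x, y)" for l
    using homogeneous_on_pdx[OF open_U smooth homogeneous] z by (simp add: homogeneous_on_def)
  show "spray P i (x, t *\<^sub>R y) = t\<^sup>2 * spray P i (x, y)"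
    unfolding spray_def ginv 1 2
    by (simp add: sum_distrib_left right_diff_distrib power2_eq_square mult_ac)
qed

lemma divergence_homogeneous: "homogeneous_on 1 U (\<lambda>w. \<Sum>s\<in>Basis. pdy s (spray P s) w)"
proof -
  have "homogeneous_on 1 U (pdy s (spray P s))" for s
    using homogeneous_on_pdy[OF open_U smooth_spray] spray_homogeneous by (simp add: numeral_2_eq_2)
  then show ?thesis unfolding homogeneous_on_def by (simp add: sum_distrib_left)
qed

text \<open>Euler's identity for \<open>P\<close>, differentiated once more in the fibre direction
  \<open>i\<close>.\<close>

lemma fund_tensor_apply_fibre:
  assumes z: "x \<in> U" "y \<noteq> 0" and i: "i \<in> Basis"
  shows "(\<Sum>j\<in>Basis. fund_tensor P i j (x, y) * (y \<bullet> j)) = (1 / 2) * pdy i P (x, y)"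
proof -
  have d: "pdy j P differentiable (at (x, y))" for j
    using smooth_on_differentiable[OF smooth_on_pdy[OF smooth]] z by auto
  have d': "(\<lambda>w. snd w \<bullet> j) differentiable (at (x, y))" for j
    using smooth_on_differentiable[OF smooth_on_fibre_coord] by blast
  have "pdy i (\<lambda>w. \<Sum>j\<in>Basis. (snd w \<bullet> j) * pdy j P w) (x, y) = pdy i (\<lambda>w. 2 * P w) (x, y)"
    using z euler_identity[OF smooth homogeneous]
    by (intro pdy_cong[OF open_slit]) (auto simp: mem_Times_iff split_paired_all)
  also have "\<dots> = 2 * pdy i P (x, y)"
    using smooth_on_differentiable[OF smooth] z by (intro pd_cmult) auto
  also have "pdy i (\<lambda>w. \<Sum>j\<in>Basis. (snd w \<bullet> j) * pdy j P w) (x, y) =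
    (\<Sum>j\<in>Basis. (y \<bullet> j) * pdy i (pdy j P) (x, y) + (i \<bullet> j) * pdy j P (x, y))"
    using d d' by (simp add: pd_sum pd_mult differentiable_mult)
  also have "\<dots> = (\<Sum>j\<in>Basis. (y \<bullet> j) * pdy i (pdy j P) (x, y)) + pdy i P (x, y)"
    using i by (simp add: sum.distrib inner_Basis if_distrib[of "\<lambda>c. c * _"] cong: if_cong)
  finally show ?thesis
    by (simp add: fund_tensor_def sum_divide_distrib[symmetric] mult_ac)
qed

text \<open>The previous identity with the index raised. It explains why warping changes the fibre
  spray by a multiple of the velocity itself.\<close>

lemma fund_tensor_inv_gradient:
  assumes z: "x \<in> U" "y \<noteq> 0" and i: "i \<in> Basis"
  shows "(\<Sum>l\<in>Basis. fund_tensor_inv P i l (x, y) * pdy l P (x, y)) = 2 * (y \<bullet> i)"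
proof -
  let ?M = "matrix_map (\<lambda>a b. fund_tensor P a b (x, y))"
  have inj: "inj ?M" using inj_fund_tensor z by auto
  have lin: "linear (inv ?M)" by (rule linear_inv_matrix_map[OF inj])
  have "(\<Sum>l\<in>Basis. pdy l P (x, y) *\<^sub>R l) = 2 *\<^sub>R ?M y"
    by (rule euclidean_eqI) (simp add: matrix_map_inner fund_tensor_apply_fibre z)
  then have "inv ?M (\<Sum>l\<in>Basis. pdy l P (x, y) *\<^sub>R l) = 2 *\<^sub>R y"
    by (simp add: linear_scale[OF lin] inj)
  then have "(\<Sum>l\<in>Basis. pdy l P (x, y) *\<^sub>R inv ?M l) \<bullet> i = (2 *\<^sub>R y) \<bullet> i"
    by (simp add: linear_sum[OF lin] linear_scale[OF lin])
  then show ?thesis by (simp add: fund_tensor_inv_eq inner_sum_left mult_ac)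
qed

text \<open>By Euler's identities \<open>P\<close> is the value of its own positive definite
  fundamental tensor on the vector \<open>y\<close>.\<close>

lemma P_pos:
  assumes z: "x \<in> U" "y \<noteq> 0"
  shows "P (x, y) > 0"
proof -
  have "0 < (\<Sum>i\<in>Basis. \<Sum>j\<in>Basis. fund_tensor P i j (x, y) * (y \<bullet> i) * (y \<bullet> j))"
    by (rule pos[OF z z(2)])
  also have "\<dots> = (\<Sum>i\<in>Basis. (y \<bullet> i) * (\<Sum>j\<in>Basis. fund_tensor P i j (x, y) * (y \<bullet> j)))"
    by (simp add: sum_distrib_left mult_ac)
  also have "\<dots> = (1 / 2) * (\<Sum>i\<in>Basis. (y \<bullet> i) * pdy i P (x, y))"
    unfolding sum_distrib_left[of "1 / 2"]
    by (intro sum.cong refl) (simp only: fund_tensor_apply_fibre[OF z] mult.left_commute)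
  also have "\<dots> = P (x, y)" using euler_identity[OF smooth homogeneous z] by simp
  finally show ?thesis .
qed

text \<open>For the single spray coefficient \<open>G\<close>, Euler gives
  \<open>y G_y = 2 G\<close>, \<open>y G_yy = G_y\<close> and, by differentiating the first,
  \<open>y G_xy = 2 G_x\<close>. So in \<open>2 G_x - y G_xy + 2 G G_yy - G_y^2\<close> the first
  two terms cancel, and \<open>2 G G_yy = y G_y G_yy = G_y^2\<close>.\<close>

lemma ricci_curv_dim_1:
  assumes dim: "DIM('e) = 1" and z: "x \<in> U" "y \<noteq> 0"
  shows "ricci_curv P (x, y) = 0"
proof -
  obtain b where b: "Basis = {b::'e}" using dim card_1_singletonE by blast
  let ?G = "spray P b"
  let ?D = "\<lambda>w. \<Sum>s\<in>Basis. pdy s (spray P s) w"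
  have D: "?D = pdy b ?G" by (simp add: b)
  have e1: "(snd w \<bullet> b) * pdy b ?G w = 2 * ?G w" if "w \<in> U \<times> - {0}" for w
    using euler_identity[OF smooth_spray spray_homogeneous, of "fst w" "snd w" b] that by (simp add: b mem_Times_iff)
  have e2: "(y \<bullet> b) * pdy b (pdy b ?G) (x, y) = pdy b ?G (x, y)"
    using euler_identity[OF smooth_divergence divergence_homogeneous z] unfolding D by (simp add: b)
  have dG: "?G differentiable (at (x, y))" "pdy b ?G differentiable (at (x, y))"
    using smooth_on_differentiable[OF smooth_spray] smooth_on_differentiable[OF smooth_on_pdy[OF smooth_spray]] z by auto
  have "pdx b (\<lambda>w. (snd w \<bullet> b) * pdy b ?G w) (x, y) = pdx b (\<lambda>w. 2 * ?G w) (x, y)"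
    using z e1 by (intro pdx_cong[OF open_slit]) auto
  then have e3: "(y \<bullet> b) * pdx b (pdy b ?G) (x, y) = 2 * pdx b ?G (x, y)"
    using pd_mult(1)[OF smooth_on_differentiable[OF smooth_on_fibre_coord UNIV_I] dG(2), of b b] dG(1)
    by (simp add: pd_cmult)
  have "ricci_curv P (x, y) = 2 * pdx b ?G (x, y) - (y \<bullet> b) * pdx b (pdy b ?G) (x, y)
     + 2 * (?G (x, y) * pdy b (pdy b ?G) (x, y)) - pdy b ?G (x, y) * pdy b ?G (x, y)"
    using ricci_curv_eq_divergence[OF open_slit, of "(x, y)" P] smooth_spray z unfolding D by (simp add: b)
  also have "\<dots> = (2 * ?G (x, y)) * pdy b (pdy b ?G) (x, y) - pdy b ?G (x, y) * pdy b ?G (x, y)"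
    using e3 by simp
  also have "\<dots> = pdy b ?G (x, y) * ((y \<bullet> b) * pdy b (pdy b ?G) (x, y)) - pdy b ?G (x, y) * pdy b ?G (x, y)"
    using e1[of "(x, y)", symmetric] z by simp
  finally show ?thesis using e2 by simp
qed

end

section \<open>Warped products in a coordinate domain\<close>

lemma sum_Basis_prod:
  fixes h :: "'a::euclidean_space \<times> 'b::euclidean_space \<Rightarrow> 'c::comm_monoid_add"
  shows "(\<Sum>s\<in>Basis. h s) = (\<Sum>i\<in>Basis. h (i, 0)) + (\<Sum>a\<in>Basis. h (0, a))"
proof -
  have "inj_on (\<lambda>u. (u::'a, 0::'b)) Basis" "inj_on (\<lambda>u. (0::'a, u::'b)) Basis"
    by (auto intro!: inj_onI)
  then show ?thesis
    unfolding Basis_prod_def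
    by (subst sum.union_disjoint) (auto simp: sum.reindex)
qed

lemma Basis_prodE:
  assumes "s \<in> Basis"
  obtains (fst) i where "i \<in> Basis" "s = (i, 0)" | (snd) a where "a \<in> Basis" "s = (0, a)"
  using assms by (auto simp: Basis_prod_def)

lemma pd_zero:
  assumes "H differentiable (at z)"
  shows "pdx 0 H z = 0" "pdy 0 H z = 0"
  using linear_0[OF linear_frechet_derivative[OF assms]] by (simp_all add: pdx_def pdy_def zero_prod_def)

text \<open>Coordinates on the tangent bundle of the product have the form
  \<open>((x1, x2), (y1, y2))\<close>; \<open>fst_pair\<close> and \<open>snd_pair\<close> regroup
  them into tangent coordinates \<open>(x1, y1)\<close> of the base and \<open>(x2, y2)\<close> of
  the fibre.\<close>

definition fst_pair :: "('a \<times> 'b) \<times> 'c \<times> 'd \<Rightarrow> 'a \<times> 'c" where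
  "fst_pair z = (fst (fst z), fst (snd z))"

definition snd_pair :: "('a \<times> 'b) \<times> 'c \<times> 'd \<Rightarrow> 'b \<times> 'd" where
  "snd_pair z = (snd (fst z), snd (snd z))"

lemma fst_pair_simps [simp]: "fst (fst_pair z) = fst (fst z)" "snd (fst_pair z) = fst (snd z)"
    "fst (snd_pair z) = snd (fst z)" "snd (snd_pair z) = snd (snd z)"
  by (simp_all add: fst_pair_def snd_pair_def)

lemma bounded_linear_fst_pair: "bounded_linear fst_pair"
  unfolding fst_pair_def[abs_def]
  by (rule bounded_linear_Pair[OF bounded_linear_compose[OF bounded_linear_fst bounded_linear_fst]
        bounded_linear_compose[OF bounded_linear_fst bounded_linear_snd]])

lemma bounded_linear_snd_pair: "bounded_linear snd_pair"
  unfolding snd_pair_def[abs_def]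
  by (rule bounded_linear_Pair[OF bounded_linear_compose[OF bounded_linear_snd bounded_linear_fst]
        bounded_linear_compose[OF bounded_linear_snd bounded_linear_snd]])

lemma has_derivative_compose_bounded_linear:
  assumes "bounded_linear T" "H differentiable (at (T z))"
  shows "((\<lambda>w. H (T w)) has_derivative (\<lambda>v. frechet_derivative H (at (T z)) (T v))) (at z)"
  using assms(2) unfolding frechet_derivative_works
  by (rule has_derivative_compose[OF bounded_linear_imp_has_derivative[OF assms(1)]])

lemma differentiable_fst_pair:
  "H differentiable (at (fst_pair z)) \<Longrightarrow> (\<lambda>w. H (fst_pair w)) differentiable (at z)"
  by (rule differentiableI[OF has_derivative_compose_bounded_linear[OF bounded_linear_fst_pair]])

lemma differentiable_snd_pair:
  "H differentiable (at (snd_pair z)) \<Longrightarrow> (\<lambda>w. H (snd_pair w)) differentiable (at z)"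
  by (rule differentiableI[OF has_derivative_compose_bounded_linear[OF bounded_linear_snd_pair]])

lemma pd_fst_pair:
  fixes z :: "('e::euclidean_space \<times> 'f::euclidean_space) \<times> 'e \<times> 'f"
  assumes "H differentiable (at (fst_pair z))"
  shows "pdx (i, 0) (\<lambda>w. H (fst_pair w)) z = pdx i H (fst_pair z)"
    "pdx (0, a) (\<lambda>w. H (fst_pair w)) z = 0"
    "pdy (i, 0) (\<lambda>w. H (fst_pair w)) z = pdy i H (fst_pair z)"
    "pdy (0, a) (\<lambda>w. H (fst_pair w)) z = 0"
  using pd_zero[OF assms]
  unfolding pdx_def pdy_def frechet_derivative_eqI[OF has_derivative_compose_bounded_linear[OF bounded_linear_fst_pair assms]]
  by (simp_all add: fst_pair_def)

lemma pd_snd_pair: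
  fixes z :: "('e::euclidean_space \<times> 'f::euclidean_space) \<times> 'e \<times> 'f"
  assumes "H differentiable (at (snd_pair z))"
  shows "pdx (i, 0) (\<lambda>w. H (snd_pair w)) z = 0"
    "pdx (0, a) (\<lambda>w. H (snd_pair w)) z = pdx a H (snd_pair z)"
    "pdy (i, 0) (\<lambda>w. H (snd_pair w)) z = 0"
    "pdy (0, a) (\<lambda>w. H (snd_pair w)) z = pdy a H (snd_pair z)"
  using pd_zero[OF assms]
  unfolding pdx_def pdy_def frechet_derivative_eqI[OF has_derivative_compose_bounded_linear[OF bounded_linear_snd_pair assms]]
  by (simp_all add: snd_pair_def)

lemma pd_base:
  assumes "h differentiable (at (fst z))"
  shows "pdx i (\<lambda>w. h (fst w)) z = frechet_derivative h (at (fst z)) i" "pdy i (\<lambda>w. h (fst w)) z = 0"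
  using linear_0[OF linear_frechet_derivative[OF assms]]
  unfolding pdx_def pdy_def frechet_derivative_eqI[OF has_derivative_compose_bounded_linear[OF bounded_linear_fst assms]]
  by simp_all

section \<open>Block-diagonal matrices and their inverses\<close>

lemma matrix_map_block:
  assumes "\<And>i j. i \<in> Basis \<Longrightarrow> j \<in> Basis \<Longrightarrow> m (i, 0) (j, 0) = m1 i j"
    "\<And>i b. i \<in> Basis \<Longrightarrow> b \<in> Basis \<Longrightarrow> m (i, 0) (0, b) = 0"
    "\<And>a j. a \<in> Basis \<Longrightarrow> j \<in> Basis \<Longrightarrow> m (0, a) (j, 0) = 0"
    "\<And>a b. a \<in> Basis \<Longrightarrow> b \<in> Basis \<Longrightarrow> m (0, a) (0, b) = c * m2 a b"
  shows "matrix_map m (v :: 'e::euclidean_space \<times> 'f::euclidean_space) =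
    (matrix_map m1 (fst v), c *\<^sub>R matrix_map m2 (snd v))"
proof (rule euclidean_eqI)
  fix i :: "'e \<times> 'f" assume i: "i \<in> Basis"
  show "matrix_map m v \<bullet> i = (matrix_map m1 (fst v), c *\<^sub>R matrix_map m2 (snd v)) \<bullet> i"
    unfolding matrix_map_inner[OF i] sum_Basis_prod using i assms
    by (auto simp: Basis_prod_def inner_prod_def matrix_map_inner sum_distrib_left mult_ac cong: sum.cong)
qed

lemma inv_matrix_map_block:
  fixes m1 :: "'e::euclidean_space \<Rightarrow> 'e \<Rightarrow> real" and m2 :: "'f::euclidean_space \<Rightarrow> 'f \<Rightarrow> real"
  assumes block: "\<And>v. matrix_map m v = (matrix_map m1 (fst v), c *\<^sub>R matrix_map m2 (snd v))"
    and inj: "inj (matrix_map m1)" "inj (matrix_map m2)" and c: "c \<noteq> 0"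
  shows "inv (matrix_map m) (l, b) = (inv (matrix_map m1) l, (1 / c) *\<^sub>R inv (matrix_map m2) b)"
proof (rule inv_f_eq)
  show "inj (matrix_map m)"
    using inj c by (auto simp: inj_def block prod_eq_iff)
  have "matrix_map m1 (inv (matrix_map m1) l) = l" "matrix_map m2 (inv (matrix_map m2) b) = b"
    using inj[THEN inj_matrix_map_imp_bij] by (auto simp: bij_is_surj surj_f_inv_f)
  then show "matrix_map m (inv (matrix_map m1) l, (1 / c) *\<^sub>R inv (matrix_map m2) b) = (l, b)"
    using c by (simp add: block linear_scale[OF linear_matrix_map])
qed

text \<open>\<open>A\<close>, \<open>P\<close> and \<open>L\<close> are the squared metrics of base,
  fibre and product, \<open>\<phi>\<close> is the warping function, and \<open>W\<close> is the
  domain where both velocities are nonzero. The Riemannian nature of the base enters through two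
  properties: the inverse metric is independent of \<open>y\<close>, and the spray divergence has
  vanishing second \<open>y\<close>-derivatives.\<close>

locale warped_chart = base: finsler_chart U A + fibre: finsler_chart V P
  for U :: "'e::euclidean_space set" and A and V :: "'f::euclidean_space set" and P +
  fixes \<phi> :: "'e \<Rightarrow> real" and ginv :: "'e \<Rightarrow> 'e \<Rightarrow> 'e \<Rightarrow> real"
    and L :: "('e \<times> 'f) \<times> 'e \<times> 'f \<Rightarrow> real" and W
  assumes smooth_\<phi>: "smooth_on U \<phi>" and \<phi>_pos: "\<And>x. x \<in> U \<Longrightarrow> \<phi> x > 0"
    and smooth_ginv: "\<And>i l. smooth_on U (ginv i l)"
    and ginv: "\<And>i l x y. x \<in> U \<Longrightarrow> y \<noteq> 0 \<Longrightarrow> fund_tensor_inv A i l (x, y) = ginv i l x"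
    and base_weakly_berwald: "\<And>i j x y. x \<in> U \<Longrightarrow> y \<noteq> 0 \<Longrightarrow> i \<in> Basis \<Longrightarrow> j \<in> Basis \<Longrightarrow>
      mean_berwald A i j (x, y) = 0"
    and W: "W = {z. fst_pair z \<in> U \<times> - {0} \<and> snd_pair z \<in> V \<times> - {0}}"
    and L: "\<And>z. z \<in> W \<Longrightarrow> L z = A (fst_pair z) + (\<phi> (fst (fst_pair z)))\<^sup>2 * P (snd_pair z)"
begin

abbreviation d\<phi> :: "'e \<Rightarrow> 'e \<Rightarrow> real" where
  "d\<phi> k x \<equiv> frechet_derivative \<phi> (at x) k"

text \<open>\<open>grad\<close> is \<open>(1/2) \<phi> \<nabla>\<phi>\<close>, and \<open>dlog (x, y)\<close> is the derivative of \<open>ln \<phi>\<close> at \<open>x\<close> in the direction \<open>y\<close>.\<close>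

definition grad :: "'e \<Rightarrow> 'e \<Rightarrow> real" where
  "grad i x = (1 / 2) * \<phi> x * (\<Sum>l\<in>Basis. ginv i l x * d\<phi> l x)"

definition dlog :: "'e \<times> 'e \<Rightarrow> real" where
  "dlog v = (\<Sum>k\<in>Basis. (d\<phi> k (fst v) / \<phi> (fst v)) * (snd v \<bullet> k))"

lemma WD: "z \<in> W \<Longrightarrow> fst_pair z \<in> U \<times> - {0}" "z \<in> W \<Longrightarrow> snd_pair z \<in> V \<times> - {0}"
  unfolding W by auto

lemma WD': "z \<in> W \<Longrightarrow> fst (fst z) \<in> U" "z \<in> W \<Longrightarrow> fst (snd z) \<noteq> 0"
   "z \<in> W \<Longrightarrow> snd (fst z) \<in> V" "z \<in> W \<Longrightarrow> snd (snd z) \<noteq> 0"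
  using WD[of z] by (auto simp: mem_Times_iff)

lemma open_W: "open W"
proof -
  have "W = fst_pair -` (U \<times> - {0}) \<inter> snd_pair -` (V \<times> - {0})" unfolding W by auto
  moreover have "open (fst_pair -` (U \<times> - {0::'e}) :: (('e \<times> 'f) \<times> 'e \<times> 'f) set)"
    by (intro open_vimage base.open_slit linear_continuous_on bounded_linear_fst_pair)
  moreover have "open (snd_pair -` (V \<times> - {0::'f}) :: (('e \<times> 'f) \<times> 'e \<times> 'f) set)"
    by (intro open_vimage fibre.open_slit linear_continuous_on bounded_linear_snd_pair)
  ultimately show ?thesis by (simp add: open_Int)
qed

lemma smooth_fst_pair: "smooth_on (U \<times> - {0}) H \<Longrightarrow> smooth_on W (\<lambda>w. H (fst_pair w))"
  by (rule smooth_on_compose_bounded_linear[OF bounded_linear_fst_pair open_W]) (auto dest: WD)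

lemma smooth_snd_pair: "smooth_on (V \<times> - {0}) H \<Longrightarrow> smooth_on W (\<lambda>w. H (snd_pair w))"
  by (rule smooth_on_compose_bounded_linear[OF bounded_linear_snd_pair open_W]) (auto dest: WD)

lemma smooth_base: "smooth_on U h \<Longrightarrow> smooth_on (U \<times> - {0::'e}) (\<lambda>v. h (fst v))"
  by (rule smooth_on_base[OF base.open_slit]) auto

lemma smooth_grad: "smooth_on U (grad i)"
  unfolding grad_def[abs_def]
  by (intro smooth_intros base.open_U smooth_\<phi> smooth_ginv smooth_on_frechet_derivative)

lemma smooth_ratio: "smooth_on U (\<lambda>x. d\<phi> k x / \<phi> x)"
  using \<phi>_pos by (intro smooth_intros base.open_U smooth_\<phi> smooth_on_frechet_derivative) force

lemma smooth_dlog: "smooth_on (U \<times> - {0}) dlog"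
  unfolding dlog_def[abs_def]
  by (intro smooth_on_sum smooth_on_mult base.open_slit smooth_on_fibre_coord smooth_base[OF smooth_ratio])

lemma smooth_sq: "smooth_on U (\<lambda>x. (\<phi> x)\<^sup>2)"
  by (intro smooth_intros base.open_U smooth_\<phi>)

lemma frechet_derivative_sq: "x \<in> U \<Longrightarrow> frechet_derivative (\<lambda>x. (\<phi> x)\<^sup>2) (at x) k = 2 * \<phi> x * d\<phi> k x"
  using smooth_on_differentiable[OF smooth_\<phi>]
  by (simp add: power2_eq_square frechet_derivative_mult)

lemma pdy_dlog: "v \<in> U \<times> - {0} \<Longrightarrow> k \<in> Basis \<Longrightarrow> pdy k dlog v = d\<phi> k (fst v) / \<phi> (fst v)"
proof -
  assume v: "v \<in> U \<times> - {0}" and k: "k \<in> Basis"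
  have d1: "(\<lambda>w. d\<phi> j (fst w) / \<phi> (fst w)) differentiable (at v)" for j
    using smooth_on_differentiable[OF smooth_base[OF smooth_ratio] v] .
  have d2: "(\<lambda>x. d\<phi> j x / \<phi> x) differentiable (at (fst v))" for j
    using smooth_on_differentiable[OF smooth_ratio] v by (auto simp: mem_Times_iff)
  have d3: "(\<lambda>w. snd w \<bullet> j) differentiable (at v)" for j :: 'e
    using smooth_on_differentiable[OF smooth_on_fibre_coord UNIV_I] .
  have "pdy k dlog v = (\<Sum>j\<in>Basis. pdy k (\<lambda>w. (d\<phi> j (fst w) / \<phi> (fst w)) * (snd w \<bullet> j)) v)"
    unfolding dlog_def[abs_def] by (rule pd_sum) (intro differentiable_mult d1 d3)
  also have "\<dots> = (\<Sum>j\<in>Basis. (d\<phi> j (fst v) / \<phi> (fst v)) * (k \<bullet> j))"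
    by (intro sum.cong refl) (subst pd_mult(2)[OF d1 d3], subst pd_base(2)[OF d2], simp)
  also have "\<dots> = d\<phi> k (fst v) / \<phi> (fst v)"
    using k by (simp add: inner_Basis if_distrib[of "\<lambda>c. _ * c"] cong: if_cong)
  finally show ?thesis .
qed

text \<open>A common template: \<open>L\<close>, its fibre derivatives, the spray coefficients and
  their divergence all have the form \<open>H + N + h * K\<close> with \<open>H\<close>,
  \<open>h\<close> on the base and \<open>N\<close>, \<open>K\<close> on the fibre. Missing summands
  are filled with zero.\<close>

lemma pd_warped:
  assumes F: "\<forall>w\<in>W. F w = H (fst_pair w) + N (snd_pair w) + h (fst_pair w) * K (snd_pair w)"
    and H: "smooth_on (U \<times> - {0}) H" and h: "smooth_on (U \<times> - {0}) h"
    and K: "smooth_on (V \<times> - {0}) K" and N: "smooth_on (V \<times> - {0}) N"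
    and z: "z \<in> W"
  shows "pdx (i, 0) F z = pdx i H (fst_pair z) + pdx i h (fst_pair z) * K (snd_pair z)"
    and "pdx (0, a) F z = pdx a N (snd_pair z) + h (fst_pair z) * pdx a K (snd_pair z)"
    and "pdy (i, 0) F z = pdy i H (fst_pair z) + pdy i h (fst_pair z) * K (snd_pair z)"
    and "pdy (0, a) F z = pdy a N (snd_pair z) + h (fst_pair z) * pdy a K (snd_pair z)"
proof -
  let ?F = "\<lambda>w. H (fst_pair w) + N (snd_pair w) + h (fst_pair w) * K (snd_pair w)"
  note dH = smooth_on_differentiable[OF H WD(1)[OF z]] and dh = smooth_on_differentiable[OF h WD(1)[OF z]]
    and dK = smooth_on_differentiable[OF K WD(2)[OF z]] and dN = smooth_on_differentiable[OF N WD(2)[OF z]]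
  note d = differentiable_fst_pair[OF dH] differentiable_fst_pair[OF dh]
    differentiable_snd_pair[OF dK] differentiable_snd_pair[OF dN]
  have c: "pdx j F z = pdx j ?F z" "pdy j F z = pdy j ?F z" for j
    by (rule pdx_cong[OF open_W z] pdy_cong[OF open_W z]; use F in simp)+
  have e: "pdx j ?F z = pdx j (\<lambda>w. H (fst_pair w)) z + pdx j (\<lambda>w. N (snd_pair w)) z +
      (h (fst_pair z) * pdx j (\<lambda>w. K (snd_pair w)) z + pdx j (\<lambda>w. h (fst_pair w)) z * K (snd_pair z))"
    "pdy j ?F z = pdy j (\<lambda>w. H (fst_pair w)) z + pdy j (\<lambda>w. N (snd_pair w)) z +
      (h (fst_pair z) * pdy j (\<lambda>w. K (snd_pair w)) z + pdy j (\<lambda>w. h (fst_pair w)) z * K (snd_pair z))" for j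
    by (simp_all only: pd_add[OF differentiable_add[OF d(1,4)] differentiable_mult[OF d(2,3)]]
      pd_add[OF d(1,4)] pd_mult[OF d(2,3)])
  show "pdx (i, 0) F z = pdx i H (fst_pair z) + pdx i h (fst_pair z) * K (snd_pair z)"
    and "pdx (0, a) F z = pdx a N (snd_pair z) + h (fst_pair z) * pdx a K (snd_pair z)"
    and "pdy (i, 0) F z = pdy i H (fst_pair z) + pdy i h (fst_pair z) * K (snd_pair z)"
    and "pdy (0, a) F z = pdy a N (snd_pair z) + h (fst_pair z) * pdy a K (snd_pair z)"
    unfolding c e pd_fst_pair[OF dH] pd_fst_pair[OF dh] pd_snd_pair[OF dK] pd_snd_pair[OF dN]
    by simp_all
qed

lemma smooth_zero: "smooth_on S (\<lambda>w. 0 :: real)"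
  by (rule smooth_on_const)

section \<open>Fundamental tensor and spray of the warped product\<close>

lemma pd_L:
  assumes z: "z \<in> W"
  shows "pdx (i, 0) L z = pdx i A (fst_pair z) + 2 * \<phi> (fst (fst z)) * d\<phi> i (fst (fst z)) * P (snd_pair z)"
    and "pdx (0, a) L z = (\<phi> (fst (fst z)))\<^sup>2 * pdx a P (snd_pair z)"
    and "pdy (i, 0) L z = pdy i A (fst_pair z)"
    and "pdy (0, a) L z = (\<phi> (fst (fst z)))\<^sup>2 * pdy a P (snd_pair z)"
proof -
  have "\<forall>w\<in>W. L w = A (fst_pair w) + 0 + (\<phi> (fst (fst_pair w)))\<^sup>2 * P (snd_pair w)"
    using L by simp
  note pd = pd_warped[where H = "A" and N = "\<lambda>_. 0" and h = "\<lambda>v. (\<phi> (fst v))\<^sup>2" and K = "P", OF this base.smooth smooth_base[OF smooth_sq] fibre.smooth smooth_zero z]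
  have sq: "(\<lambda>x. (\<phi> x)\<^sup>2) differentiable at (fst (fst_pair z))"
    using smooth_on_differentiable[OF smooth_sq] WD'[OF z] by simp
  show "pdx (i, 0) L z = pdx i A (fst_pair z) + 2 * \<phi> (fst (fst z)) * d\<phi> i (fst (fst z)) * P (snd_pair z)"
    and "pdx (0, a) L z = (\<phi> (fst (fst z)))\<^sup>2 * pdx a P (snd_pair z)"
    and "pdy (i, 0) L z = pdy i A (fst_pair z)"
    and "pdy (0, a) L z = (\<phi> (fst (fst z)))\<^sup>2 * pdy a P (snd_pair z)"
    unfolding pd pd_base[OF sq] using WD'(1)[OF z] by (simp_all add: frechet_derivative_sq)
qed

text \<open>The vanishing mixed fibre derivatives make the fundamental tensor block diagonal. The
  only coupling left is the base derivative of \<open>\<phi>\<close> in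
  \<open>pdx (k, 0) (pdy (0, b) L)\<close>.\<close>

lemma pd_pdy_L:
  assumes z: "z \<in> W"
  shows "pdx (k, 0) (pdy (l, 0) L) z = pdx k (pdy l A) (fst_pair z)"
    and "pdx (0, c) (pdy (l, 0) L) z = 0"
    and "pdx (k, 0) (pdy (0, b) L) z = 2 * \<phi> (fst (fst z)) * d\<phi> k (fst (fst z)) * pdy b P (snd_pair z)"
    and "pdx (0, c) (pdy (0, b) L) z = (\<phi> (fst (fst z)))\<^sup>2 * pdx c (pdy b P) (snd_pair z)"
    and "pdy (k, 0) (pdy (l, 0) L) z = pdy k (pdy l A) (fst_pair z)"
    and "pdy (0, c) (pdy (l, 0) L) z = 0"
    and "pdy (k, 0) (pdy (0, b) L) z = 0"
    and "pdy (0, c) (pdy (0, b) L) z = (\<phi> (fst (fst z)))\<^sup>2 * pdy c (pdy b P) (snd_pair z)"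
proof -
  have sq: "(\<lambda>x. (\<phi> x)\<^sup>2) differentiable at (fst (fst_pair z))"
    using smooth_on_differentiable[OF smooth_sq] WD'[OF z] by simp
  have "\<forall>w\<in>W. pdy (l, 0) L w = pdy l A (fst_pair w) + 0 + 0 * 0"
    using pd_L(3) by simp
  note pd1 = pd_warped[where H = "pdy l A" and N = "\<lambda>_. 0" and h = "\<lambda>_. 0" and K = "\<lambda>_. 0", OF this smooth_on_pdy[OF base.smooth] smooth_zero smooth_zero smooth_zero z]
  have "\<forall>w\<in>W. pdy (0, b) L w = 0 + 0 + (\<phi> (fst (fst_pair w)))\<^sup>2 * pdy b P (snd_pair w)"
    using pd_L(4) by simp
  note pd2 = pd_warped[where H = "\<lambda>_. 0" and N = "\<lambda>_. 0" and h = "\<lambda>v. (\<phi> (fst v))\<^sup>2" and K = "pdy b P", OF this smooth_zero smooth_base[OF smooth_sq] smooth_on_pdy[OF fibre.smooth] smooth_zero z]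
  show "pdx (k, 0) (pdy (l, 0) L) z = pdx k (pdy l A) (fst_pair z)"
    and "pdx (0, c) (pdy (l, 0) L) z = 0"
    and "pdx (k, 0) (pdy (0, b) L) z = 2 * \<phi> (fst (fst z)) * d\<phi> k (fst (fst z)) * pdy b P (snd_pair z)"
    and "pdx (0, c) (pdy (0, b) L) z = (\<phi> (fst (fst z)))\<^sup>2 * pdx c (pdy b P) (snd_pair z)"
    and "pdy (k, 0) (pdy (l, 0) L) z = pdy k (pdy l A) (fst_pair z)"
    and "pdy (0, c) (pdy (l, 0) L) z = 0"
    and "pdy (k, 0) (pdy (0, b) L) z = 0"
    and "pdy (0, c) (pdy (0, b) L) z = (\<phi> (fst (fst z)))\<^sup>2 * pdy c (pdy b P) (snd_pair z)"
    unfolding pd1 pd2 pd_base[OF sq] using WD'(1)[OF z] by (simp_all add: frechet_derivative_sq)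
qed

lemma fund_tensor_inv_L:
  assumes z: "z \<in> W"
  shows "fund_tensor_inv L (i, 0) (l, 0) z = ginv i l (fst (fst z))"
    and "fund_tensor_inv L (i, 0) (0, b) z = 0"
    and "fund_tensor_inv L (0, a) (l, 0) z = 0"
    and "fund_tensor_inv L (0, a) (0, b) z = fund_tensor_inv P a b (snd_pair z) / (\<phi> (fst (fst z)))\<^sup>2"
proof -
  note i = base.inj_fund_tensor[OF WD(1)[OF z]] fibre.inj_fund_tensor[OF WD(2)[OF z]]
  have "matrix_map (\<lambda>a b. fund_tensor L a b z) v =
    (matrix_map (\<lambda>a b. fund_tensor A a b (fst_pair z)) (fst v),
     (\<phi> (fst (fst z)))\<^sup>2 *\<^sub>R matrix_map (\<lambda>a b. fund_tensor P a b (snd_pair z)) (snd v))" for v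
    by (rule matrix_map_block) (simp_all add: fund_tensor_def pd_pdy_L[OF z])
  note inv = inv_matrix_map_block[OF this i]
  have nz: "(\<phi> (fst (fst z)))\<^sup>2 \<noteq> 0" using \<phi>_pos[OF WD'(1)[OF z]] by simp
  have inv0: "inv (matrix_map (\<lambda>a b. fund_tensor A a b (fst_pair z))) 0 = 0"
      "inv (matrix_map (\<lambda>a b. fund_tensor P a b (snd_pair z))) 0 = 0"
    using linear_0[OF linear_inv_matrix_map] i by blast+
  have g: "ginv i l (fst (fst z)) = fund_tensor_inv A i l (fst_pair z)"
    using ginv[OF WD'(1,2)[OF z]] by (simp add: fst_pair_def)
  show "fund_tensor_inv L (i, 0) (l, 0) z = ginv i l (fst (fst z))"
    and "fund_tensor_inv L (i, 0) (0, b) z = 0"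
    and "fund_tensor_inv L (0, a) (l, 0) z = 0"
    and "fund_tensor_inv L (0, a) (0, b) z = fund_tensor_inv P a b (snd_pair z) / (\<phi> (fst (fst z)))\<^sup>2"
    unfolding g fund_tensor_inv_eq inv[OF nz] by (simp_all add: inv0)
qed

text \<open>The correction is the base derivative of \<open>\<phi>\<^sup>2 * P\<close> in the last
  term of the spray: \<open>(1 / 4) * 2 * \<phi> * d\<phi> l * P\<close> with the index raised,
  which is where the factor \<open>1 / 2\<close> in \<open>grad\<close> comes from.\<close>

lemma spray_L_base:
  assumes z: "z \<in> W"
  shows "spray L (i, 0) z = spray A i (fst_pair z) - grad i (fst (fst z)) * P (snd_pair z)"
proof -
  let ?x = "fst (fst z)"
  have "spray L (i, 0) z = (1 / 4) * (\<Sum>l\<in>Basis. ginv i l ?x *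
     ((\<Sum>k\<in>Basis. pdx k (pdy l A) (fst_pair z) * (fst (snd z) \<bullet> k)) -
      (pdx l A (fst_pair z) + 2 * \<phi> ?x * d\<phi> l ?x * P (snd_pair z))))"
    unfolding spray_def
    by (simp add: sum_Basis_prod fund_tensor_inv_L[OF z] pd_pdy_L[OF z] pd_L[OF z] inner_prod_def)
  also have "\<dots> = (1 / 4) * (\<Sum>l\<in>Basis. ginv i l ?x *
     ((\<Sum>k\<in>Basis. pdx k (pdy l A) (fst_pair z) * (fst (snd z) \<bullet> k)) - pdx l A (fst_pair z)))
     - (1 / 2) * \<phi> ?x * (\<Sum>l\<in>Basis. ginv i l ?x * d\<phi> l ?x) * P (snd_pair z)"
    by (simp add: algebra_simps sum.distrib sum_subtractf sum_distrib_left sum_divide_distrib)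
  also have "(\<Sum>l\<in>Basis. ginv i l ?x *
     ((\<Sum>k\<in>Basis. pdx k (pdy l A) (fst_pair z) * (fst (snd z) \<bullet> k)) - pdx l A (fst_pair z)))
    = (\<Sum>l\<in>Basis. fund_tensor_inv A i l (fst_pair z) *
     ((\<Sum>k\<in>Basis. pdx k (pdy l A) (fst_pair z) * (snd (fst_pair z) \<bullet> k)) - pdx l A (fst_pair z)))"
    using ginv[OF WD'(1,2)[OF z]] by (simp add: fst_pair_def)
  finally show ?thesis unfolding spray_def grad_def .
qed

text \<open>The correction comes from the mixed derivative
  \<open>2 * \<phi> * d\<phi> k * pdy b P\<close>. Raising the index divides by
  \<open>\<phi>\<^sup>2\<close>, which leaves \<open>dlog\<close>, and turns the fibre gradient of
  \<open>P\<close> into twice the velocity.\<close>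

lemma spray_L_fibre:
  assumes z: "z \<in> W" and a: "a \<in> Basis"
  shows "spray L (0, a) z = spray P a (snd_pair z) + dlog (fst_pair z) * (snd (snd z) \<bullet> a)"
proof -
  let ?x = "fst (fst z)"
  let ?g = "\<lambda>b. fund_tensor_inv P a b (snd_pair z)"
  let ?s = "\<Sum>k\<in>Basis. d\<phi> k ?x * (fst (snd z) \<bullet> k)"
  have nz: "\<phi> ?x \<noteq> 0" using \<phi>_pos[OF WD'(1)[OF z]] by simp
  have s: "(\<Sum>k\<in>Basis. 2 * \<phi> ?x * d\<phi> k ?x * pdy b P (snd_pair z) * (fst (snd z) \<bullet> k)) = 2 * \<phi> ?x * ?s * pdy b P (snd_pair z)" for b
    by (simp add: sum_distrib_left sum_distrib_right mult_ac)
  have s2: "(\<Sum>k\<in>Basis. (\<phi> ?x)\<^sup>2 * pdx k (pdy b P) (snd_pair z) * (snd (snd z) \<bullet> k)) =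
     (\<phi> ?x)\<^sup>2 * (\<Sum>k\<in>Basis. pdx k (pdy b P) (snd_pair z) * (snd (snd z) \<bullet> k))" for b
    by (simp add: sum_distrib_left mult_ac)
  have "spray L (0, a) z = (1 / 4) * (\<Sum>b\<in>Basis. ?g b / (\<phi> ?x)\<^sup>2 *
     (2 * \<phi> ?x * ?s * pdy b P (snd_pair z) +
      (\<phi> ?x)\<^sup>2 * (\<Sum>k\<in>Basis. pdx k (pdy b P) (snd_pair z) * (snd (snd z) \<bullet> k)) -
      (\<phi> ?x)\<^sup>2 * pdx b P (snd_pair z)))"
    unfolding spray_def
    by (simp add: sum_Basis_prod fund_tensor_inv_L[OF z] pd_pdy_L[OF z] pd_L[OF z] inner_prod_def s s2)
  also have "\<dots> = (\<Sum>b\<in>Basis. (1 / 4) * (?g b *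
     ((\<Sum>k\<in>Basis. pdx k (pdy b P) (snd_pair z) * (snd (snd z) \<bullet> k)) - pdx b P (snd_pair z)))
     + (?s / (2 * \<phi> ?x)) * (?g b * pdy b P (snd_pair z)))"
    unfolding sum_distrib_left[of "1 / 4"] using nz
    by (intro sum.cong refl) (simp add: field_simps power2_eq_square)
  also have "\<dots> = spray P a (snd_pair z) + (?s / (2 * \<phi> ?x)) * (\<Sum>b\<in>Basis. ?g b * pdy b P (snd_pair z))"
    by (simp add: spray_def sum.distrib sum_distrib_left)
  also have "(\<Sum>b\<in>Basis. ?g b * pdy b P (snd_pair z)) = 2 * (snd (snd z) \<bullet> a)"
    using fibre.fund_tensor_inv_gradient[OF WD'(3,4)[OF z] a] by (simp add: snd_pair_def)
  also have "?s / (2 * \<phi> ?x) * (2 * (snd (snd z) \<bullet> a)) = dlog (fst_pair z) * (snd (snd z) \<bullet> a)"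
    by (simp add: dlog_def sum_divide_distrib[symmetric])
  finally show ?thesis .
qed

section \<open>Divergence of the spray and mean Berwald curvature\<close>

abbreviation D1 where "D1 w \<equiv> \<Sum>s\<in>Basis. pdy s (spray A s) w"
abbreviation D2 where "D2 w \<equiv> \<Sum>s\<in>Basis. pdy s (spray P s) w"

lemma pd_spray_L_base:
  assumes z: "z \<in> W"
  shows "pdx (j, 0) (spray L (i, 0)) z = pdx j (spray A i) (fst_pair z)
      - frechet_derivative (grad i) (at (fst (fst z))) j * P (snd_pair z)"
    and "pdy (j, 0) (spray L (i, 0)) z = pdy j (spray A i) (fst_pair z)"
    and "pdy (0, b) (spray L (i, 0)) z = - grad i (fst (fst z)) * pdy b P (snd_pair z)"
proof -
  have d: "grad i differentiable at (fst (fst_pair z))"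
    using smooth_on_differentiable[OF smooth_grad] WD'[OF z] by simp
  have "\<forall>w\<in>W. spray L (i, 0) w = spray A i (fst_pair w) + 0 + grad i (fst (fst_pair w)) * (- 1 * P (snd_pair w))"
    using spray_L_base by simp
  note pd = pd_warped[where H = "spray A i" and N = "\<lambda>_. 0" and h = "\<lambda>v. grad i (fst v)" and K = "\<lambda>v. - 1 * P v", OF this base.smooth_spray smooth_base[OF smooth_grad]
      smooth_on_mult[OF fibre.open_slit smooth_on_const fibre.smooth] smooth_zero z]
  show "pdx (j, 0) (spray L (i, 0)) z = pdx j (spray A i) (fst_pair z)
      - frechet_derivative (grad i) (at (fst (fst z))) j * P (snd_pair z)"
    and "pdy (j, 0) (spray L (i, 0)) z = pdy j (spray A i) (fst_pair z)"
    and "pdy (0, b) (spray L (i, 0)) z = - grad i (fst (fst z)) * pdy b P (snd_pair z)"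
    unfolding pd pd_base[OF d] pd_cmult[OF smooth_on_differentiable[OF fibre.smooth WD(2)[OF z]]] by simp_all
qed

lemma pd_spray_L_fibre:
  assumes z: "z \<in> W" and a: "a \<in> Basis"
  shows "pdx (0, b) (spray L (0, a)) z = pdx b (spray P a) (snd_pair z)"
    and "pdy (j, 0) (spray L (0, a)) z = pdy j dlog (fst_pair z) * (snd (snd z) \<bullet> a)"
    and "pdy (0, b) (spray L (0, a)) z = pdy b (spray P a) (snd_pair z) + dlog (fst_pair z) * (b \<bullet> a)"
proof -
  have "\<forall>w\<in>W. spray L (0, a) w = 0 + spray P a (snd_pair w) + dlog (fst_pair w) * (snd (snd_pair w) \<bullet> a)"
    using spray_L_fibre[OF _ a] by simp
  note pd = pd_warped[where H = "\<lambda>_. 0" and N = "spray P a" and h = "dlog" and K = "\<lambda>v. snd v \<bullet> a", OF this smooth_zero smooth_dlog smooth_on_fibre_coord fibre.smooth_spray z]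
  show "pdx (0, b) (spray L (0, a)) z = pdx b (spray P a) (snd_pair z)"
    and "pdy (j, 0) (spray L (0, a)) z = pdy j dlog (fst_pair z) * (snd (snd z) \<bullet> a)"
    and "pdy (0, b) (spray L (0, a)) z = pdy b (spray P a) (snd_pair z) + dlog (fst_pair z) * (b \<bullet> a)"
    unfolding pd by simp_all
qed

text \<open>The base correction \<open>grad * P\<close> does not depend on the base velocity, so it
  has no trace; the fibre correction has the trace of \<open>dlog\<close> times the
  identity.\<close>

lemma divergence_L:
  assumes z: "z \<in> W"
  shows "(\<Sum>s\<in>Basis. pdy s (spray L s) z) =
    (D1 (fst_pair z) + real DIM('f) * dlog (fst_pair z)) + D2 (snd_pair z)"
  by (simp add: sum_Basis_prod pd_spray_L_base[OF z] pd_spray_L_fibre[OF z] sum.distrib)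

lemma smooth_D1_dlog: "smooth_on (U \<times> - {0}) (\<lambda>w. D1 w + real DIM('f) * dlog w)"
  by (rule smooth_on_add[OF base.open_slit base.smooth_divergence
        smooth_on_mult[OF base.open_slit smooth_on_const smooth_dlog]])

lemma pd_divergence_L:
  assumes z: "z \<in> W"
  shows "pdx (j, 0) (\<lambda>w. \<Sum>s\<in>Basis. pdy s (spray L s) w) z = pdx j D1 (fst_pair z) + real DIM('f) * pdx j dlog (fst_pair z)"
    and "pdx (0, b) (\<lambda>w. \<Sum>s\<in>Basis. pdy s (spray L s) w) z = pdx b D2 (snd_pair z)"
    and "pdy (j, 0) (\<lambda>w. \<Sum>s\<in>Basis. pdy s (spray L s) w) z = pdy j D1 (fst_pair z) + real DIM('f) * pdy j dlog (fst_pair z)"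
    and "pdy (0, b) (\<lambda>w. \<Sum>s\<in>Basis. pdy s (spray L s) w) z = pdy b D2 (snd_pair z)"
proof -
  have "\<forall>w\<in>W. (\<Sum>s\<in>Basis. pdy s (spray L s) w) = (D1 (fst_pair w) + real DIM('f) * dlog (fst_pair w)) + D2 (snd_pair w) + 0 * 0"
    using divergence_L by simp
  note pd = pd_warped[where H = "\<lambda>w. D1 w + real DIM('f) * dlog w" and N = D2 and h = "\<lambda>_. 0" and K = "\<lambda>_. 0", OF this smooth_D1_dlog smooth_zero smooth_zero fibre.smooth_divergence z]
  note d = smooth_on_differentiable[OF base.smooth_divergence WD(1)[OF z]] smooth_on_differentiable[OF smooth_dlog WD(1)[OF z]]
  note e = pd_add[OF d(1) smooth_on_differentiable[OF smooth_on_mult[OF base.open_slit smooth_on_const smooth_dlog] WD(1)[OF z]]]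
    pd_cmult[OF d(2)]
  show "pdx (j, 0) (\<lambda>w. \<Sum>s\<in>Basis. pdy s (spray L s) w) z = pdx j D1 (fst_pair z) + real DIM('f) * pdx j dlog (fst_pair z)"
    and "pdx (0, b) (\<lambda>w. \<Sum>s\<in>Basis. pdy s (spray L s) w) z = pdx b D2 (snd_pair z)"
    and "pdy (j, 0) (\<lambda>w. \<Sum>s\<in>Basis. pdy s (spray L s) w) z = pdy j D1 (fst_pair z) + real DIM('f) * pdy j dlog (fst_pair z)"
    and "pdy (0, b) (\<lambda>w. \<Sum>s\<in>Basis. pdy s (spray L s) w) z = pdy b D2 (snd_pair z)"
    unfolding pd e by simp_all
qed


lemma smooth_spray_L:
  assumes "i \<in> Basis"
  shows "smooth_on W (spray L i)"
proof -
  show ?thesis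
    using assms
  proof (cases rule: Basis_prodE)
    case (fst j)
    have "smooth_on W (\<lambda>w. spray A j (fst_pair w) - (\<lambda>v. grad j (fst v)) (fst_pair w) * P (snd_pair w))"
      by (intro smooth_on_diff smooth_on_mult open_W smooth_fst_pair smooth_snd_pair
          base.smooth_spray smooth_base smooth_grad fibre.smooth)
    then show ?thesis
      by (rule smooth_on_cong[OF open_W, rotated]) (simp add: fst spray_L_base)
  next
    case (snd a)
    have "smooth_on W (\<lambda>w. spray P a (snd_pair w) + dlog (fst_pair w) * (\<lambda>v. snd v \<bullet> a) (snd_pair w))"
      by (intro smooth_on_add smooth_on_mult open_W smooth_fst_pair smooth_snd_pair
          fibre.smooth_spray smooth_dlog smooth_on_fibre_coord)
    then show ?thesis
      by (rule smooth_on_cong[OF open_W, rotated]) (simp add: snd spray_L_fibre)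
  qed
qed

text \<open>The divergence is a function of the base coordinates plus a function of the fibre
  coordinates, so mixed second derivatives vanish and each diagonal block reduces to its own
  factor.\<close>

lemma weakly_berwald_L:
  assumes fibre_weakly_berwald: "\<And>a b. a \<in> Basis \<Longrightarrow> b \<in> Basis \<Longrightarrow> mean_berwald P a b (snd_pair z) = 0"
    and z: "z \<in> W" and ij: "i \<in> Basis" "j \<in> Basis"
  shows "mean_berwald L i j z = 0"
proof -
  have z1: "fst_pair z = (fst (fst z), fst (snd z))" by (simp add: fst_pair_def)
  have w1: "pdy i (pdy j D1) (fst_pair z) = 0" if "i \<in> Basis" "j \<in> Basis" for i j
    using base_weakly_berwald[OF WD'(1,2)[OF z] that] unfolding mean_berwald_def z1 by simp
  have w2: "pdy a (pdy b D2) (snd_pair z) = 0" if "a \<in> Basis" "b \<in> Basis" for a b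
    using fibre_weakly_berwald[OF that] unfolding mean_berwald_def by simp
  show ?thesis
    using ij(2)
  proof (cases rule: Basis_prodE)
    case (fst k)
    let ?r = "\<lambda>v :: 'e \<times> 'e. d\<phi> k (fst v) / \<phi> (fst v)"
    have sm: "smooth_on (U \<times> - {0}) (pdy k D1)" "smooth_on (U \<times> - {0}) ?r"
        "smooth_on (U \<times> - {0}) (\<lambda>v. real DIM('f) * ?r v)"
      using smooth_on_pdy[OF base.smooth_divergence] smooth_base[OF smooth_ratio]
        smooth_on_mult[OF base.open_slit smooth_on_const smooth_base[OF smooth_ratio]] by blast+
    note d = smooth_on_differentiable[OF _ WD(1)[OF z]]
    have r0: "pdy i ?r (fst_pair z) = 0" for i
      using smooth_on_differentiable[OF smooth_ratio, of "fst (fst z)"] WD'(1)[OF z]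
      by (subst pd_base(2)) simp_all
    have e: "pdy i (\<lambda>v. pdy k D1 v + real DIM('f) * ?r v) (fst_pair z) = 0" if "i \<in> Basis" for i
      unfolding pd_add[OF d[OF sm(1)] d[OF sm(3)]] pd_cmult[OF d[OF sm(2)]] by (simp only: r0 w1[OF that fst(1)])
    have "\<forall>w\<in>W. pdy j (\<lambda>w. \<Sum>s\<in>Basis. pdy s (spray L s) w) w =
        (pdy k D1 (fst_pair w) + real DIM('f) * ?r (fst_pair w)) + 0 + 0 * 0"
      using fst pd_divergence_L(3) pdy_dlog[OF WD(1)] by simp
    note pd = pd_warped(3,4)[where H = "\<lambda>v. pdy k D1 v + real DIM('f) * ?r v" and N = "\<lambda>_. 0" and h = "\<lambda>_. 0" and K = "\<lambda>_. 0",
        OF this smooth_on_add[OF base.open_slit sm(1,3)] smooth_zero smooth_zero smooth_zero z]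
    have "pdy i (pdy j (\<lambda>w. \<Sum>s\<in>Basis. pdy s (spray L s) w)) z = 0"
      using ij(1) by (cases rule: Basis_prodE) (simp_all only: pd e pd_const mult_zero_left add_0_right)
    then show ?thesis by (simp add: mean_berwald_def)
  next
    case (snd b)
    have "\<forall>w\<in>W. pdy j (\<lambda>w. \<Sum>s\<in>Basis. pdy s (spray L s) w) w = 0 + pdy b D2 (snd_pair w) + 0 * 0"
      using snd pd_divergence_L(4) by simp
    note pd = pd_warped(3,4)[where H = "\<lambda>_. 0" and N = "pdy b D2" and h = "\<lambda>_. 0" and K = "\<lambda>_. 0",
        OF this smooth_zero smooth_zero smooth_zero smooth_on_pdy[OF fibre.smooth_divergence] z]
    have "pdy i (pdy j (\<lambda>w. \<Sum>s\<in>Basis. pdy s (spray L s) w)) z = 0"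
      using ij(1) by (cases rule: Basis_prodE) (simp_all add: pd w2 snd(1))
    then show ?thesis by (simp add: mean_berwald_def)
  qed
qed

text \<open>In invariant terms, \<open>hess_log (x, y)\<close> is \<open>Hess \<phi> (y, y) / \<phi>\<close>, and \<open>warp_laplacian (x, y)\<close> is
  \<open>\<phi> \<Delta>\<phi> + (n - 1) |\<nabla>\<phi>|\<^sup>2\<close>, where \<open>n\<close> is the dimension of the fibre.\<close>

definition hess_log :: "'e \<times> 'e \<Rightarrow> real" where
  "hess_log v = (\<Sum>k\<in>Basis. (snd v \<bullet> k) * pdx k dlog v)
     - 2 * (\<Sum>i\<in>Basis. spray A i v * pdy i dlog v) + (dlog v)\<^sup>2"

definition warp_laplacian :: "'e \<times> 'e \<Rightarrow> real" where
  "warp_laplacian v = 2 * (\<Sum>i\<in>Basis. frechet_derivative (grad i) (at (fst v)) i)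
     + 2 * (\<Sum>i\<in>Basis. grad i (fst v) * pdy i D1 v)
     + (2 * real DIM('f) - 4) * (\<Sum>i\<in>Basis. grad i (fst v) * pdy i dlog v)"

section \<open>Ricci curvature of the warped product\<close>

lemma sum_Basis_inner:
  assumes "a \<in> Basis"
  shows "(\<Sum>b\<in>Basis. (b \<bullet> a) * h b) = (h a :: real)" "(\<Sum>b\<in>Basis. (a \<bullet> b) * h b) = h a"
    "(\<Sum>b\<in>Basis. h b * (b \<bullet> a)) = (h a :: real)" "(\<Sum>b\<in>Basis. h b * (a \<bullet> b)) = h a"
  using assms
  by (simp_all add: inner_Basis if_distrib[of "\<lambda>c. _ * c"] if_distrib[of "\<lambda>c. c * _"] cong: if_cong)

text \<open>\<open>S1\<close> to \<open>S4\<close> evaluate the four sums of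
  \<open>ricci_curv_eq_divergence\<close>. The terms \<open>2 * dlog * D2\<close> coming from
  \<open>S3\<close> and \<open>S4\<close> cancel. In \<open>warp_laplacian\<close> the coefficient
  \<open>2 * n - 4\<close> combines \<open>2 * n\<close>, from differentiating
  \<open>n * dlog\<close> along \<open>grad\<close>, with \<open>- 4\<close> from the off-diagonal
  blocks in \<open>S4\<close>.\<close>

lemma ricci_curv_L:
  assumes z: "z \<in> W"
  shows "ricci_curv L z = ricci_curv A (fst_pair z) + ricci_curv P (snd_pair z)
    - real DIM('f) * hess_log (fst_pair z) - P (snd_pair z) * warp_laplacian (fst_pair z)"
proof -
  define x where "x = fst (fst z)"
  define z1 where "z1 = fst_pair z"
  define z2 where "z2 = snd_pair z"
  define y2 where "y2 = snd (snd z)"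
  define n where "n = real DIM('f)"
  let ?D = "\<lambda>w. \<Sum>s\<in>Basis. pdy s (spray L s) w"
  let ?dw = "\<Sum>i\<in>Basis. frechet_derivative (grad i) (at x) i"
  let ?wD = "\<Sum>i\<in>Basis. grad i x * pdy i D1 z1"
  let ?wt = "\<Sum>i\<in>Basis. grad i x * pdy i dlog z1"
  let ?Gt = "\<Sum>i\<in>Basis. spray A i z1 * pdy i dlog z1"
  have sn: "snd z \<bullet> (i, 0) = snd z1 \<bullet> i" "snd z \<bullet> (0, a) = y2 \<bullet> a" for i a
    by (simp_all add: z1_def y2_def inner_prod_def)
  note defs = x_def[symmetric] z1_def[symmetric] z2_def[symmetric] y2_def[symmetric] n_def[symmetric]
  have y2z2: "snd z2 = y2" by (simp add: z2_def y2_def)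
  have z2m: "z2 \<in> V \<times> - {0}" using WD(2)[OF z] by (simp add: z2_def)
  have z2eq: "z2 = (fst z2, y2)" "fst z2 \<in> V" "y2 \<noteq> 0" using z2m y2z2 by (auto simp: mem_Times_iff)
  have S1: "(\<Sum>i\<in>Basis. pdx i (spray L i) z) =
      (\<Sum>i\<in>Basis. pdx i (spray A i) z1) - ?dw * P z2 + (\<Sum>a\<in>Basis. pdx a (spray P a) z2)"
    by (simp add: sum_Basis_prod pd_spray_L_base[OF z] pd_spray_L_fibre[OF z] defs
        sum_subtractf sum_distrib_right)
  have S2: "(\<Sum>j\<in>Basis. (snd z \<bullet> j) * pdx j ?D z) =
      (\<Sum>j\<in>Basis. (snd z1 \<bullet> j) * pdx j D1 z1) + n * (\<Sum>k\<in>Basis. (snd z1 \<bullet> k) * pdx k dlog z1)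
      + (\<Sum>b\<in>Basis. (y2 \<bullet> b) * pdx b D2 z2)"
    by (subst sum_Basis_prod)
      (simp add: pd_divergence_L[OF z] sn defs sum.distrib sum_distrib_left algebra_simps)
  \<comment> \<open>Radial derivatives, produced by the summand \<open>dlog * y2\<close> of the
    fibre spray and by the mixed blocks: \<open>D2\<close> has degree 1 and \<open>P\<close> degree
    2.\<close>
  have eD2: "(\<Sum>a\<in>Basis. (y2 \<bullet> a) * pdy a D2 z2) = D2 z2"
    using euler_identity[OF fibre.smooth_divergence fibre.divergence_homogeneous z2eq(2,3)] z2eq(1)
    by simp
  have eP: "(\<Sum>a\<in>Basis. (y2 \<bullet> a) * pdy a P z2) = 2 * P z2"
    using euler_identity[OF fibre.smooth fibre.homogeneous z2eq(2,3)] z2eq(1) by simp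
  have "(\<Sum>j\<in>Basis. spray L j z * pdy j ?D z) =
      (\<Sum>i\<in>Basis. (spray A i z1 - grad i x * P z2) * (pdy i D1 z1 + n * pdy i dlog z1))
      + (\<Sum>a\<in>Basis. (spray P a z2 + dlog z1 * (y2 \<bullet> a)) * pdy a D2 z2)"
    by (subst sum_Basis_prod)
      (simp add: pd_divergence_L[OF z] spray_L_base[OF z] spray_L_fibre[OF z] defs)
  also have "(\<Sum>i\<in>Basis. (spray A i z1 - grad i x * P z2) * (pdy i D1 z1 + n * pdy i dlog z1))
     = (\<Sum>i\<in>Basis. spray A i z1 * pdy i D1 z1) + n * ?Gt - P z2 * ?wD - n * P z2 * ?wt"
    by (simp add: algebra_simps sum.distrib sum_subtractf sum_distrib_left)
  also have "(\<Sum>a\<in>Basis. (spray P a z2 + dlog z1 * (y2 \<bullet> a)) * pdy a D2 z2)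
     = (\<Sum>a\<in>Basis. spray P a z2 * pdy a D2 z2) + dlog z1 * (\<Sum>a\<in>Basis. (y2 \<bullet> a) * pdy a D2 z2)"
    by (simp add: distrib_right sum.distrib sum_distrib_left mult.assoc)
  finally have S3: "(\<Sum>j\<in>Basis. spray L j z * pdy j ?D z) =
      (\<Sum>i\<in>Basis. spray A i z1 * pdy i D1 z1) + n * ?Gt - P z2 * ?wD - n * P z2 * ?wt
      + (\<Sum>a\<in>Basis. spray P a z2 * pdy a D2 z2) + dlog z1 * D2 z2"
    unfolding eD2 by simp
  have "(\<Sum>i\<in>Basis. \<Sum>j\<in>Basis. pdy j (spray L i) z * pdy i (spray L j) z) =
      (\<Sum>i\<in>Basis. \<Sum>j\<in>Basis. pdy j (spray A i) z1 * pdy i (spray A j) z1)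
      + (\<Sum>i\<in>Basis. \<Sum>a\<in>Basis. - grad i x * pdy a P z2 * (pdy i dlog z1 * (y2 \<bullet> a)))
      + (\<Sum>a\<in>Basis. \<Sum>i\<in>Basis. pdy i dlog z1 * (y2 \<bullet> a) * (- grad i x * pdy a P z2))
      + (\<Sum>a\<in>Basis. \<Sum>b\<in>Basis. (pdy b (spray P a) z2 + dlog z1 * (b \<bullet> a)) * (pdy a (spray P b) z2 + dlog z1 * (a \<bullet> b)))"
    by (simp add: sum_Basis_prod pd_spray_L_base[OF z] pd_spray_L_fibre[OF z] defs sum.distrib)
  \<comment> \<open>The two off-diagonal blocks contribute equally, each
    \<open>- 2 * P * ?wt\<close> after Euler's identity.\<close>
  also have "(\<Sum>a\<in>Basis. \<Sum>i\<in>Basis. pdy i dlog z1 * (y2 \<bullet> a) * (- grad i x * pdy a P z2))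
     = (\<Sum>i\<in>Basis. \<Sum>a\<in>Basis. - grad i x * pdy a P z2 * (pdy i dlog z1 * (y2 \<bullet> a)))"
    by (subst sum.swap) (simp add: mult_ac)
  also have "(\<Sum>i\<in>Basis. \<Sum>a\<in>Basis. - grad i x * pdy a P z2 * (pdy i dlog z1 * (y2 \<bullet> a)))
     = - (?wt * (\<Sum>a\<in>Basis. (y2 \<bullet> a) * pdy a P z2))"
    unfolding sum_product sum_negf[symmetric] by (intro sum.cong refl) simp
  also have "(\<Sum>a\<in>Basis. \<Sum>b\<in>Basis. (pdy b (spray P a) z2 + dlog z1 * (b \<bullet> a)) * (pdy a (spray P b) z2 + dlog z1 * (a \<bullet> b)))
     = (\<Sum>a\<in>Basis. (\<Sum>b\<in>Basis. pdy b (spray P a) z2 * pdy a (spray P b) z2)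
         + dlog z1 * (\<Sum>b\<in>Basis. pdy b (spray P a) z2 * (a \<bullet> b))
         + dlog z1 * (\<Sum>b\<in>Basis. (b \<bullet> a) * pdy a (spray P b) z2)
         + (dlog z1)\<^sup>2 * (\<Sum>b\<in>Basis. (b \<bullet> a) * (a \<bullet> b)))"
    by (intro sum.cong refl)
      (simp add: algebra_simps sum.distrib sum_distrib_left power2_eq_square)
  also have "\<dots> = (\<Sum>a\<in>Basis. \<Sum>b\<in>Basis. pdy b (spray P a) z2 * pdy a (spray P b) z2)
     + 2 * dlog z1 * D2 z2 + n * (dlog z1)\<^sup>2"
    by (simp add: sum_Basis_inner sum.distrib sum_distrib_left n_def mult.assoc cong: sum.cong)
  finally have S4: "(\<Sum>i\<in>Basis. \<Sum>j\<in>Basis. pdy j (spray L i) z * pdy i (spray L j) z) =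
      (\<Sum>i\<in>Basis. \<Sum>j\<in>Basis. pdy j (spray A i) z1 * pdy i (spray A j) z1) - 4 * P z2 * ?wt
      + (\<Sum>a\<in>Basis. \<Sum>b\<in>Basis. pdy b (spray P a) z2 * pdy a (spray P b) z2)
      + 2 * dlog z1 * D2 z2 + n * (dlog z1)\<^sup>2"
    unfolding eP by simp
  have RA: "ricci_curv A z1 = 2 * (\<Sum>i\<in>Basis. pdx i (spray A i) z1) - (\<Sum>j\<in>Basis. (snd z1 \<bullet> j) * pdx j D1 z1)
    + 2 * (\<Sum>i\<in>Basis. spray A i z1 * pdy i D1 z1)
    - (\<Sum>i\<in>Basis. \<Sum>j\<in>Basis. pdy j (spray A i) z1 * pdy i (spray A j) z1)"
    using WD(1)[OF z] unfolding z1_def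
    by (intro ricci_curv_eq_divergence[OF base.open_slit] base.smooth_spray)
  have RP: "ricci_curv P z2 = 2 * (\<Sum>a\<in>Basis. pdx a (spray P a) z2) - (\<Sum>b\<in>Basis. (y2 \<bullet> b) * pdx b D2 z2)
    + 2 * (\<Sum>a\<in>Basis. spray P a z2 * pdy a D2 z2)
    - (\<Sum>a\<in>Basis. \<Sum>b\<in>Basis. pdy b (spray P a) z2 * pdy a (spray P b) z2)"
    unfolding y2z2[symmetric]
    by (intro ricci_curv_eq_divergence[OF fibre.open_slit] fibre.smooth_spray z2m)
  have x1: "fst z1 = x" by (simp add: z1_def x_def)
  show ?thesis
    unfolding ricci_curv_eq_divergence[OF open_W z smooth_spray_L, simplified] S1 S2 S3 S4
      defs RA RP hess_log_def warp_laplacian_def x1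
    by (simp add: algebra_simps)
qed

end

section \<open>Symmetry and positivity of inverse matrices\<close>

lemma inner_inv_matrix_map:
  assumes sym: "\<And>i j. i \<in> Basis \<Longrightarrow> j \<in> Basis \<Longrightarrow> m i j = m j i"
    and inj: "inj (matrix_map m)"
  shows "inv (matrix_map m) u \<bullet> v = inv (matrix_map m) v \<bullet> u"
proof -
  have s: "matrix_map m u \<bullet> v = matrix_map m v \<bullet> u" for u v
  proof -
    have e: "matrix_map m u \<bullet> v = (\<Sum>i\<in>Basis. \<Sum>j\<in>Basis. m i j * (u \<bullet> j) * (v \<bullet> i))" for u v
      by (subst euclidean_inner) (simp add: matrix_map_inner sum_distrib_right)
    have "matrix_map m u \<bullet> v = (\<Sum>j\<in>Basis. \<Sum>i\<in>Basis. m i j * (u \<bullet> j) * (v \<bullet> i))"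
      unfolding e by (rule sum.swap)
    also have "\<dots> = matrix_map m v \<bullet> u"
      unfolding e by (intro sum.cong refl) (simp add: sym)
    finally show ?thesis .
  qed
  have "matrix_map m (inv (matrix_map m) w) = w" for w
    using inj[THEN inj_matrix_map_imp_bij] by (simp add: bij_is_surj surj_f_inv_f)
  then show ?thesis
    using s[of "inv (matrix_map m) u" "inv (matrix_map m) v"] by (simp add: inner_commute)
qed

text \<open>With \<open>v = M u\<close>, the form of the inverse at \<open>v\<close> is the form of
  \<open>M\<close> at \<open>u\<close>.\<close>

lemma inv_matrix_map_pos:
  assumes pos: "\<And>v. v \<noteq> 0 \<Longrightarrow> (\<Sum>i\<in>Basis. \<Sum>j\<in>Basis. m i j * (v \<bullet> i) * (v \<bullet> j)) > 0" and v: "v \<noteq> 0"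
  shows "(\<Sum>i\<in>Basis. \<Sum>l\<in>Basis. (inv (matrix_map m) l \<bullet> i) * (v \<bullet> i) * (v \<bullet> l)) > 0"
proof -
  have inj: "inj (matrix_map m)" by (rule inj_matrix_map_pos[OF pos])
  have lin: "linear (inv (matrix_map m))" by (rule linear_inv_matrix_map[OF inj])
  define u where "u = inv (matrix_map m) v"
  have Mu: "matrix_map m u = v"
    unfolding u_def using inj[THEN inj_matrix_map_imp_bij] by (simp add: bij_is_surj surj_f_inv_f)
  have u0: "u \<noteq> 0" using Mu v linear_0[OF linear_matrix_map] by metis
  have "u = (\<Sum>l\<in>Basis. (v \<bullet> l) *\<^sub>R inv (matrix_map m) l)"
    unfolding u_def by (subst euclidean_representation[of v, symmetric])
      (simp only: linear_sum[OF lin] linear_scale[OF lin])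
  then have "u \<bullet> i = (\<Sum>l\<in>Basis. (v \<bullet> l) * (inv (matrix_map m) l \<bullet> i))" for i
    by (simp add: inner_sum_left)
  then have "(\<Sum>i\<in>Basis. \<Sum>l\<in>Basis. (inv (matrix_map m) l \<bullet> i) * (v \<bullet> i) * (v \<bullet> l)) = (\<Sum>i\<in>Basis. (u \<bullet> i) * (v \<bullet> i))"
    by (simp add: sum_distrib_right sum_distrib_left mult_ac)
  also have "\<dots> = (\<Sum>i\<in>Basis. \<Sum>j\<in>Basis. m i j * (u \<bullet> i) * (u \<bullet> j))"
    unfolding Mu[symmetric] by (intro sum.cong refl) (simp add: matrix_map_inner sum_distrib_left mult_ac)
  finally show ?thesis using pos[OF u0] by simp
qed

section \<open>Forms with coefficients on the base\<close>

text \<open>A Riemannian metric and its spray are quadratic in \<open>y\<close>, their fibre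
  derivatives linear; these rules for linear forms and the next ones for quadratic forms
  differentiate all of them.\<close>

lemma
  fixes e :: "'e \<Rightarrow> 'e::euclidean_space \<Rightarrow> real"
  assumes e: "\<And>k. k \<in> Basis \<Longrightarrow> e k differentiable (at (fst v))"
  shows pdx_linear_form: "pdx s (\<lambda>v. \<Sum>k\<in>Basis. e k (fst v) * (snd v \<bullet> k)) v = (\<Sum>k\<in>Basis. frechet_derivative (e k) (at (fst v)) s * (snd v \<bullet> k))"
    and pdy_linear_form: "s \<in> Basis \<Longrightarrow> pdy s (\<lambda>v. \<Sum>k\<in>Basis. e k (fst v) * (snd v \<bullet> k)) v = e s (fst v)"
proof -
  have d1: "(\<lambda>w. e j (fst w)) differentiable (at v)" if "j \<in> Basis" for j
    by (rule differentiableI[OF has_derivative_compose_bounded_linear[OF bounded_linear_fst e[OF that]]])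
  have d3: "(\<lambda>w. snd w \<bullet> j) differentiable (at v)" for j :: 'e
    using smooth_on_differentiable[OF smooth_on_fibre_coord UNIV_I] .
  have "pdx s (\<lambda>v. \<Sum>k\<in>Basis. e k (fst v) * (snd v \<bullet> k)) v = (\<Sum>k\<in>Basis. pdx s (\<lambda>v. e k (fst v) * (snd v \<bullet> k)) v)"
    by (rule pd_sum) (intro differentiable_mult d1 d3)
  also have "\<dots> = (\<Sum>k\<in>Basis. frechet_derivative (e k) (at (fst v)) s * (snd v \<bullet> k))"
    by (intro sum.cong refl) (subst pd_mult(1)[OF d1 d3], assumption, subst pd_base(1)[OF e], assumption, simp)
  finally show "pdx s (\<lambda>v. \<Sum>k\<in>Basis. e k (fst v) * (snd v \<bullet> k)) v = (\<Sum>k\<in>Basis. frechet_derivative (e k) (at (fst v)) s * (snd v \<bullet> k))" .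
  assume s: "s \<in> Basis"
  have "pdy s (\<lambda>v. \<Sum>k\<in>Basis. e k (fst v) * (snd v \<bullet> k)) v = (\<Sum>k\<in>Basis. pdy s (\<lambda>v. e k (fst v) * (snd v \<bullet> k)) v)"
    by (rule pd_sum) (intro differentiable_mult d1 d3)
  also have "\<dots> = (\<Sum>k\<in>Basis. e k (fst v) * (s \<bullet> k))"
    by (intro sum.cong refl) (subst pd_mult(2)[OF d1 d3], assumption, subst pd_base(2)[OF e], assumption, simp)
  also have "\<dots> = e s (fst v)"
    using s by (simp add: inner_Basis if_distrib[of "\<lambda>c. _ * c"] cong: if_cong)
  finally show "pdy s (\<lambda>v. \<Sum>k\<in>Basis. e k (fst v) * (snd v \<bullet> k)) v = e s (fst v)" .
qed

text \<open>The form is read as \<open>\<Sum>j. y j * (linear form)\<close>, so the product rule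
  reduces it to the linear case. The coefficients are not taken symmetric because
  \<open>christoffel\<close> below is not symmetric in its last two indices.\<close>

lemma
  fixes c :: "'e \<Rightarrow> 'e \<Rightarrow> 'e::euclidean_space \<Rightarrow> real"
  assumes c: "\<And>j k. j \<in> Basis \<Longrightarrow> k \<in> Basis \<Longrightarrow> c j k differentiable (at (fst v))"
  shows pdx_quadratic_form: "pdx s (\<lambda>v. \<Sum>j\<in>Basis. \<Sum>k\<in>Basis. c j k (fst v) * (snd v \<bullet> j) * (snd v \<bullet> k)) v =
      (\<Sum>j\<in>Basis. \<Sum>k\<in>Basis. frechet_derivative (c j k) (at (fst v)) s * (snd v \<bullet> j) * (snd v \<bullet> k))"
    and pdy_quadratic_form: "s \<in> Basis \<Longrightarrow> pdy s (\<lambda>v. \<Sum>j\<in>Basis. \<Sum>k\<in>Basis. c j k (fst v) * (snd v \<bullet> j) * (snd v \<bullet> k)) v =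
      (\<Sum>k\<in>Basis. (c s k (fst v) + c k s (fst v)) * (snd v \<bullet> k))"
proof -
  have eq: "(\<lambda>v::'e \<times> 'e. \<Sum>j\<in>Basis. \<Sum>k\<in>Basis. c j k (fst v) * (snd v \<bullet> j) * (snd v \<bullet> k)) =
    (\<lambda>v. \<Sum>j\<in>Basis. (snd v \<bullet> j) * (\<Sum>k\<in>Basis. c j k (fst v) * (snd v \<bullet> k)))"
    by (simp add: sum_distrib_left mult_ac)
  have d1: "(\<lambda>w. c j k (fst w)) differentiable (at v)" if "j \<in> Basis" "k \<in> Basis" for j k
    by (rule differentiableI[OF has_derivative_compose_bounded_linear[OF bounded_linear_fst c[OF that]]])
  have d3: "(\<lambda>w. snd w \<bullet> j) differentiable (at v)" for j :: 'e
    using smooth_on_differentiable[OF smooth_on_fibre_coord UNIV_I] .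
  have d4: "(\<lambda>v. \<Sum>k\<in>Basis. c j k (fst v) * (snd v \<bullet> k)) differentiable (at v)" if "j \<in> Basis" for j
    using that by (intro differentiable_sum finite_Basis ballI differentiable_mult d1 d3) auto
  have "pdx s (\<lambda>v. \<Sum>j\<in>Basis. (snd v \<bullet> j) * (\<Sum>k\<in>Basis. c j k (fst v) * (snd v \<bullet> k))) v =
    (\<Sum>j\<in>Basis. pdx s (\<lambda>v. (snd v \<bullet> j) * (\<Sum>k\<in>Basis. c j k (fst v) * (snd v \<bullet> k))) v)"
    by (rule pd_sum) (intro differentiable_mult d4 d3)
  also have "\<dots> = (\<Sum>j\<in>Basis. (snd v \<bullet> j) * (\<Sum>k\<in>Basis. frechet_derivative (c j k) (at (fst v)) s * (snd v \<bullet> k)))"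
    by (intro sum.cong refl) (subst pd_mult(1)[OF d3 d4], assumption, subst pdx_linear_form[OF c], simp_all)
  finally show "pdx s (\<lambda>v. \<Sum>j\<in>Basis. \<Sum>k\<in>Basis. c j k (fst v) * (snd v \<bullet> j) * (snd v \<bullet> k)) v =
      (\<Sum>j\<in>Basis. \<Sum>k\<in>Basis. frechet_derivative (c j k) (at (fst v)) s * (snd v \<bullet> j) * (snd v \<bullet> k))"
    unfolding eq by (simp add: sum_distrib_left mult_ac)
  assume s: "s \<in> Basis"
  have "pdy s (\<lambda>v. \<Sum>j\<in>Basis. (snd v \<bullet> j) * (\<Sum>k\<in>Basis. c j k (fst v) * (snd v \<bullet> k))) v =
    (\<Sum>j\<in>Basis. pdy s (\<lambda>v. (snd v \<bullet> j) * (\<Sum>k\<in>Basis. c j k (fst v) * (snd v \<bullet> k))) v)"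
    by (rule pd_sum) (intro differentiable_mult d4 d3)
  also have "\<dots> = (\<Sum>j\<in>Basis. (snd v \<bullet> j) * c j s (fst v) + (s \<bullet> j) * (\<Sum>k\<in>Basis. c j k (fst v) * (snd v \<bullet> k)))"
    by (intro sum.cong refl) (subst pd_mult(2)[OF d3 d4], assumption, subst pdy_linear_form[OF c], simp_all add: s)
  also have "\<dots> = (\<Sum>k\<in>Basis. (c s k (fst v) + c k s (fst v)) * (snd v \<bullet> k))"
    using s by (simp add: sum.distrib inner_Basis if_distrib[of "\<lambda>c. c * _"] algebra_simps cong: if_cong)
  finally show "pdy s (\<lambda>v. \<Sum>j\<in>Basis. \<Sum>k\<in>Basis. c j k (fst v) * (snd v \<bullet> j) * (snd v \<bullet> k)) v =
      (\<Sum>k\<in>Basis. (c s k (fst v) + c k s (fst v)) * (snd v \<bullet> k))"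
    unfolding eq .
qed

section \<open>Riemannian metrics in a coordinate domain\<close>

locale riemannian_chart =
  fixes U :: "'e::euclidean_space set" and g :: "'e \<Rightarrow> 'e \<Rightarrow> 'e \<Rightarrow> real" and A :: "'e \<times> 'e \<Rightarrow> real"
  assumes open_U: "open U"
    and smooth_g: "\<And>i j. i \<in> Basis \<Longrightarrow> j \<in> Basis \<Longrightarrow> smooth_on U (g i j)"
    and sym: "\<And>x i j. x \<in> U \<Longrightarrow> i \<in> Basis \<Longrightarrow> j \<in> Basis \<Longrightarrow> g i j x = g j i x"
    and g_pos: "\<And>x v. x \<in> U \<Longrightarrow> v \<noteq> 0 \<Longrightarrow> (\<Sum>i\<in>Basis. \<Sum>j\<in>Basis. g i j x * (v \<bullet> i) * (v \<bullet> j)) > 0"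
    and A: "\<And>x y. x \<in> U \<Longrightarrow> A (x, y) = (\<Sum>i\<in>Basis. \<Sum>j\<in>Basis. g i j x * (y \<bullet> i) * (y \<bullet> j))"
begin

lemma A': "v \<in> U \<times> UNIV \<Longrightarrow> A v = (\<Sum>i\<in>Basis. \<Sum>j\<in>Basis. g i j (fst v) * (snd v \<bullet> i) * (snd v \<bullet> j))"
  using A[of "fst v" "snd v"] by (auto simp: mem_Times_iff)

lemma open_UU: "open (U \<times> (UNIV :: 'e set))"
  by (intro open_Times open_U open_UNIV)

lemma diff_g: "v \<in> U \<times> UNIV \<Longrightarrow> i \<in> Basis \<Longrightarrow> j \<in> Basis \<Longrightarrow> g i j differentiable (at (fst v))"
  using smooth_on_differentiable[OF smooth_g] by (auto simp: mem_Times_iff)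

lemma smooth_A: "smooth_on (U \<times> UNIV) A"
proof -
  have "smooth_on (U \<times> UNIV) (\<lambda>v :: 'e \<times> 'e. \<Sum>i\<in>Basis. \<Sum>j\<in>Basis. g i j (fst v) * (snd v \<bullet> i) * (snd v \<bullet> j))"
    by (intro smooth_on_sum smooth_on_mult open_UU smooth_on_fibre_coord smooth_on_base[OF open_UU _ smooth_g]) auto
  then show ?thesis
    by (rule smooth_on_cong[OF open_UU, rotated]) (simp add: A')
qed

lemma pdx_A:
  assumes v: "v \<in> U \<times> UNIV"
  shows "pdx l A v = (\<Sum>j\<in>Basis. \<Sum>k\<in>Basis. frechet_derivative (g j k) (at (fst v)) l * (snd v \<bullet> j) * (snd v \<bullet> k))"
  using pdx_cong[OF open_UU v A'] pdx_quadratic_form[of g v, OF diff_g[OF v]] by simp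

lemma pdy_A:
  assumes v: "v \<in> U \<times> UNIV" and l: "l \<in> Basis"
  shows "pdy l A v = (\<Sum>k\<in>Basis. (g l k (fst v) + g k l (fst v)) * (snd v \<bullet> k))"
  using pdy_cong[OF open_UU v A'] pdy_quadratic_form[of g v, OF diff_g[OF v] l] by simp

lemma pd_pdy_A:
  assumes v: "v \<in> U \<times> UNIV" and l: "l \<in> Basis"
  shows "pdx k (pdy l A) v = (\<Sum>j\<in>Basis. frechet_derivative (\<lambda>x. g l j x + g j l x) (at (fst v)) k * (snd v \<bullet> j))"
    and "k \<in> Basis \<Longrightarrow> pdy k (pdy l A) v = g l k (fst v) + g k l (fst v)"
proof -
  have d: "(\<lambda>x. g l j x + g j l x) differentiable (at (fst v))" if "j \<in> Basis" for j
    by (intro differentiable_add diff_g[OF v] l that)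
  show "pdx k (pdy l A) v = (\<Sum>j\<in>Basis. frechet_derivative (\<lambda>x. g l j x + g j l x) (at (fst v)) k * (snd v \<bullet> j))"
    using pdx_cong[OF open_UU v pdy_A[OF _ l]] pdx_linear_form[of "\<lambda>j x. g l j x + g j l x" v, OF d] by simp
  show "k \<in> Basis \<Longrightarrow> pdy k (pdy l A) v = g l k (fst v) + g k l (fst v)"
    using pdy_cong[OF open_UU v pdy_A[OF _ l]] pdy_linear_form[of "\<lambda>j x. g l j x + g j l x" v, OF d] by simp
qed

lemma fund_tensor_A: "x \<in> U \<Longrightarrow> i \<in> Basis \<Longrightarrow> j \<in> Basis \<Longrightarrow> fund_tensor A i j (x, y) = g i j x"
  using pd_pdy_A(2)[of "(x, y)" j i] sym[of x i j] by (simp add: fund_tensor_def)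

sublocale finsler_chart U A
proof
  show "open U" by (rule open_U)
  show "smooth_on (U \<times> - {0}) A" using smooth_A by (rule smooth_on_subset) auto
  show "homogeneous_on 2 U A"
    unfolding homogeneous_on_def by (simp add: A sum_distrib_left power2_eq_square mult_ac)
  show "0 < (\<Sum>i\<in>Basis. \<Sum>j\<in>Basis. fund_tensor A i j (x, y) * (v \<bullet> i) * (v \<bullet> j))"
    if "x \<in> U" "v \<noteq> 0" for x y v
    using g_pos that by (simp add: fund_tensor_A cong: sum.cong)
qed

definition ginv :: "'e \<Rightarrow> 'e \<Rightarrow> 'e \<Rightarrow> real" where
  "ginv i l x = inv (matrix_map (\<lambda>a b. g a b x)) l \<bullet> i"

lemma inj_g: "x \<in> U \<Longrightarrow> inj (matrix_map (\<lambda>a b. g a b x))"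
  by (rule inj_matrix_map_pos[OF g_pos])

lemma smooth_ginv: "smooth_on U (ginv i l)"
  unfolding ginv_def[abs_def] by (rule smooth_on_inv_matrix_map[OF open_U inj_g smooth_g])

lemma ginv_sym: "x \<in> U \<Longrightarrow> ginv i l x = ginv l i x"
  unfolding ginv_def using sym inj_g by (intro inner_inv_matrix_map) auto

lemma ginv_pos: "x \<in> U \<Longrightarrow> v \<noteq> 0 \<Longrightarrow> (\<Sum>i\<in>Basis. \<Sum>l\<in>Basis. ginv i l x * (v \<bullet> i) * (v \<bullet> l)) > 0"
  unfolding ginv_def using g_pos by (intro inv_matrix_map_pos) auto

lemma fund_tensor_inv_A: "x \<in> U \<Longrightarrow> fund_tensor_inv A i l (x, y) = ginv i l x"
proof -
  assume x: "x \<in> U"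
  have "matrix_map (\<lambda>a b. fund_tensor A a b (x, y)) = matrix_map (\<lambda>a b. g a b x)"
    unfolding matrix_map_def[abs_def] using x by (intro ext sum.cong refl) (simp add: fund_tensor_A)
  then show ?thesis by (simp add: fund_tensor_inv_eq ginv_def)
qed

text \<open>Coefficients of the spray as a quadratic form in \<open>y\<close>. Symmetrised in
  \<open>j\<close> and \<open>k\<close> they are half the usual Christoffel symbols.\<close>

definition christoffel :: "'e \<Rightarrow> 'e \<Rightarrow> 'e \<Rightarrow> 'e \<Rightarrow> real" where
  "christoffel i j k x = (1 / 4) * (\<Sum>l\<in>Basis. ginv i l x *
     (frechet_derivative (\<lambda>x. g l j x + g j l x) (at x) k - frechet_derivative (g j k) (at x) l))"

lemma smooth_christoffel: "j \<in> Basis \<Longrightarrow> k \<in> Basis \<Longrightarrow> smooth_on U (christoffel i j k)"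
  unfolding christoffel_def[abs_def]
  by (intro smooth_on_mult smooth_on_const smooth_on_sum smooth_on_diff smooth_ginv open_U
      smooth_on_frechet_derivative smooth_on_add smooth_g)

lemma sum_rotate3: "(\<Sum>l\<in>I. \<Sum>j\<in>J. \<Sum>k\<in>K. h l j k) = (\<Sum>j\<in>J. \<Sum>k\<in>K. \<Sum>l\<in>I. h l j k)"
  by (subst sum.swap) (intro sum.cong refl, rule sum.swap)

lemma spray_A:
  assumes v: "v \<in> U \<times> UNIV"
  shows "spray A i v = (\<Sum>j\<in>Basis. \<Sum>k\<in>Basis. christoffel i j k (fst v) * (snd v \<bullet> j) * (snd v \<bullet> k))"
proof -
  let ?a = "\<lambda>l j k. frechet_derivative (\<lambda>x. g l j x + g j l x) (at (fst v)) k"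
  let ?b = "\<lambda>l j k. frechet_derivative (g j k) (at (fst v)) l"
  have sw: "(\<Sum>k\<in>Basis. (\<Sum>j\<in>Basis. ?a l j k * (snd v \<bullet> j)) * (snd v \<bullet> k)) =
      (\<Sum>j\<in>Basis. \<Sum>k\<in>Basis. ?a l j k * (snd v \<bullet> j) * (snd v \<bullet> k))" for l
    unfolding sum_distrib_right by (rule sum.swap)
  have "spray A i v = (1 / 4) * (\<Sum>l\<in>Basis. ginv i l (fst v) *
     ((\<Sum>k\<in>Basis. (\<Sum>j\<in>Basis. ?a l j k * (snd v \<bullet> j)) * (snd v \<bullet> k))
      - (\<Sum>j\<in>Basis. \<Sum>k\<in>Basis. ?b l j k * (snd v \<bullet> j) * (snd v \<bullet> k))))"
    unfolding spray_def using v fund_tensor_inv_A[of "fst v" i _ "snd v"]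
    by (simp add: pd_pdy_A pdx_A mem_Times_iff cong: sum.cong)
  also have "\<dots> = (1 / 4) * (\<Sum>l\<in>Basis. \<Sum>j\<in>Basis. \<Sum>k\<in>Basis. ginv i l (fst v) * (?a l j k - ?b l j k) * (snd v \<bullet> j) * (snd v \<bullet> k))"
    unfolding sw by (simp add: sum_distrib_left sum_subtractf[symmetric] algebra_simps)
  also have "\<dots> = (\<Sum>j\<in>Basis. \<Sum>k\<in>Basis. christoffel i j k (fst v) * (snd v \<bullet> j) * (snd v \<bullet> k))"
    unfolding christoffel_def by (subst sum_rotate3) (simp add: sum_distrib_left sum_distrib_right mult_ac)
  finally show ?thesis .
qed

lemma weakly_berwald_A:
  assumes v: "v \<in> U \<times> UNIV" and ij: "i \<in> Basis" "j \<in> Basis"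
  shows "mean_berwald A i j v = 0"
proof -
  let ?e = "\<lambda>k x. \<Sum>s\<in>Basis. christoffel s s k x + christoffel s k s x"
  have sm: "smooth_on U (?e k)" if "k \<in> Basis" for k
    using that by (intro smooth_on_sum smooth_on_add smooth_christoffel open_U)
  have dc: "christoffel i j k differentiable (at (fst w))" if "w \<in> U \<times> UNIV" "j \<in> Basis" "k \<in> Basis" for w i j k
    using smooth_on_differentiable[OF smooth_christoffel[OF that(2,3)]] that(1) by (auto simp: mem_Times_iff)
  have de: "?e k differentiable (at (fst w))" if "w \<in> U \<times> UNIV" "k \<in> Basis" for w k
    using smooth_on_differentiable[OF sm[OF that(2)]] that(1) by (auto simp: mem_Times_iff)
  have 1: "pdy s (spray A s) w = (\<Sum>k\<in>Basis. (christoffel s s k (fst w) + christoffel s k s (fst w)) * (snd w \<bullet> k))"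
    if "w \<in> U \<times> UNIV" "s \<in> Basis" for s w
    using pdy_cong[OF open_UU that(1) spray_A] pdy_quadratic_form[of "christoffel s" w, OF dc[OF that(1)] that(2)] by simp
  have 2: "(\<Sum>s\<in>Basis. pdy s (spray A s) w) = (\<Sum>k\<in>Basis. ?e k (fst w) * (snd w \<bullet> k))"
    if "w \<in> U \<times> UNIV" for w
    using 1[OF that] by (simp add: sum_distrib_right cong: sum.cong) (rule sum.swap)
  have 3: "pdy j (\<lambda>w. \<Sum>s\<in>Basis. pdy s (spray A s) w) w = ?e j (fst w)" if "w \<in> U \<times> UNIV" for w
    using pdy_cong[OF open_UU that 2] pdy_linear_form[of ?e w j, OF de[OF that] ij(2)] by simp
  have "pdy i (pdy j (\<lambda>w. \<Sum>s\<in>Basis. pdy s (spray A s) w)) v = pdy i (\<lambda>w. ?e j (fst w)) v"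
    by (rule pdy_cong[OF open_UU v 3])
  also have "\<dots> = 0" by (rule pd_base(2)[OF de[OF v ij(2)]])
  finally show ?thesis by (simp add: mean_berwald_def)
qed

end

section \<open>The warping function of an Einstein warped product\<close>

context warped_chart
begin

lemma in_W: "x \<in> U \<Longrightarrow> x2 \<in> V \<Longrightarrow> y1 \<noteq> 0 \<Longrightarrow> y2 \<noteq> 0 \<Longrightarrow> ((x, x2), (y1, y2)) \<in> W"
  by (simp add: W fst_pair_def snd_pair_def)

text \<open>The fibre is Ricci flat, so for fixed \<open>x\<close>, \<open>x2\<close> and
  \<open>y\<close> the Einstein equation is affine in the number \<open>P (x2, y2)\<close>. As
  \<open>y2 = 0\<close> is excluded, its slope is isolated by comparing \<open>b\<close> with
  \<open>2 *\<^sub>R b\<close>, where \<open>P\<close> takes two different positive values.\<close>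

lemma einstein_fibre_dim_1:
  assumes dim: "DIM('f) = 1" and x: "x \<in> U" "x2 \<in> V" and y: "y \<noteq> 0"
    and ein: "\<And>y2. y2 \<noteq> 0 \<Longrightarrow> ricci_curv L ((x, x2), (y, y2)) = c * L ((x, x2), (y, y2))"
  shows "warp_laplacian (x, y) = - c * (\<phi> x)\<^sup>2"
proof -
  obtain b :: 'f where b: "b \<in> Basis" using nonempty_Basis by blast
  then have b0: "b \<noteq> 0" "2 *\<^sub>R b \<noteq> 0" by auto
  define X where "X = ricci_curv A (x, y) - real DIM('f) * hess_log (x, y) - c * A (x, y)"
  have e: "X - P (x2, y2) * (warp_laplacian (x, y) + c * (\<phi> x)\<^sup>2) = 0" if "y2 \<noteq> 0" for y2
  proof -
    have R: "ricci_curv P (x2, y2) = 0" by (rule fibre.ricci_curv_dim_1[OF dim x(2) that])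
    have "ricci_curv A (x, y) + 0 - real DIM('f) * hess_log (x, y) - P (x2, y2) * warp_laplacian (x, y)
        = c * (A (x, y) + (\<phi> x)\<^sup>2 * P (x2, y2))"
      using ein[OF that] ricci_curv_L[OF in_W[OF x y that]] L[OF in_W[OF x y that]] R
      by (simp add: fst_pair_def snd_pair_def)
    then show ?thesis unfolding X_def by (simp add: algebra_simps)
  qed
  have "P (x2, 2 *\<^sub>R b) = 4 * P (x2, b)"
    using homogeneous_onD[OF fibre.homogeneous x(2) b0(1), of 2] by simp
  then have "3 * (P (x2, b) * (warp_laplacian (x, y) + c * (\<phi> x)\<^sup>2)) = 0"
    using e[OF b0(1)] e[OF b0(2)] by (simp add: algebra_simps)
  then show ?thesis using fibre.P_pos[OF x(2) b0(1)] by simp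
qed

text \<open>Degree 2, against degree 0 for \<open>warp_laplacian\<close>: rescaling the base
  velocity tells the two corrections of the Ricci curvature apart.\<close>

lemma hess_log_homogeneous:
  assumes "x \<in> U" "y \<noteq> 0" "t > 0"
  shows "hess_log (x, t *\<^sub>R y) = t\<^sup>2 * hess_log (x, y)"
proof -
  have h: "homogeneous_on 1 U dlog"
    by (simp add: homogeneous_on_def dlog_def sum_distrib_left mult_ac)
  have 1: "pdx k dlog (x, t *\<^sub>R y) = t * pdx k dlog (x, y)" for k
    using homogeneous_onD[OF homogeneous_on_pdx[OF base.open_U smooth_dlog h] assms] by simp
  have 2: "pdy k dlog (x, t *\<^sub>R y) = pdy k dlog (x, y)" for k
    using homogeneous_onD[OF homogeneous_on_pdy[OF base.open_U smooth_dlog] assms] h by simp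
  show ?thesis
    unfolding hess_log_def 1 2 homogeneous_onD[OF base.spray_homogeneous assms] homogeneous_onD[OF h assms]
    by (simp add: sum_distrib_left power2_eq_square algebra_simps)
qed

lemma warp_laplacian_homogeneous:
  assumes "x \<in> U" "y \<noteq> 0" "t > 0"
  shows "warp_laplacian (x, t *\<^sub>R y) = warp_laplacian (x, y)"
proof -
  have h: "homogeneous_on (Suc 0) U dlog"
    by (simp add: homogeneous_on_def dlog_def sum_distrib_left mult_ac)
  have 2: "pdy k dlog (x, t *\<^sub>R y) = pdy k dlog (x, y)" for k
    using homogeneous_onD[OF homogeneous_on_pdy[OF base.open_U smooth_dlog h] assms] by simp
  have 3: "pdy k D1 (x, t *\<^sub>R y) = pdy k D1 (x, y)" for k
    using homogeneous_onD[OF homogeneous_on_pdy[OF base.open_U base.smooth_divergence] assms] base.divergence_homogeneous by simp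
  show ?thesis unfolding warp_laplacian_def 2 3 by simp
qed

text \<open>The base is Ricci flat. Passing from \<open>y\<close> to \<open>2 *\<^sub>R y\<close>
  with fibre velocity \<open>b\<close> fixed multiplies \<open>hess_log\<close> and \<open>A\<close>
  by 4 and leaves every other term unchanged, so the difference of the two equations contains 3
  times the claim.\<close>

lemma einstein_base_dim_1:
  assumes dim: "DIM('e) = 1" and x: "x \<in> U" "x2 \<in> V" and y: "y \<noteq> 0"
    and ein: "\<And>y y2. y \<noteq> 0 \<Longrightarrow> y2 \<noteq> 0 \<Longrightarrow> ricci_curv L ((x, x2), (y, y2)) = c * L ((x, x2), (y, y2))"
  shows "real DIM('f) * hess_log (x, y) = - c * A (x, y)"
proof -
  obtain b :: 'f where b: "b \<in> Basis" using nonempty_Basis by blast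
  then have b0: "b \<noteq> 0" by auto
  have e: "ricci_curv P (x2, b) - real DIM('f) * hess_log (x, y) - P (x2, b) * warp_laplacian (x, y)
      = c * (A (x, y) + (\<phi> x)\<^sup>2 * P (x2, b))" if y: "y \<noteq> 0" for y
    using ein[OF y b0] ricci_curv_L[OF in_W[OF x y b0]] L[OF in_W[OF x y b0]]
      base.ricci_curv_dim_1[OF dim x(1) y]
    by (simp add: fst_pair_def snd_pair_def)
  have y2: "2 *\<^sub>R y \<noteq> 0" using y by simp
  have "3 * (real DIM('f) * hess_log (x, y) + c * A (x, y)) = 0"
    using e[OF y] e[OF y2] hess_log_homogeneous[OF x(1) y, of 2] warp_laplacian_homogeneous[OF x(1) y, of 2]
      homogeneous_onD[OF base.homogeneous x(1) y, of 2]
    by (simp add: algebra_simps)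
  then show ?thesis by simp
qed

text \<open>For a one-dimensional fibre the coefficient \<open>2 * n - 4\<close> is
  \<open>- 2\<close>. The resulting term cancels the one obtained by differentiating the factor
  \<open>\<phi>\<close> of \<open>grad\<close>; both are quadratic in the derivatives of
  \<open>\<phi>\<close>. What remains is \<open>\<phi>\<close> times the Laplacian in
  coordinates.\<close>

lemma warp_laplacian_eq:
  assumes dim: "DIM('f) = 1" and x: "x \<in> U" and y: "y \<noteq> 0"
  shows "warp_laplacian (x, y) = \<phi> x * ((\<Sum>i\<in>Basis. \<Sum>l\<in>Basis. ginv i l x * frechet_derivative (d\<phi> l) (at x) i)
    + (\<Sum>l\<in>Basis. (\<Sum>i\<in>Basis. frechet_derivative (ginv i l) (at x) i + ginv i l x * pdy i D1 (x, y)) * d\<phi> l x))"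
proof -
  have nz: "\<phi> x \<noteq> 0" using \<phi>_pos[OF x] by simp
  let ?f = "\<lambda>i x. \<Sum>l\<in>Basis. ginv i l x * d\<phi> l x"
  have dg: "ginv i l differentiable (at x)" and dd: "d\<phi> l differentiable (at x)" and d0: "\<phi> differentiable (at x)" for i l
    using smooth_on_differentiable[OF _ x] smooth_ginv smooth_on_frechet_derivative[OF smooth_\<phi>] smooth_\<phi> by blast+
  have df: "?f i differentiable (at x)" for i
    by (intro differentiable_sum finite_Basis ballI differentiable_mult dg dd)
  have 1: "frechet_derivative (?f i) (at x) i = (\<Sum>l\<in>Basis. ginv i l x * frechet_derivative (d\<phi> l) (at x) i + frechet_derivative (ginv i l) (at x) i * d\<phi> l x)" for i
    by (subst frechet_derivative_sum) (simp_all add: frechet_derivative_mult[OF dg dd] differentiable_mult[OF dg dd])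
  have g: "grad i = (\<lambda>x. (1 / 2 * \<phi> x) * ?f i x)" for i
    by (rule ext) (simp add: grad_def)
  have 2: "frechet_derivative (grad i) (at x) i = (1 / 2) * \<phi> x * frechet_derivative (?f i) (at x) i + (1 / 2) * d\<phi> i x * ?f i x" for i
    unfolding g
    by (subst frechet_derivative_mult[OF _ df], intro differentiable_mult differentiable_const d0,
      subst frechet_derivative_mult[OF differentiable_const d0], simp)
  have 3: "pdy i dlog (x, y) = d\<phi> i x / \<phi> x" if "i \<in> Basis" for i
    using pdy_dlog[of "(x, y)" i] x y that by simp
  have "warp_laplacian (x, y) = 2 * (\<Sum>i\<in>Basis. frechet_derivative (grad i) (at x) i)
     + 2 * (\<Sum>i\<in>Basis. grad i x * pdy i D1 (x, y)) - 2 * (\<Sum>i\<in>Basis. grad i x * (d\<phi> i x / \<phi> x))"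
    unfolding warp_laplacian_def dim by (simp add: 3 cong: sum.cong)
  also have "\<dots> = (\<Sum>i\<in>Basis. 2 * frechet_derivative (grad i) (at x) i + 2 * (grad i x * pdy i D1 (x, y)) - 2 * (grad i x * (d\<phi> i x / \<phi> x)))"
    by (simp add: sum.distrib sum_subtractf sum_distrib_left)
  also have "\<dots> = (\<Sum>i\<in>Basis. \<phi> x * (frechet_derivative (?f i) (at x) i + ?f i x * pdy i D1 (x, y)))"
  proof (intro sum.cong refl)
    fix i
    have gi: "grad i x = (1 / 2) * \<phi> x * ?f i x" by (simp add: grad_def)
    have alg: "2 * (1 / 2 * \<phi> x * p + 1 / 2 * d * F) + 2 * (1 / 2 * \<phi> x * F * q) - 2 * (1 / 2 * \<phi> x * F * (d / \<phi> x)) =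
      \<phi> x * (p + F * q)" for p d F q :: real
      using nz by (simp add: field_simps)
    show "2 * frechet_derivative (grad i) (at x) i + 2 * (grad i x * pdy i D1 (x, y)) - 2 * (grad i x * (d\<phi> i x / \<phi> x)) =
      \<phi> x * (frechet_derivative (?f i) (at x) i + ?f i x * pdy i D1 (x, y))"
      unfolding 2 gi by (rule alg)
  qed
  also have "\<dots> = \<phi> x * (\<Sum>i\<in>Basis. \<Sum>l\<in>Basis. ginv i l x * frechet_derivative (d\<phi> l) (at x) i
     + (frechet_derivative (ginv i l) (at x) i + ginv i l x * pdy i D1 (x, y)) * d\<phi> l x)"
    unfolding 1 sum_distrib_left[symmetric] sum_distrib_right
    by (simp add: sum.distrib algebra_simps)
  also have "(\<Sum>i\<in>Basis. \<Sum>l\<in>Basis. ginv i l x * frechet_derivative (d\<phi> l) (at x) i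
     + (frechet_derivative (ginv i l) (at x) i + ginv i l x * pdy i D1 (x, y)) * d\<phi> l x)
    = (\<Sum>i\<in>Basis. \<Sum>l\<in>Basis. ginv i l x * frechet_derivative (d\<phi> l) (at x) i)
    + (\<Sum>i\<in>Basis. \<Sum>l\<in>Basis. (frechet_derivative (ginv i l) (at x) i + ginv i l x * pdy i D1 (x, y)) * d\<phi> l x)"
    by (simp only: sum.distrib)
  also have "(\<Sum>i\<in>Basis. \<Sum>l\<in>Basis. (frechet_derivative (ginv i l) (at x) i + ginv i l x * pdy i D1 (x, y)) * d\<phi> l x)
    = (\<Sum>l\<in>Basis. (\<Sum>i\<in>Basis. frechet_derivative (ginv i l) (at x) i + ginv i l x * pdy i D1 (x, y)) * d\<phi> l x)"
    unfolding sum_distrib_right by (rule sum.swap)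
  finally show ?thesis .
qed

text \<open>The quotient rule for the derivative of \<open>d\<phi> / \<phi>\<close> produces minus
  the square of this quotient, which cancels the summand \<open>(dlog v)\<^sup>2\<close> of
  \<open>hess_log\<close>.\<close>

lemma hess_log_dim_1:
  assumes b: "Basis = {b :: 'e}" and x: "x \<in> U"
  shows "\<phi> x * hess_log (x, b) = frechet_derivative (d\<phi> b) (at x) b - 2 * spray A b (x, b) * d\<phi> b x"
proof -
  have nz: "\<phi> x \<noteq> 0" using \<phi>_pos[OF x] by simp
  have bB: "b \<in> Basis" unfolding b by (rule singletonI)
  have bb: "b \<bullet> b = 1" "b \<in> Basis" using inner_same_Basis[OF bB] bB by auto
  then have b0: "b \<noteq> 0" by auto
  have dd: "d\<phi> b differentiable (at x)" and d0: "\<phi> differentiable (at x)"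
    using smooth_on_differentiable[OF _ x] smooth_on_frechet_derivative[OF smooth_\<phi>] smooth_\<phi> by blast+
  have r: "((\<lambda>x. d\<phi> b x / \<phi> x) has_derivative
      (\<lambda>v. (frechet_derivative (d\<phi> b) (at x) v * \<phi> x - d\<phi> b x * d\<phi> v x) / (\<phi> x * \<phi> x))) (at x)"
    using has_derivative_divide'[OF dd[unfolded frechet_derivative_works] d0[unfolded frechet_derivative_works] nz] .
  have "pdx b dlog (x, b) = frechet_derivative (\<lambda>x. d\<phi> b x / \<phi> x) (at x) b * (b \<bullet> b)"
    unfolding dlog_def[abs_def] using pdx_linear_form[of "\<lambda>k x. d\<phi> k x / \<phi> x" "(x, b)" b] r
    by (simp add: b differentiableI)
  then have p: "pdx b dlog (x, b) = (frechet_derivative (d\<phi> b) (at x) b * \<phi> x - d\<phi> b x * d\<phi> b x) / (\<phi> x * \<phi> x)"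
    unfolding frechet_derivative_eqI[OF r] bb by simp
  have d: "dlog (x, b) = d\<phi> b x / \<phi> x" by (simp add: dlog_def b bb)
  have q: "pdy b dlog (x, b) = d\<phi> b x / \<phi> x"
    using pdy_dlog[of "(x, b)" b] x b0 bb by simp
  show ?thesis
    unfolding hess_log_def p q d b using nz by (simp add: p q d bb field_simps power2_eq_square)
qed

end

section \<open>The strong maximum principle\<close>

lemma sum_insert_square:
  fixes h :: "'i \<Rightarrow> 'i \<Rightarrow> real"
  assumes "finite S" "k \<notin> S"
  shows "(\<Sum>i\<in>insert k S. \<Sum>j\<in>insert k S. h i j) =
    h k k + (\<Sum>j\<in>S. h k j) + (\<Sum>i\<in>S. h i k) + (\<Sum>i\<in>S. \<Sum>j\<in>S. h i j)"
  using assms by (simp add: sum.distrib)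

text \<open>Gaussian elimination: splitting off the square \<open>(\<Sum>j. a k j v j)\<^sup>2 / a k k\<close> leaves a form on the remaining indices.\<close>

lemma sum_mult_psd_nonneg:
  fixes a b :: "'i \<Rightarrow> 'i \<Rightarrow> real"
  assumes "finite S"
    and "\<And>i j. i \<in> S \<Longrightarrow> j \<in> S \<Longrightarrow> a i j = a j i"
    and "\<And>v. (\<Sum>i\<in>S. \<Sum>j\<in>S. a i j * v i * v j) \<ge> 0"
    and "\<And>v. (\<Sum>i\<in>S. \<Sum>j\<in>S. b i j * v i * v j) \<ge> 0"
  shows "(\<Sum>i\<in>S. \<Sum>j\<in>S. a i j * b i j) \<ge> 0"
  using assms
proof (induction S arbitrary: a rule: finite_induct)
  case empty
  then show ?case by simp
next
  case (insert k S)
  note fin = insert.hyps(1,2)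
  have k: "i \<noteq> k" if "i \<in> S" for i using that fin by auto
  have b_S: "(\<Sum>i\<in>S. \<Sum>j\<in>S. b i j * v i * v j) \<ge> 0" for v
    using insert.prems(3)[of "v(k := 0)"] k
    unfolding sum_insert_square[OF fin] by (simp cong: sum.cong)
  define d where "d = a k k"
  have expand: "d * (v k)\<^sup>2 + 2 * v k * (\<Sum>j\<in>S. a k j * v j) + (\<Sum>i\<in>S. \<Sum>j\<in>S. a i j * v i * v j) \<ge> 0" for v
  proof -
    have "(\<Sum>i\<in>S. a i k * v i * v k) = (\<Sum>j\<in>S. a k j * v k * v j)"
      using insert.prems(1) by (intro sum.cong refl) simp
    then show ?thesis
      using insert.prems(2)[of v] unfolding sum_insert_square[OF fin]
      by (simp add: d_def power2_eq_square sum_distrib_left mult_ac)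
  qed
  have d0: "d \<ge> 0" using expand[of "\<lambda>i. if i = k then 1 else 0"] k by (simp cong: sum.cong)
  show ?case
  proof (cases "d = 0")
    case True
    have z: "a k j = 0" if j: "j \<in> S" for j
    proof (rule ccontr)
      assume nz: "a k j \<noteq> 0"
      \<comment> \<open>With zero pivot, the form at the vector with entries \<open>t\<close> at
        \<open>k\<close> and 1 at \<open>j\<close> is \<open>2 * t * a k j + a j j\<close>; this
        \<open>t\<close> makes it \<open>- 1\<close>.\<close>
      define t where "t = - (a j j + 1) / (2 * a k j)"
      define v where "v = (\<lambda>i. if i = k then t else if i = j then 1 else (0::real))"
      have v: "v k = t" "v i = (if i = j then 1 else 0)" if "i \<in> S" for i
        using that k by (auto simp: v_def)
      have "0 \<le> 2 * t * a k j + a j j"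
        using expand[of v] True v j fin
        by (simp add: if_distrib[of "\<lambda>c. _ * c"] if_distrib[of "\<lambda>c. c * _"] sum.delta cong: sum.cong if_cong)
      then show False unfolding t_def using nz by (simp add: field_simps)
    qed
    have z': "a j k = 0" if "j \<in> S" for j using z[OF that] insert.prems(1)[of k j] that by simp
    have "(\<Sum>i\<in>S. \<Sum>j\<in>S. a i j * b i j) \<ge> 0"
    proof (rule insert.IH[OF _ _ b_S])
      show "a i j = a j i" if "i \<in> S" "j \<in> S" for i j using insert.prems(1) that by simp
      show "(\<Sum>i\<in>S. \<Sum>j\<in>S. a i j * v i * v j) \<ge> 0" for v
        using expand[of "v(k := 0)"] k by (simp cong: sum.cong)
    qed
    then show ?thesis
      unfolding sum_insert_square[OF fin] using True z z' by (simp add: d_def)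
  next
    case False
    then have dpos: "d > 0" using d0 by simp
    \<comment> \<open>The Schur complement of the pivot \<open>d\<close>.\<close>
    define a' where "a' = (\<lambda>i j. a i j - a i k * a k j / d)"
    have form': "(\<Sum>i\<in>S. \<Sum>j\<in>S. a' i j * v i * v j) =
      (\<Sum>i\<in>S. \<Sum>j\<in>S. a i j * v i * v j) - (\<Sum>j\<in>S. a k j * v j)\<^sup>2 / d" for v
    proof -
      have "(\<Sum>j\<in>S. a k j * v j)\<^sup>2 / d = (\<Sum>i\<in>S. \<Sum>j\<in>S. a i k * a k j / d * v i * v j)"
        unfolding power2_eq_square sum_product sum_divide_distrib
        using insert.prems(1) by (intro sum.cong refl) simp
      then show ?thesis by (simp add: a'_def left_diff_distrib sum_subtractf)
    qed
    have "(\<Sum>i\<in>S. \<Sum>j\<in>S. a' i j * b i j) \<ge> 0"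
    proof (rule insert.IH[OF _ _ b_S])
      show "a' i j = a' j i" if "i \<in> S" "j \<in> S" for i j
        using insert.prems(1)[of i j] insert.prems(1)[of i k] insert.prems(1)[of j k] that by (simp add: a'_def)
      fix v :: "'i \<Rightarrow> real"
      \<comment> \<open>The entry \<open>- ?s / d\<close> at \<open>k\<close> minimises the form in
        that variable, and the minimum is the form of \<open>a'\<close> at \<open>v\<close>.\<close>
      let ?s = "\<Sum>j\<in>S. a k j * v j"
      have "d * (?s / d)\<^sup>2 - 2 * (?s / d) * ?s + (\<Sum>i\<in>S. \<Sum>j\<in>S. a i j * v i * v j) \<ge> 0"
        using expand[of "v(k := - ?s / d)"] k by (simp cong: sum.cong)
      then show "(\<Sum>i\<in>S. \<Sum>j\<in>S. a' i j * v i * v j) \<ge> 0"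
        unfolding form' using dpos by (simp add: field_simps power2_eq_square)
    qed
    \<comment> \<open>The rank-one part \<open>a k i * a k j / d\<close> that was split off pairs
      with \<open>b\<close> to the form of \<open>b\<close> at the vector \<open>a k\<close>,
      divided by \<open>d\<close>.\<close>
    moreover have "(\<Sum>i\<in>insert k S. \<Sum>j\<in>insert k S. b i j * a k i * a k j) \<ge> 0"
      by (rule insert.prems(3))
    moreover have "(\<Sum>i\<in>insert k S. \<Sum>j\<in>insert k S. a i j * b i j) =
       (\<Sum>i\<in>S. \<Sum>j\<in>S. a' i j * b i j) + (\<Sum>i\<in>insert k S. \<Sum>j\<in>insert k S. b i j * a k i * a k j) / d"
    proof -
      have "(\<Sum>i\<in>S. \<Sum>j\<in>S. a' i j * b i j) =
        (\<Sum>i\<in>insert k S. \<Sum>j\<in>insert k S. a i j * b i j - b i j * a k i * a k j / d)"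
        unfolding sum_insert_square[OF fin] using dpos insert.prems(1)
        by (simp add: a'_def d_def[symmetric] left_diff_distrib right_diff_distrib mult_ac cong: sum.cong)
      then show ?thesis by (simp add: sum_subtractf sum_divide_distrib)
    qed
    ultimately show ?thesis using dpos by simp
  qed
qed

section \<open>Second derivative test and elliptic operators\<close>

lemma frechet_derivative_expand:
  fixes h :: "'e::euclidean_space \<Rightarrow> real"
  assumes "h differentiable (at x)"
  shows "frechet_derivative h (at x) d = (\<Sum>i\<in>Basis. (d \<bullet> i) * frechet_derivative h (at x) i)"
proof -
  note lin = linear_frechet_derivative[OF assms]
  show ?thesis
    by (subst (1) euclidean_representation[of d, symmetric])
      (simp only: linear_sum[OF lin] linear_scale[OF lin] real_scaleR_def)
qed

text \<open>The derivative along the line through \<open>z\<close> in direction \<open>d\<close> is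
  zero at \<open>z\<close>. Were the second derivative positive, it would be positive shortly
  afterwards, and by the mean value theorem \<open>h\<close> would exceed its maximum.\<close>

lemma second_derivative_le_0_at_max:
  fixes h :: "'e::euclidean_space \<Rightarrow> real"
  assumes V: "open V" "z \<in> V" and d1: "\<And>x. x \<in> V \<Longrightarrow> h differentiable (at x)"
    and d2: "(\<lambda>x. frechet_derivative h (at x) d) differentiable (at z)"
    and max: "\<And>x. x \<in> V \<Longrightarrow> h x \<le> h z"
  shows "frechet_derivative h (at z) d = 0"
    and "frechet_derivative (\<lambda>x. frechet_derivative h (at x) d) (at z) d \<le> 0"
proof -
  have h': "(h has_derivative frechet_derivative h (at x)) (at x)" if "x \<in> V" for x
    using d1[OF that] by (simp add: frechet_derivative_works[symmetric])
  have zero: "frechet_derivative h (at z) = (\<lambda>v. 0)"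
    using differential_zero_maxmin[OF V(2,1) h'[OF V(2)]] max by blast
  then show z: "frechet_derivative h (at z) d = 0" by simp
  show "frechet_derivative (\<lambda>x. frechet_derivative h (at x) d) (at z) d \<le> 0"
  proof (rule ccontr)
    let ?l = "frechet_derivative (\<lambda>x. frechet_derivative h (at x) d) (at z) d"
    let ?c = "\<lambda>t::real. z + t *\<^sub>R d"
    let ?g' = "\<lambda>t. frechet_derivative h (at (?c t)) d"
    assume "\<not> ?l \<le> 0"
    then have pos: "?l > 0" by simp
    have c: "(?c has_derivative (\<lambda>t. t *\<^sub>R d)) (at t)" for t
      by (auto intro!: derivative_eq_intros)
    have "((\<lambda>x. frechet_derivative h (at x) d) has_derivative
        frechet_derivative (\<lambda>x. frechet_derivative h (at x) d) (at z)) (at (?c 0))"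
      using d2 by (simp add: frechet_derivative_works[symmetric])
    from has_derivative_compose[OF c this] have "(?g' has_field_derivative ?l) (at 0)"
      unfolding has_field_derivative_def
      by (rule has_derivative_eq_rhs)
        (simp add: fun_eq_iff linear_scale[OF linear_frechet_derivative[OF d2]] mult.commute)
    from DERIV_pos_inc_right[OF this pos]
    obtain \<delta> where \<delta>: "\<delta> > 0" "\<And>t. 0 < t \<Longrightarrow> t < \<delta> \<Longrightarrow> ?g' 0 < ?g' t" by auto
    have "continuous (at 0) ?c" by (intro continuous_intros)
    then have "(?c \<longlongrightarrow> z) (at 0)" unfolding continuous_at by simp
    from topological_tendstoD[OF this V] have "\<forall>\<^sub>F t in at 0. ?c t \<in> V" .
    then obtain \<epsilon> where \<epsilon>: "\<epsilon> > 0" "\<And>t. t \<noteq> 0 \<Longrightarrow> \<bar>t\<bar> < \<epsilon> \<Longrightarrow> ?c t \<in> V"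
      unfolding eventually_at by (auto simp: dist_real_def)
    define T where "T = min \<delta> \<epsilon> / 2"
    have T: "T > 0" "T < \<delta>" "T < \<epsilon>" using \<delta>(1) \<epsilon>(1) by (auto simp: T_def)
    have inV: "?c t \<in> V" if "0 \<le> t" "t \<le> T" for t
      using \<epsilon>(2)[of t] that T V(2) by (cases "t = 0") auto
    have g: "((\<lambda>t. h (?c t)) has_field_derivative ?g' t) (at t)" if "0 \<le> t" "t \<le> T" for t
      unfolding has_field_derivative_def
      by (rule has_derivative_eq_rhs[OF has_derivative_compose[OF c h'[OF inV[OF that]]]])
        (simp add: fun_eq_iff linear_scale[OF linear_frechet_derivative[OF d1[OF inV[OF that]]]] mult.commute)
    obtain t where t: "0 < t" "t < T" "h (?c T) - h (?c 0) = (T - 0) * ?g' t"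
      using MVT2[OF T(1), of "\<lambda>t. h (?c t)" ?g'] g by auto
    have "?g' t > 0" using \<delta>(2)[of t] t T z by simp
    then have "(T - 0) * ?g' t > 0" using T(1) by simp
    then have "h (?c T) > h z" using t(3) by simp
    then show False using max[OF inV[of T]] T by simp
  qed
qed

text \<open>At a maximum the gradient vanishes and the negative Hessian is semidefinite; its pairing
  with the positive form \<open>a\<close> is therefore nonnegative.\<close>

lemma elliptic_operator_le_0_at_max:
  fixes h :: "'e::euclidean_space \<Rightarrow> real"
  assumes V: "open V" "z \<in> V" and d1: "\<And>x. x \<in> V \<Longrightarrow> h differentiable (at x)"
    and d2: "\<And>d. (\<lambda>x. frechet_derivative h (at x) d) differentiable (at z)"
    and max: "\<And>x. x \<in> V \<Longrightarrow> h x \<le> h z"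
    and sym: "\<And>i j. i \<in> Basis \<Longrightarrow> j \<in> Basis \<Longrightarrow> a i j = a j i"
    and pos: "\<And>v. v \<noteq> 0 \<Longrightarrow> (\<Sum>i\<in>Basis. \<Sum>j\<in>Basis. a i j * (v \<bullet> i) * (v \<bullet> j)) > 0"
  shows "(\<Sum>i\<in>Basis. \<Sum>j\<in>Basis. a i j * frechet_derivative (\<lambda>x. frechet_derivative h (at x) j) (at z) i)
    + (\<Sum>j\<in>Basis. b j * frechet_derivative h (at z) j) \<le> 0"
proof -
  let ?H = "\<lambda>i j. frechet_derivative (\<lambda>x. frechet_derivative h (at x) j) (at z) i"
  have vec: "(\<Sum>i\<in>Basis. v i *\<^sub>R i) \<bullet> j = v j" if "j \<in> Basis" for v and j :: 'e
    using that by simp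
  have "0 \<le> (\<Sum>i\<in>Basis. \<Sum>j\<in>Basis. a i j * - ?H i j)"
  proof (rule sum_mult_psd_nonneg)
    show "finite (Basis :: 'e set)" by simp
    show "a i j = a j i" if "i \<in> Basis" "j \<in> Basis" for i j by (rule sym[OF that])
    fix v :: "'e \<Rightarrow> real"
    let ?v = "\<Sum>i\<in>Basis. v i *\<^sub>R i"
    show "0 \<le> (\<Sum>i\<in>Basis. \<Sum>j\<in>Basis. a i j * v i * v j)"
    proof (cases "?v = 0")
      case True
      then have "v i = 0" if "i \<in> Basis" for i using vec[OF that, of v] by simp
      then show ?thesis by simp
    next
      case False
      then show ?thesis using pos[OF False] by (simp add: vec cong: sum.cong)
    qed
    \<comment> \<open>\<open>?v\<close> turns the coordinate function \<open>v\<close> into a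
      vector; the second derivative in this fixed direction is the Hessian form at
      \<open>v\<close>.\<close>
    have "frechet_derivative (\<lambda>x. frechet_derivative h (at x) ?v) (at z) ?v =
      frechet_derivative (\<lambda>x. \<Sum>j\<in>Basis. (?v \<bullet> j) * frechet_derivative h (at x) j) (at z) ?v"
      by (rule fun_cong[OF frechet_derivative_cong_open[OF V]]) (rule frechet_derivative_expand[OF d1])
    also have "\<dots> = (\<Sum>j\<in>Basis. (?v \<bullet> j) * ?H ?v j)"
      using d2 by (simp add: frechet_derivative_sum frechet_derivative_mult)
    also have "\<dots> = (\<Sum>j\<in>Basis. \<Sum>i\<in>Basis. ?H i j * v i * v j)"
      by (intro sum.cong refl, subst frechet_derivative_expand[OF d2]) (simp add: vec sum_distrib_left mult_ac cong: sum.cong)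
    also have "\<dots> = (\<Sum>i\<in>Basis. \<Sum>j\<in>Basis. ?H i j * v i * v j)" by (rule sum.swap)
    finally show "0 \<le> (\<Sum>i\<in>Basis. \<Sum>j\<in>Basis. - ?H i j * v i * v j)"
      using second_derivative_le_0_at_max(2)[OF V d1 d2 max, of ?v] by (simp add: sum_negf)
  qed
  moreover have "frechet_derivative h (at z) j = 0" for j
    by (rule second_derivative_le_0_at_max(1)[OF V d1 d2 max])
  ultimately show ?thesis by (simp add: sum_negf)
qed

text \<open>Hopf's barrier. Differentiating twice gives a term in \<open>k\<^sup>2\<close> that is
  quadratic in \<open>x - c\<close>; away from the centre it dominates the term linear in
  \<open>k\<close> once \<open>k\<close> is large.\<close>

lemma
  fixes c :: "'e::euclidean_space" and k :: real
  defines "w \<equiv> \<lambda>x. exp (- k * ((x - c) \<bullet> (x - c)))"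
  shows barrier_derivative: "(w has_derivative (\<lambda>d. - 2 * k * ((x - c) \<bullet> d) * w x)) (at x)"
    and barrier_second_derivative: "((\<lambda>x. - 2 * k * ((x - c) \<bullet> j) * w x) has_derivative
      (\<lambda>d. (4 * k\<^sup>2 * ((x - c) \<bullet> d) * ((x - c) \<bullet> j) - 2 * k * (d \<bullet> j)) * w x)) (at x)"
proof -
  show 1: "(w has_derivative (\<lambda>d. - 2 * k * ((x - c) \<bullet> d) * w x)) (at x)" for x
    unfolding w_def by (auto intro!: derivative_eq_intros simp: fun_eq_iff inner_commute algebra_simps)
  show "((\<lambda>x. - 2 * k * ((x - c) \<bullet> j) * w x) has_derivative
      (\<lambda>d. (4 * k\<^sup>2 * ((x - c) \<bullet> d) * ((x - c) \<bullet> j) - 2 * k * (d \<bullet> j)) * w x)) (at x)"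
    by (auto intro!: derivative_eq_intros 1 simp: fun_eq_iff power2_eq_square algebra_simps)
qed

text \<open>A ball inside \<open>{h < m}\<close>, shrunk so that it touches \<open>{h = m}\<close> in a single point \<open>y\<close>, has a barrier
  \<open>w\<close> that is strictly subharmonic near \<open>y\<close>, negative outside the ball and zero at \<open>y\<close>. Then
  \<open>h + \<epsilon> w\<close> attains its maximum over a small ball around \<open>y\<close> in the interior, which is impossible.\<close>

lemma strong_maximum_principle:
  fixes h :: "'e::euclidean_space \<Rightarrow> real" and a :: "'e \<Rightarrow> 'e \<Rightarrow> 'e \<Rightarrow> real"
  assumes U: "open U" and h: "smooth_on U h"
    and a: "\<And>i j. i \<in> Basis \<Longrightarrow> j \<in> Basis \<Longrightarrow> continuous_on U (a i j)"
    and b: "\<And>j. j \<in> Basis \<Longrightarrow> continuous_on U (b j)"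
    and sym: "\<And>x i j. x \<in> U \<Longrightarrow> i \<in> Basis \<Longrightarrow> j \<in> Basis \<Longrightarrow> a i j x = a j i x"
    and pos: "\<And>x v. x \<in> U \<Longrightarrow> v \<noteq> 0 \<Longrightarrow> (\<Sum>i\<in>Basis. \<Sum>j\<in>Basis. a i j x * (v \<bullet> i) * (v \<bullet> j)) > 0"
    and sub: "\<And>x. x \<in> U \<Longrightarrow>
      (\<Sum>i\<in>Basis. \<Sum>j\<in>Basis. a i j x * frechet_derivative (\<lambda>x. frechet_derivative h (at x) j) (at x) i)
      + (\<Sum>j\<in>Basis. b j x * frechet_derivative h (at x) j) \<ge> 0"
    and max: "\<And>x. x \<in> U \<Longrightarrow> h x \<le> m" and x0: "x0 \<in> U" "h x0 = m"
  shows "\<exists>r>0. ball x0 r \<subseteq> U \<and> (\<forall>x\<in>ball x0 r. h x = m)"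
proof -
  obtain \<rho> where \<rho>: "\<rho> > 0" "cball x0 \<rho> \<subseteq> U"
    using U x0(1) open_contains_cball_eq by blast
  have cont: "continuous_on U h" by (rule smooth_on_continuous_on[OF h])
  \<comment> \<open>The radius \<open>\<rho> / 2\<close> ensures that the ball about
    \<open>x1\<close> reaching to the nearest point of \<open>Z\<close> stays inside
    \<open>cball x0 \<rho>\<close>, where all points with value \<open>m\<close> belong to
    \<open>Z\<close>.\<close>
  have "h x1 = m" if x1: "x1 \<in> ball x0 (\<rho> / 2)" for x1
  proof (rule ccontr)
    assume hx1: "h x1 \<noteq> m"
    define Z where "Z = {x \<in> cball x0 \<rho>. h x = m}"
    have "continuous_on (cball x0 \<rho>) h" by (rule continuous_on_subset[OF cont \<rho>(2)])
    then have clZ: "closed Z"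
      unfolding Z_def by (intro continuous_closed_preimage_constant) auto
    have x0Z: "x0 \<in> Z" using \<rho> x0 by (simp add: Z_def)
    obtain y where y: "y \<in> Z" "\<And>x. x \<in> Z \<Longrightarrow> dist x1 y \<le> dist x1 x"
      using distance_attains_inf[OF clZ, of x1] x0Z by blast
    define R where "R = dist x1 y"
    have "R < \<rho> / 2" using y(2)[OF x0Z] x1 by (simp add: R_def dist_commute)
    have R0: "R > 0" using y(1) hx1 by (auto simp: R_def Z_def)
    have hy: "h y = m" using y(1) by (simp add: Z_def)
    \<comment> \<open>\<open>cball c (R / 2)\<close> lies in \<open>ball x1 R\<close> except for the
      point \<open>y\<close>.\<close>
    define c where "c = midpoint x1 y"
    define q where "q = (1 / 2) *\<^sub>R (y - x1)"
    have cq: "y - c = q" "c - x1 = q"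
      unfolding c_def q_def midpoint_def by (simp_all add: algebra_simps flip: scaleR_add_left)
    have nq: "norm q = R / 2" by (simp add: q_def R_def dist_norm norm_minus_commute)
    have inner_ball: "h x < m \<and> x \<in> U" if x: "x \<in> cball c (R / 2)" "x \<noteq> y" for x
    proof -
      have p: "norm (x - c) \<le> norm q" using x(1) by (simp add: nq dist_norm norm_minus_commute)
      have "(norm (x - x1))\<^sup>2 = (norm ((x - c) + q))\<^sup>2" using cq(2) by (simp add: algebra_simps)
      \<comment> \<open>Parallelogram law. The subtracted square is that of \<open>x - y\<close>,
        hence positive, which makes \<open>y\<close> the only point of contact.\<close>
      also have "\<dots> = 2 * (norm (x - c))\<^sup>2 + 2 * (norm q)\<^sup>2 - (norm ((x - c) - q))\<^sup>2"
        by (simp add: power2_norm_eq_inner inner_simps inner_commute)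
      also have "\<dots> < 4 * (norm q)\<^sup>2"
      proof -
        have "(norm (x - c))\<^sup>2 \<le> (norm q)\<^sup>2" using p by (intro power_mono) auto
        moreover have "(norm ((x - c) - q))\<^sup>2 > 0" using x(2) cq(1) by (auto simp: algebra_simps)
        ultimately show ?thesis by linarith
      qed
      also have "\<dots> = R\<^sup>2" by (simp add: nq power2_eq_square)
      finally have lt: "dist x1 x < R" using R0 by (simp add: dist_norm norm_minus_commute power2_less_imp_less)
      then have "dist x0 x \<le> \<rho>" using dist_triangle[of x0 x x1] x1 \<open>R < \<rho> / 2\<close> by simp
      then have "x \<in> cball x0 \<rho>" "x \<in> U" using \<rho>(2) by auto
      moreover have "x \<notin> Z" using y(2)[of x] lt by (auto simp: R_def)
      ultimately show ?thesis using max[of x] by (auto simp: Z_def less_le)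
    qed
    have yU: "y \<in> U" using y(1) \<rho>(2) by (auto simp: Z_def)
    then obtain s0 where s0: "s0 > 0" "cball y s0 \<subseteq> U" using U open_contains_cball_eq by blast
    \<comment> \<open>As \<open>norm (y - c) = R / 2\<close>, the bound \<open>R / 4\<close> keeps
      the centre \<open>c\<close>, where the gradient of the barrier vanishes, out of
      \<open>cball y s\<close>.\<close>
    define s where "s = min s0 (R / 4)"
    have s: "s > 0" "s < R / 2" "cball y s \<subseteq> U" using s0 R0 by (auto simp: s_def)
    have away: "x - c \<noteq> 0" if "x \<in> cball y s" for x
      using that s(2) nq cq(1) by (auto simp: dist_norm)
    let ?Q = "\<lambda>x. \<Sum>i\<in>Basis. \<Sum>j\<in>Basis. a i j x * ((x - c) \<bullet> i) * ((x - c) \<bullet> j)"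
    let ?T = "\<lambda>x. (\<Sum>i\<in>Basis. a i i x) + (\<Sum>j\<in>Basis. b j x * ((x - c) \<bullet> j))"
    have cQ: "continuous_on (cball y s) ?Q" and cT: "continuous_on (cball y s) ?T"
      using continuous_on_subset[OF a s(3)] continuous_on_subset[OF b s(3)]
      by (auto intro!: continuous_intros)
    have ne: "cball y s \<noteq> {}" using s(1) by simp
    obtain zq where zq: "zq \<in> cball y s" "\<And>x. x \<in> cball y s \<Longrightarrow> ?Q zq \<le> ?Q x"
      using continuous_attains_inf[OF compact_cball ne cQ] by blast
    obtain zt where zt: "zt \<in> cball y s" "\<And>x. x \<in> cball y s \<Longrightarrow> ?T x \<le> ?T zt"
      using continuous_attains_sup[OF compact_cball ne cT] by blast
    have \<alpha>: "?Q zq > 0" using pos[of zq "zq - c"] away[OF zq(1)] zq(1) s(3) by auto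
    \<comment> \<open>Chosen so that \<open>2 * k * ?Q > ?T\<close> on the whole ball, from the
      minimum of \<open>?Q\<close> and the maximum of \<open>?T\<close>; \<open>max 0\<close> keeps
      it positive.\<close>
    define k where "k = max 0 (?T zt) / (2 * ?Q zq) + 1"
    have k0: "k > 0" using \<alpha> by (auto simp: k_def intro!: add_nonneg_pos divide_nonneg_pos)
    have "2 * k * ?Q zq = max 0 (?T zt) + 2 * ?Q zq" using \<alpha> by (simp add: k_def field_simps)
    then have kQ: "2 * k * ?Q zq > ?T zt" using \<alpha> by linarith
    let ?w = "\<lambda>x. exp (- k * ((x - c) \<bullet> (x - c)))"
    \<comment> \<open>The barrier at distance \<open>R / 2\<close> from \<open>c\<close>, in
      particular at \<open>y\<close>.\<close>
    define E where "E = exp (- k * (R / 2)\<^sup>2)"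
    \<comment> \<open>On the part of the small sphere inside the touching ball, compactness gives
      \<open>h\<close> a uniform gap below \<open>m\<close>, and \<open>?w - E \<le> 1\<close>
      there. On the rest of the sphere \<open>?w < E\<close>, so any positive
      \<open>\<epsilon>\<close> works.\<close>
    obtain \<epsilon> where \<epsilon>: "\<epsilon> > 0" "\<And>x. x \<in> sphere y s \<inter> cball c (R / 2) \<Longrightarrow> h x + \<epsilon> < m"
    proof (cases "sphere y s \<inter> cball c (R / 2) = {}")
      case True
      then show ?thesis using that[of 1] by simp
    next
      case False
      have "continuous_on (sphere y s \<inter> cball c (R / 2)) h"
        by (rule continuous_on_subset[OF cont]) (use s(3) in \<open>auto simp: subset_iff\<close>)
      then obtain xm where xm: "xm \<in> sphere y s \<inter> cball c (R / 2)"
          "\<And>x. x \<in> sphere y s \<inter> cball c (R / 2) \<Longrightarrow> h x \<le> h xm"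
        using continuous_attains_sup[OF compact_Int[OF compact_sphere compact_cball] False] by blast
      have "xm \<noteq> y" using xm(1) s(1) by auto
      then have "h xm < m" using inner_ball[of xm] xm(1) by simp
      then show ?thesis using that[of "(m - h xm) / 2"] xm(2) by (force simp: field_simps)
    qed
    let ?v = "\<lambda>x. h x + \<epsilon> * (?w x - E)"
    have vy: "?v y = m"
      by (simp add: hy E_def cq(1) power2_norm_eq_inner[symmetric] nq)
    have v_sphere: "?v x < m" if x: "x \<in> sphere y s" for x
    proof (cases "x \<in> cball c (R / 2)")
      case True
      have "?w x \<le> 1" using k0 by simp
      moreover have "E > 0" by (simp add: E_def)
      ultimately have "?w x - E \<le> 1" by linarith
      then have "\<epsilon> * (?w x - E) \<le> \<epsilon> * 1" using \<epsilon>(1) by (intro mult_left_mono) auto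
      then show ?thesis using \<epsilon>(2)[of x] x True by simp
    next
      case False
      then have "R / 2 < norm (x - c)" by (simp add: dist_norm norm_minus_commute)
      then have "(R / 2)\<^sup>2 < (norm (x - c))\<^sup>2" using R0 by (intro power_strict_mono) auto
      then have "?w x < E" using k0 by (simp add: E_def power2_norm_eq_inner)
      then have "\<epsilon> * (?w x - E) < 0" using \<epsilon>(1) by (simp add: mult_pos_neg)
      moreover have "h x \<le> m" using max x s(3) by (auto simp: subset_iff)
      ultimately show ?thesis by simp
    qed
    have "continuous_on (cball y s) ?v"
      by (intro continuous_intros continuous_on_subset[OF cont s(3)])
    then obtain z where z: "z \<in> cball y s" "\<And>x. x \<in> cball y s \<Longrightarrow> ?v x \<le> ?v z"
      using continuous_attains_sup[OF compact_cball ne] by blast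
    have "?v z \<ge> m" using z(2)[of y] vy s(1) by simp
    then have zb: "z \<in> ball y s" using v_sphere[of z] z(1) by (auto simp: less_le)
    have zU: "z \<in> U" using z(1) s(3) by auto
    have hd: "(h has_derivative frechet_derivative h (at x)) (at x)" if "x \<in> ball y s" for x
      using smooth_on_differentiable[OF h] that s(3) ball_subset_cball
      by (force simp: frechet_derivative_works[symmetric])
    have hd2: "((\<lambda>x. frechet_derivative h (at x) j) has_derivative frechet_derivative (\<lambda>x. frechet_derivative h (at x) j) (at z)) (at z)" for j
      using smooth_on_differentiable[OF smooth_on_frechet_derivative[OF h] zU]
      by (simp add: frechet_derivative_works[symmetric])
    have vd: "(?v has_derivative (\<lambda>d. frechet_derivative h (at x) d + \<epsilon> * (- 2 * k * ((x - c) \<bullet> d) * ?w x))) (at x)"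
      if "x \<in> ball y s" for x
      using has_derivative_add[OF hd[OF that] has_derivative_mult_right[OF has_derivative_diff[OF barrier_derivative has_derivative_const]], of \<epsilon> k c E]
      by simp
    have ve: "frechet_derivative ?v (at x) j = frechet_derivative h (at x) j + \<epsilon> * (- 2 * k * ((x - c) \<bullet> j) * ?w x)"
      if "x \<in> ball y s" for x j
      using frechet_derivative_eqI[OF vd[OF that]] by simp
    have "((\<lambda>x. frechet_derivative h (at x) j + \<epsilon> * (- 2 * k * ((x - c) \<bullet> j) * ?w x)) has_derivative
      (\<lambda>d. frechet_derivative (\<lambda>x. frechet_derivative h (at x) j) (at z) d
        + \<epsilon> * ((4 * k\<^sup>2 * ((z - c) \<bullet> d) * ((z - c) \<bullet> j) - 2 * k * (d \<bullet> j)) * ?w z))) (at z)" for j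
      by (intro has_derivative_add hd2 has_derivative_mult_right barrier_second_derivative)
    then have vd2: "((\<lambda>x. frechet_derivative ?v (at x) j) has_derivative
      (\<lambda>d. frechet_derivative (\<lambda>x. frechet_derivative h (at x) j) (at z) d
        + \<epsilon> * ((4 * k\<^sup>2 * ((z - c) \<bullet> d) * ((z - c) \<bullet> j) - 2 * k * (d \<bullet> j)) * ?w z))) (at z)" for j
      by (rule has_derivative_transform_within_open[OF _ open_ball zb]) (rule ve[symmetric])
    let ?L = "\<lambda>h. (\<Sum>i\<in>Basis. \<Sum>j\<in>Basis. a i j z * frechet_derivative (\<lambda>x. frechet_derivative h (at x) j) (at z) i)
      + (\<Sum>j\<in>Basis. b j z * frechet_derivative h (at z) j)"
    have "?L ?v \<le> 0"
    proof (rule elliptic_operator_le_0_at_max[OF open_ball zb])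
      show "?v differentiable at x" if "x \<in> ball y s" for x using vd[OF that] by (rule differentiableI)
      show "(\<lambda>x. frechet_derivative ?v (at x) d) differentiable at z" for d using vd2 by (rule differentiableI)
      show "?v x \<le> ?v z" if "x \<in> ball y s" for x using z(2) that by simp
      show "a i j z = a j i z" if "i \<in> Basis" "j \<in> Basis" for i j by (rule sym[OF zU that])
      show "0 < (\<Sum>i\<in>Basis. \<Sum>j\<in>Basis. a i j z * (v \<bullet> i) * (v \<bullet> j))" if "v \<noteq> 0" for v by (rule pos[OF zU that])
    qed
    \<comment> \<open>\<open>?Q\<close> comes with \<open>k\<^sup>2\<close>; \<open>?T\<close>
      collects the two contributions linear in \<open>k\<close>, the trace of \<open>a\<close> and
      the drift.\<close>
    moreover have "?L ?v = ?L h + \<epsilon> * ?w z * (4 * k\<^sup>2 * ?Q z - 2 * k * ?T z)"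
    proof -
      have "(\<Sum>i\<in>Basis. \<Sum>j\<in>Basis. a i j z * frechet_derivative (\<lambda>x. frechet_derivative ?v (at x) j) (at z) i) =
        (\<Sum>i\<in>Basis. \<Sum>j\<in>Basis. a i j z * frechet_derivative (\<lambda>x. frechet_derivative h (at x) j) (at z) i
          + (\<epsilon> * ?w z * 4 * k\<^sup>2) * (a i j z * ((z - c) \<bullet> i) * ((z - c) \<bullet> j))
          - (\<epsilon> * ?w z * 2 * k) * (a i j z * (i \<bullet> j)))"
        unfolding frechet_derivative_eqI[OF vd2] by (intro sum.cong refl) (simp add: algebra_simps)
      also have "\<dots> = (\<Sum>i\<in>Basis. \<Sum>j\<in>Basis. a i j z * frechet_derivative (\<lambda>x. frechet_derivative h (at x) j) (at z) i)
        + (\<epsilon> * ?w z * 4 * k\<^sup>2) * ?Q z - (\<epsilon> * ?w z * 2 * k) * (\<Sum>i\<in>Basis. \<Sum>j\<in>Basis. a i j z * (i \<bullet> j))"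
        by (simp only: sum.distrib sum_subtractf sum_distrib_left)
      also have "(\<Sum>i\<in>Basis. \<Sum>j\<in>Basis. a i j z * (i \<bullet> j)) = (\<Sum>i\<in>Basis. a i i z)"
        by (intro sum.cong refl) (simp add: inner_Basis if_distrib[of "\<lambda>c. _ * c"] cong: if_cong)
      finally have 1: "(\<Sum>i\<in>Basis. \<Sum>j\<in>Basis. a i j z * frechet_derivative (\<lambda>x. frechet_derivative ?v (at x) j) (at z) i) =
        (\<Sum>i\<in>Basis. \<Sum>j\<in>Basis. a i j z * frechet_derivative (\<lambda>x. frechet_derivative h (at x) j) (at z) i)
        + (\<epsilon> * ?w z * 4 * k\<^sup>2) * ?Q z - (\<epsilon> * ?w z * 2 * k) * (\<Sum>i\<in>Basis. a i i z)" .
      have "(\<Sum>j\<in>Basis. b j z * frechet_derivative ?v (at z) j) =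
        (\<Sum>j\<in>Basis. b j z * frechet_derivative h (at z) j - (\<epsilon> * ?w z * 2 * k) * (b j z * ((z - c) \<bullet> j)))"
        unfolding ve[OF zb] by (intro sum.cong refl) (simp add: algebra_simps)
      also have "\<dots> = (\<Sum>j\<in>Basis. b j z * frechet_derivative h (at z) j) - (\<epsilon> * ?w z * 2 * k) * (\<Sum>j\<in>Basis. b j z * ((z - c) \<bullet> j))"
        by (simp only: sum_subtractf sum_distrib_left)
      finally show ?thesis unfolding 1 by (simp only: algebra_simps)
    qed
    moreover have "?L h \<ge> 0" by (rule sub[OF zU])
    moreover have "\<epsilon> * ?w z * (4 * k\<^sup>2 * ?Q z - 2 * k * ?T z) > 0"
    proof -
      have "?T z < 2 * k * ?Q z"
        using kQ zt(2)[OF z(1)] mult_left_mono[OF zq(2)[OF z(1)], of "2 * k"] k0 by linarith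
      then have "2 * k * (2 * k * ?Q z - ?T z) > 0" using k0 by simp
      then have "4 * k\<^sup>2 * ?Q z - 2 * k * ?T z > 0" by (simp add: power2_eq_square algebra_simps)
      then show ?thesis using \<epsilon>(1) by simp
    qed
    ultimately show False by linarith
  qed
  then show ?thesis
    using \<rho> by (intro exI[of _ "\<rho> / 2"]) (auto simp: subset_iff)
qed

section \<open>Charts of a manifold\<close>

text \<open>The reference chart is fixed at the image of \<open>x\<close> before differentiating, so
  this is the derivative of a single transition map although \<open>chart_at\<close> varies with the
  point.\<close>

definition jacobian :: "('a, 'e::euclidean_space) manifold \<Rightarrow> ('a, 'e) chart \<Rightarrow> 'e \<Rightarrow> 'e \<Rightarrow> 'e" where
  "jacobian M c x = frechet_derivative (snd (chart_at M (chart_inv c x)) \<circ> chart_inv c) (at x)"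

lemma tangent_lift_eq: "tangent_lift M c (x, y) = (chart_inv c x, jacobian M c x y)"
  by (simp add: tangent_lift_def jacobian_def Let_def)

locale manifold_chart =
  fixes M :: "('a, 'e::euclidean_space) manifold" and c
  assumes M: "smooth_manifold M" and c: "c \<in> atlas M"
begin

lemma hom: "homeomorphic_map (subtopology (mtop M) (fst c)) (top_of_set (chart_image c)) (snd c)"
  and open_dom: "openin (mtop M) (fst c)" and open_image: "open (chart_image c)"
  using M c by (auto simp: smooth_manifold_def)

lemma topspace_dom: "topspace (subtopology (mtop M) (fst c)) = fst c"
  using openin_subset[OF open_dom] by (auto simp: topspace_subtopology)

lemma inj_chart: "inj_on (snd c) (fst c)"
  using homeomorphic_imp_injective_map[OF hom] topspace_dom by simp

lemma chart_inv_in: "x \<in> chart_image c \<Longrightarrow> chart_inv c x \<in> fst c"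
  unfolding chart_image_def chart_inv_def by (rule inv_into_into)

lemma chart_inv_in_topspace: "x \<in> chart_image c \<Longrightarrow> chart_inv c x \<in> topspace (mtop M)"
  using chart_inv_in openin_subset[OF open_dom] by blast

lemma chart_chart_inv: "x \<in> chart_image c \<Longrightarrow> snd c (chart_inv c x) = x"
  unfolding chart_image_def chart_inv_def by (rule f_inv_into_f)

lemma chart_inv_chart: "p \<in> fst c \<Longrightarrow> chart_inv c (snd c p) = p"
  unfolding chart_inv_def by (rule inv_into_f_f[OF inj_chart])

lemma chart_in_image: "p \<in> fst c \<Longrightarrow> snd c p \<in> chart_image c"
  unfolding chart_image_def by (rule imageI)

lemma openin_chart_preimage:
  assumes "open S"
  shows "openin (mtop M) {p \<in> fst c. snd c p \<in> S}"
proof -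
  have "continuous_map (subtopology (mtop M) (fst c)) (top_of_set (chart_image c)) (snd c)"
    by (rule homeomorphic_imp_continuous_map[OF hom])
  then have "continuous_map (subtopology (mtop M) (fst c)) euclidean (snd c)"
    by (rule continuous_map_into_fulltopology)
  from openin_continuous_map_preimage[OF this, of S] assms
  show ?thesis unfolding topspace_dom using openin_trans_full[OF _ open_dom] by simp
qed

lemma open_overlap:
  assumes d: "d \<in> atlas M"
  shows "open (snd c ` (fst c \<inter> fst d))"
proof -
  have "openin (mtop M) (fst d)" using M d by (auto simp: smooth_manifold_def)
  then have "openin (subtopology (mtop M) (fst c)) (fst c \<inter> fst d)"
    by (simp add: openin_open_subtopology[OF open_dom] openin_Int open_dom)
  then have "openin (top_of_set (chart_image c)) (snd c ` (fst c \<inter> fst d))"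
    using homeomorphic_imp_open_map[OF hom] by (simp add: open_map_def)
  then show ?thesis using open_image by (simp add: openin_open_eq)
qed

lemma transition_differentiable:
  assumes d: "d \<in> atlas M" and x: "x \<in> snd c ` (fst c \<inter> fst d)"
  shows "snd d \<circ> chart_inv c differentiable (at x)"
  using M c d x smooth_on_differentiable unfolding smooth_manifold_def by blast

lemma reference_chart:
  assumes "x \<in> chart_image c"
  shows "chart_at M (chart_inv c x) \<in> atlas M" "chart_inv c x \<in> fst (chart_at M (chart_inv c x))"
  using M chart_inv_in_topspace[OF assms] by (auto simp: smooth_manifold_def)

lemma in_overlap: "x \<in> chart_image c \<Longrightarrow> chart_inv c x \<in> fst d \<Longrightarrow> x \<in> snd c ` (fst c \<inter> fst d)"
  using chart_inv_in chart_chart_inv by (metis IntI imageI)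

lemma differentiable_jacobian:
  assumes "x \<in> chart_image c"
  shows "snd (chart_at M (chart_inv c x)) \<circ> chart_inv c differentiable (at x)"
  using reference_chart[OF assms] by (intro transition_differentiable in_overlap assms)

lemma linear_jacobian: "x \<in> chart_image c \<Longrightarrow> linear (jacobian M c x)"
  unfolding jacobian_def by (rule linear_frechet_derivative[OF differentiable_jacobian])

text \<open>By the chain rule on the open overlap, the derivative of the reverse transition map is a
  left inverse.\<close>

lemma inj_jacobian:
  assumes x: "x \<in> chart_image c"
  shows "inj (jacobian M c x)"
proof -
  define d where "d = chart_at M (chart_inv c x)"
  have d: "d \<in> atlas M" "chart_inv c x \<in> fst d" unfolding d_def by (rule reference_chart[OF x])+
  interpret d: manifold_chart M d using M d by unfold_locales
  let ?S = "snd c ` (fst c \<inter> fst d)"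
  have xS: "x \<in> ?S" by (rule in_overlap[OF x d(2)])
  have df: "snd d \<circ> chart_inv c differentiable (at x)" by (rule transition_differentiable[OF d(1) xS])
  have "(snd d \<circ> chart_inv c) x \<in> snd d ` (fst d \<inter> fst c)" using d chart_inv_in[OF x] by auto
  then have dg: "snd c \<circ> chart_inv d differentiable (at ((snd d \<circ> chart_inv c) x))"
    by (rule d.transition_differentiable[OF c])
  have "((snd c \<circ> chart_inv d) \<circ> (snd d \<circ> chart_inv c)) w = id w" if "w \<in> ?S" for w
    using that by (auto simp: chart_inv_chart d.chart_inv_chart)
  then have "frechet_derivative ((snd c \<circ> chart_inv d) \<circ> (snd d \<circ> chart_inv c)) (at x) = frechet_derivative id (at x)"
    by (rule frechet_derivative_cong_open[OF open_overlap[OF d(1)] xS])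
  then have "frechet_derivative (snd c \<circ> chart_inv d) (at ((snd d \<circ> chart_inv c) x)) \<circ> jacobian M c x = id"
    unfolding frechet_derivative_compose[OF df dg] by (simp add: jacobian_def d_def)
  then show ?thesis by (metis inj_on_id inj_on_imageI2)
qed

lemma jacobian_eq_0_iff: "x \<in> chart_image c \<Longrightarrow> jacobian M c x y = 0 \<longleftrightarrow> y = 0"
  using linear_injective_0[OF linear_jacobian] inj_jacobian linear_0[OF linear_jacobian] by blast

text \<open>An injective Jacobian sends exactly the zero components to the zero vector, so the slit
  condition is the same in every chart.\<close>

lemma tangent_dom_slit: "tangent_dom M (slit_tangent_bundle M) c = chart_image c \<times> - {0}"
  unfolding tangent_dom_def slit_tangent_bundle_def
  by (auto simp: tangent_lift_eq jacobian_eq_0_iff chart_inv_in_topspace)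

end

lemma finsler_chart_local_sq:
  assumes F: "finsler_manifold M F" and c: "c \<in> atlas M"
  shows "finsler_chart (chart_image c) (local_sq M F c)"
proof -
  interpret manifold_chart M c using F c by unfold_locales (auto simp: finsler_manifold_def)
  note td = tangent_dom_slit[symmetric]
  show ?thesis
  proof
    show "open (chart_image c)" by (rule open_image)
    then have "open (chart_image c \<times> - {0::'b})" by (intro open_Times open_Compl) auto
    moreover have "smooth_on (chart_image c \<times> - {0}) (F \<circ> tangent_lift M c)"
      using F c unfolding finsler_manifold_def td by blast
    ultimately show "smooth_on (chart_image c \<times> - {0}) (local_sq M F c)"
      unfolding local_sq_def[abs_def] using smooth_on_power[of _ "F \<circ> tangent_lift M c" 2] by simp
    show "homogeneous_on 2 (chart_image c) (local_sq M F c)"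
      unfolding homogeneous_on_def
    proof (intro ballI allI impI)
      fix x y and t :: real assume x: "x \<in> chart_image c" and t: "t > 0"
      have "F (chart_inv c x, t *\<^sub>R jacobian M c x y) = t * F (chart_inv c x, jacobian M c x y)"
        using F chart_inv_in_topspace[OF x] t unfolding finsler_manifold_def by blast
      then show "local_sq M F c (x, t *\<^sub>R y) = t\<^sup>2 * local_sq M F c (x, y)"
        by (simp add: local_sq_def tangent_lift_eq linear_scale[OF linear_jacobian[OF x]] power_mult_distrib)
    qed
    show "0 < (\<Sum>i\<in>Basis. \<Sum>j\<in>Basis. fund_tensor (local_sq M F c) i j (x, y) * (v \<bullet> i) * (v \<bullet> j))"
      if "x \<in> chart_image c" "y \<noteq> 0" "v \<noteq> 0" for x y v
    proof -
      have "(x, y) \<in> tangent_dom M (slit_tangent_bundle M) c" unfolding tangent_dom_slit using that by simp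
      then show ?thesis using F c that(3) unfolding finsler_manifold_def by blast
    qed
  qed
qed

definition local_metric ::
  "('a, 'e::euclidean_space) manifold \<Rightarrow> ('a \<Rightarrow> 'e \<Rightarrow> 'e \<Rightarrow> real) \<Rightarrow> ('a, 'e) chart \<Rightarrow> 'e \<Rightarrow> 'e \<Rightarrow> 'e \<Rightarrow> real" where
  "local_metric M g c i j x = g (chart_inv c x) (jacobian M c x i) (jacobian M c x j)"

lemma riemannian_chart_local_sq:
  assumes g: "riemannian_manifold M g" and c: "c \<in> atlas M"
  shows "riemannian_chart (chart_image c) (local_metric M g c) (local_sq M (riemannian_norm g) c)"
proof -
  interpret manifold_chart M c using g c by unfold_locales (auto simp: riemannian_manifold_def)
  have gp: "bilinear (g p)" "g p v w = g p w v" "v \<noteq> 0 \<Longrightarrow> g p v v > 0" if "p \<in> topspace (mtop M)" for p v w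
    using g that unfolding riemannian_manifold_def by blast+
  have quad: "g (chart_inv c x) (jacobian M c x v) (jacobian M c x v) =
      (\<Sum>i\<in>Basis. \<Sum>j\<in>Basis. local_metric M g c i j x * (v \<bullet> i) * (v \<bullet> j))" if x: "x \<in> chart_image c" for x v
  proof -
    note lin = linear_jacobian[OF x]
    note bil = gp(1)[OF chart_inv_in_topspace[OF x]]
    have "jacobian M c x v = (\<Sum>i\<in>Basis. (v \<bullet> i) *\<^sub>R jacobian M c x i)"
      by (subst (1) euclidean_representation[of v, symmetric]) (simp only: linear_sum[OF lin] linear_scale[OF lin])
    then show ?thesis
      by (simp add: bilinear_sum[OF bil] bilinear_lmul[OF bil] bilinear_rmul[OF bil] sum.cartesian_product local_metric_def mult_ac)
  qed
  show ?thesis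
  proof
    show "open (chart_image c)" by (rule open_image)
    show "smooth_on (chart_image c) (local_metric M g c i j)" if "i \<in> Basis" "j \<in> Basis" for i j
    proof -
      have "smooth_on (chart_image c)
          (\<lambda>x. g (chart_inv c x) (snd (tangent_lift M c (x, i))) (snd (tangent_lift M c (x, j))))"
        using g c that unfolding riemannian_manifold_def by blast
      then show ?thesis by (simp add: local_metric_def[abs_def] tangent_lift_eq)
    qed
    show "local_metric M g c i j x = local_metric M g c j i x" if "x \<in> chart_image c" for x i j
      unfolding local_metric_def by (rule gp(2)[OF chart_inv_in_topspace[OF that]])
    show "0 < (\<Sum>i\<in>Basis. \<Sum>j\<in>Basis. local_metric M g c i j x * (v \<bullet> i) * (v \<bullet> j))"
      if "x \<in> chart_image c" "v \<noteq> 0" for x v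
      unfolding quad[OF that(1), symmetric]
      using that by (intro gp(3)[OF chart_inv_in_topspace]) (simp_all add: jacobian_eq_0_iff)
    fix x y assume x: "x \<in> chart_image c"
    \<comment> \<open>Squaring undoes the root in \<open>riemannian_norm\<close> because of this,
      and the quadratic expression holds at \<open>y = 0\<close> too.\<close>
    have "g (chart_inv c x) (jacobian M c x y) (jacobian M c x y) \<ge> 0"
    proof (cases "jacobian M c x y = 0")
      case True
      then show ?thesis using bilinear_lzero[OF gp(1)[OF chart_inv_in_topspace[OF x]]] by simp
    qed (use gp(3)[OF chart_inv_in_topspace[OF x]] in \<open>simp add: less_imp_le\<close>)
    then show "local_sq M (riemannian_norm g) c (x, y) = (\<Sum>i\<in>Basis. \<Sum>j\<in>Basis. local_metric M g c i j x * (y \<bullet> i) * (y \<bullet> j))"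
      unfolding quad[OF x, symmetric] by (simp add: local_sq_def riemannian_norm_def tangent_lift_eq)
  qed
qed

section \<open>Charts of a product\<close>

lemma chart_at_product:
  "snd (chart_at (product_manifold M1 M2) p) = map_prod (snd (chart_at M1 (fst p))) (snd (chart_at M2 (snd p)))"
  by (simp add: product_manifold_def product_chart_def)

lemma product_chart_image: "chart_image (product_chart c d) = chart_image c \<times> chart_image d"
  by (auto simp: chart_image_def product_chart_def)

locale product_manifold_chart =
  c: manifold_chart M1 c + d: manifold_chart M2 d
  for M1 :: "('a, 'e::euclidean_space) manifold" and c and M2 :: "('b, 'f::euclidean_space) manifold" and d
begin

abbreviation "cd \<equiv> product_chart c d"

lemma product_chart_inv:
  assumes "x1 \<in> chart_image c" "x2 \<in> chart_image d"
  shows "chart_inv cd (x1, x2) = (chart_inv c x1, chart_inv d x2)"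
proof -
  have "inj_on (snd cd) (fst cd)"
    using c.inj_chart d.inj_chart by (auto simp: inj_on_def product_chart_def)
  moreover have "(chart_inv c x1, chart_inv d x2) \<in> fst cd"
    using assms c.chart_inv_in d.chart_inv_in by (simp add: product_chart_def)
  moreover have "snd cd (chart_inv c x1, chart_inv d x2) = (x1, x2)"
    using assms by (simp add: product_chart_def c.chart_chart_inv d.chart_chart_inv)
  ultimately show ?thesis unfolding chart_inv_def[of cd] by (metis inv_into_f_f)
qed

text \<open>The reference chart of a product point is the product of the reference charts, so the
  Jacobian of the product is block diagonal.\<close>

lemma product_tangent_lift:
  assumes x: "x1 \<in> chart_image c" "x2 \<in> chart_image d"
  shows "tangent_lift (product_manifold M1 M2) cd ((x1, x2), (y1, y2)) =
    ((chart_inv c x1, chart_inv d x2), (jacobian M1 c x1 y1, jacobian M2 d x2 y2))"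
proof -
  let ?c = "snd (chart_at M1 (chart_inv c x1)) \<circ> chart_inv c"
  let ?d = "snd (chart_at M2 (chart_inv d x2)) \<circ> chart_inv d"
  have 1: "((\<lambda>w. ?c (fst w)) has_derivative (\<lambda>v. jacobian M1 c x1 (fst v))) (at (x1, x2))"
    using has_derivative_compose_bounded_linear[OF bounded_linear_fst, of ?c "(x1, x2)"] c.differentiable_jacobian[OF x(1)]
    by (simp add: jacobian_def)
  have 2: "((\<lambda>w. ?d (snd w)) has_derivative (\<lambda>v. jacobian M2 d x2 (snd v))) (at (x1, x2))"
    using has_derivative_compose_bounded_linear[OF bounded_linear_snd, of ?d "(x1, x2)"] d.differentiable_jacobian[OF x(2)]
    by (simp add: jacobian_def)
  \<comment> \<open>Restricted to the chart image: only there is \<open>chart_inv\<close> of the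
    product chart known to act componentwise.\<close>
  have eq: "(snd (chart_at (product_manifold M1 M2) (chart_inv cd (x1, x2))) \<circ> chart_inv cd) w = (?c (fst w), ?d (snd w))"
    if "w \<in> chart_image c \<times> chart_image d" for w
    using that x by (auto simp: product_chart_inv chart_at_product)
  have "frechet_derivative (snd (chart_at (product_manifold M1 M2) (chart_inv cd (x1, x2))) \<circ> chart_inv cd) (at (x1, x2))
    = frechet_derivative (\<lambda>w. (?c (fst w), ?d (snd w))) (at (x1, x2))"
    by (rule frechet_derivative_cong_open[OF open_Times[OF c.open_image d.open_image] _ eq]) (use x in simp_all)
  also have "\<dots> = (\<lambda>v. (jacobian M1 c x1 (fst v), jacobian M2 d x2 (snd v)))"
    by (rule frechet_derivative_eqI[OF has_derivative_Pair[OF 1 2]])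
  finally show ?thesis
    unfolding tangent_lift_eq jacobian_def[of "product_manifold M1 M2"] by (simp add: product_chart_inv[OF x])
qed

lemma product_tangent_dom:
  "tangent_dom (product_manifold M1 M2) (product_slit M1 M2) cd =
    {z. fst_pair z \<in> chart_image c \<times> - {0} \<and> snd_pair z \<in> chart_image d \<times> - {0}}"
proof (rule set_eqI, unfold mem_Collect_eq)
  fix z
  show "z \<in> tangent_dom (product_manifold M1 M2) (product_slit M1 M2) cd \<longleftrightarrow>
      fst_pair z \<in> chart_image c \<times> - {0} \<and> snd_pair z \<in> chart_image d \<times> - {0}"
  proof -
    obtain x1 x2 y1 y2 where z: "z = ((x1, x2), (y1, y2))" by (metis prod.collapse)
    show ?thesis
    proof (cases "x1 \<in> chart_image c \<and> x2 \<in> chart_image d")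
      case True
      then show ?thesis
        by (simp add: z tangent_dom_def product_chart_image product_tangent_lift product_slit_def slit_tangent_bundle_def
            fst_pair_def snd_pair_def c.jacobian_eq_0_iff d.jacobian_eq_0_iff c.chart_inv_in_topspace d.chart_inv_in_topspace)
    next
      case False
      then show ?thesis
        by (simp add: z tangent_dom_def product_chart_image fst_pair_def snd_pair_def del: imp_conjL not_imp) blast
    qed
  qed
qed

lemma product_local_sq:
  assumes "x1 \<in> chart_image c" "x2 \<in> chart_image d"
  shows "local_sq (product_manifold M1 M2) (warped_metric f F1 F2) cd ((x1, x2), (y1, y2)) =
    local_sq M1 F1 c (x1, y1) + (f (chart_inv c x1))\<^sup>2 * local_sq M2 F2 d (x2, y2)"
  unfolding local_sq_def product_tangent_lift[OF assms] by (simp add: warped_metric_def tangent_lift_eq)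

lemma warped_chart_local_sq:
  assumes g: "riemannian_manifold M1 g" and F: "finsler_manifold M2 F"
    and f: "smooth_fun_on_manifold M1 f" and f_pos: "\<forall>p\<in>topspace (mtop M1). f p > 0"
  shows "warped_chart (chart_image c) (local_sq M1 (riemannian_norm g) c) (chart_image d) (local_sq M2 F d)
    (f \<circ> chart_inv c) (riemannian_chart.ginv (local_metric M1 g c))
    (local_sq (product_manifold M1 M2) (warped_metric f (riemannian_norm g) F) cd)
    (tangent_dom (product_manifold M1 M2) (product_slit M1 M2) cd)"
proof -
  interpret A: riemannian_chart "chart_image c" "local_metric M1 g c" "local_sq M1 (riemannian_norm g) c"
    by (rule riemannian_chart_local_sq[OF g c.c])
  interpret P: finsler_chart "chart_image d" "local_sq M2 F d"
    by (rule finsler_chart_local_sq[OF F d.c])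
  show ?thesis
  proof
    show "smooth_on (chart_image c) (f \<circ> chart_inv c)"
      using f c.c by (simp add: smooth_fun_on_manifold_def)
    show "0 < (f \<circ> chart_inv c) x" if "x \<in> chart_image c" for x
      using f_pos c.chart_inv_in_topspace[OF that] by simp
    show "smooth_on (chart_image c) (A.ginv i l)" for i l by (rule A.smooth_ginv)
    show "fund_tensor_inv (local_sq M1 (riemannian_norm g) c) i l (x, y) = A.ginv i l x"
      if "x \<in> chart_image c" for i l x y by (rule A.fund_tensor_inv_A[OF that])
    show "mean_berwald (local_sq M1 (riemannian_norm g) c) i j (x, y) = 0"
      if "x \<in> chart_image c" "i \<in> Basis" "j \<in> Basis" for i j x y
      using that by (intro A.weakly_berwald_A) auto
    show "tangent_dom (product_manifold M1 M2) (product_slit M1 M2) cd =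
      {z. fst_pair z \<in> chart_image c \<times> - {0} \<and> snd_pair z \<in> chart_image d \<times> - {0}}"
      by (rule product_tangent_dom)
    fix z assume "z \<in> tangent_dom (product_manifold M1 M2) (product_slit M1 M2) cd"
    then show "local_sq (product_manifold M1 M2) (warped_metric f (riemannian_norm g) F) cd z =
      local_sq M1 (riemannian_norm g) c (fst_pair z)
      + ((f \<circ> chart_inv c) (fst (fst_pair z)))\<^sup>2 * local_sq M2 F d (snd_pair z)"
      unfolding product_tangent_dom
      using product_local_sq[of "fst (fst z)" "snd (fst z)" f "riemannian_norm g" F "fst (snd z)" "snd (snd z)"]
      by (auto simp: fst_pair_def snd_pair_def)
  qed
qed

end

section \<open>Einstein warped products\<close>

text \<open>If the fibre is one-dimensional, the operator is the Laplacian of the base; if the base is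
  one-dimensional, it is the second covariant derivative along the coordinate vector.\<close>

lemma (in warped_chart) einstein_imp_elliptic:
  fixes r :: "'e \<Rightarrow> real"
  assumes dim: "DIM('e) = 1 \<or> DIM('f) = 1" and x2: "x2 \<in> V"
    and ginv_sym: "\<And>x i l. x \<in> U \<Longrightarrow> ginv i l x = ginv l i x"
    and ginv_pos: "\<And>x v. x \<in> U \<Longrightarrow> v \<noteq> 0 \<Longrightarrow> (\<Sum>i\<in>Basis. \<Sum>l\<in>Basis. ginv i l x * (v \<bullet> i) * (v \<bullet> l)) > 0"
    and ein: "\<And>x y1 y2. x \<in> U \<Longrightarrow> y1 \<noteq> 0 \<Longrightarrow> y2 \<noteq> 0 \<Longrightarrow>
      ricci_curv L ((x, x2), (y1, y2)) = r x * L ((x, x2), (y1, y2))"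
  obtains a b k where "\<And>i j. i \<in> Basis \<Longrightarrow> j \<in> Basis \<Longrightarrow> continuous_on U (a i j)"
    "\<And>j. j \<in> Basis \<Longrightarrow> continuous_on U (b j)"
    "\<And>x i j. x \<in> U \<Longrightarrow> i \<in> Basis \<Longrightarrow> j \<in> Basis \<Longrightarrow> a i j x = a j i x"
    "\<And>x v. x \<in> U \<Longrightarrow> v \<noteq> 0 \<Longrightarrow> (\<Sum>i\<in>Basis. \<Sum>j\<in>Basis. a i j x * (v \<bullet> i) * (v \<bullet> j)) > 0"
    "\<And>x. x \<in> U \<Longrightarrow> k x > 0"
    "\<And>x. x \<in> U \<Longrightarrow> (\<Sum>i\<in>Basis. \<Sum>j\<in>Basis. a i j x * frechet_derivative (d\<phi> j) (at x) i)
      + (\<Sum>j\<in>Basis. b j x * d\<phi> j x) = - r x * k x"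
proof -
  \<comment> \<open>Some coefficients, such as \<open>pdy i D1\<close>, are functions on the slit
    domain. Evaluating them at a fixed nonzero velocity makes them continuous functions of
    \<open>x\<close>.\<close>
  obtain e :: 'e where e: "e \<in> Basis" using nonempty_Basis by blast
  then have e0: "e \<noteq> 0" by auto
  have slit: "continuous_on U (\<lambda>x. H (x, e))" if "smooth_on (U \<times> - {0}) H" for H :: "'e \<times> 'e \<Rightarrow> real"
    by (rule continuous_on_compose2[OF smooth_on_continuous_on[OF that]])
      (use e0 in \<open>auto intro!: continuous_intros\<close>)
  show thesis
  proof (cases "DIM('f) = 1")
    case True
    \<comment> \<open>Dividing \<open>- r x * (\<phi> x)\<^sup>2\<close> by \<open>\<phi> x\<close>
      leaves the positive factor \<open>k = \<phi>\<close>.\<close>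
    show thesis
    proof (rule that[of ginv "\<lambda>l x. \<Sum>i\<in>Basis. frechet_derivative (ginv i l) (at x) i + ginv i l x * pdy i D1 (x, e)" \<phi>])
      show "continuous_on U (ginv i j)" for i j by (rule smooth_on_continuous_on[OF smooth_ginv])
      show "continuous_on U (\<lambda>x. \<Sum>i\<in>Basis. frechet_derivative (ginv i l) (at x) i + ginv i l x * pdy i D1 (x, e))" for l
        by (intro continuous_on_sum continuous_on_add continuous_on_mult slit smooth_on_continuous_on[OF smooth_ginv]
            smooth_on_continuous_on[OF smooth_on_frechet_derivative[OF smooth_ginv]] smooth_on_pdy base.smooth_divergence)
      fix x assume x: "x \<in> U"
      show "0 < \<phi> x" by (rule \<phi>_pos[OF x])
      let ?l = "(\<Sum>i\<in>Basis. \<Sum>j\<in>Basis. ginv i j x * frechet_derivative (d\<phi> j) (at x) i)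
        + (\<Sum>l\<in>Basis. (\<Sum>i\<in>Basis. frechet_derivative (ginv i l) (at x) i + ginv i l x * pdy i D1 (x, e)) * d\<phi> l x)"
      have "\<phi> x * ?l = - r x * (\<phi> x)\<^sup>2"
        using warp_laplacian_eq[OF True x e0] einstein_fibre_dim_1[OF True x x2 e0 ein[OF x e0]] by simp
      then have "\<phi> x * ?l = \<phi> x * (- r x * \<phi> x)" by (simp add: power2_eq_square mult_ac)
      then show "?l = - r x * \<phi> x" using mult_left_cancel[THEN iffD1, OF less_imp_neq[OF \<phi>_pos[OF x], symmetric]] by blast
    qed (use ginv_sym ginv_pos in auto)
  next
    case False
    then have dim: "DIM('e) = 1" using dim by simp
    then obtain b0 where b0: "Basis = {b0::'e}" using card_1_singletonE by blast
    have "e = b0" using e unfolding b0 by (rule singletonD)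
    then have b: "Basis = {e}" using b0 by simp
    \<comment> \<open>In one coordinate the leading coefficient can be 1. The factor
      \<open>k\<close> arises from multiplying \<open>n * hess_log = - r x * A\<close> by
      \<open>\<phi> / n\<close>.\<close>
    show thesis
    proof (rule that[of "\<lambda>i j x. 1" "\<lambda>j x. - 2 * spray A e (x, e)" "\<lambda>x. \<phi> x * A (x, e) / real DIM('f)"])
      show "continuous_on U (\<lambda>x. - 2 * spray A e (x, e))"
        by (intro continuous_on_mult continuous_on_const slit base.smooth_spray)
      show "(\<Sum>i\<in>Basis. \<Sum>j\<in>Basis. 1 * (v \<bullet> i) * (v \<bullet> j)) > 0" if "v \<noteq> 0" for v :: 'e
      proof -
        have "v \<bullet> e \<noteq> 0" using that b euclidean_all_zero_iff[of v] by auto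
        then show ?thesis by (simp add: b power2_eq_square[symmetric])
      qed
      fix x assume x: "x \<in> U"
      show "0 < \<phi> x * A (x, e) / real DIM('f)"
        using \<phi>_pos[OF x] base.P_pos[OF x e0] by simp
      have "real DIM('f) * hess_log (x, e) = - r x * A (x, e)"
        by (rule einstein_base_dim_1[OF dim x x2 e0 ein[OF x]])
      then have "\<phi> x * hess_log (x, e) = - r x * (\<phi> x * A (x, e) / real DIM('f))"
        by (simp add: field_simps)
      then show "(\<Sum>i\<in>Basis. \<Sum>j\<in>Basis. 1 * frechet_derivative (d\<phi> j) (at x) i)
        + (\<Sum>j\<in>Basis. - 2 * spray A e (x, e) * d\<phi> j x) = - r x * (\<phi> x * A (x, e) / real DIM('f))"
        using hess_log_dim_1[OF b x] by (simp add: b)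
    qed auto
  qed
qed

section \<open>From charts to the compact connected base\<close>

lemma atlas_nonempty:
  assumes "smooth_manifold M"
  obtains d x where "d \<in> atlas M" "x \<in> chart_image d"
proof -
  obtain p where "p \<in> topspace (mtop M)" using assms unfolding smooth_manifold_def by blast
  then have "chart_at M p \<in> atlas M" "p \<in> fst (chart_at M p)" using assms by (auto simp: smooth_manifold_def)
  then show thesis
    using that[of "chart_at M p" "snd (chart_at M p) p"] by (simp add: chart_image_def)
qed

lemma continuous_map_smooth_fun:
  assumes M: "smooth_manifold M" and f: "smooth_fun_on_manifold M f"
  shows "continuous_map (mtop M) euclideanreal f"
  unfolding continuous_map
proof (intro conjI allI impI)
  fix S :: "real set" assume "openin euclidean S"
  then have S: "open S" by simp
  show "openin (mtop M) {p \<in> topspace (mtop M). f p \<in> S}"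
  proof (subst openin_subopen, intro ballI)
    fix p assume p: "p \<in> {p \<in> topspace (mtop M). f p \<in> S}"
    define c where "c = chart_at M p"
    have pc: "c \<in> atlas M" "p \<in> fst c" using M p by (auto simp: smooth_manifold_def c_def)
    interpret manifold_chart M c using M pc by unfold_locales
    have "continuous_on (chart_image c) (f \<circ> chart_inv c)"
      using f pc(1) unfolding smooth_fun_on_manifold_def by (blast intro: smooth_on_continuous_on)
    then have "open ((f \<circ> chart_inv c) -` S \<inter> chart_image c)"
      using continuous_on_open_vimage[OF open_image] S by blast
    from openin_chart_preimage[OF this]
    show "\<exists>T. openin (mtop M) T \<and> p \<in> T \<and> T \<subseteq> {p \<in> topspace (mtop M). f p \<in> S}"
      using pc(2) p openin_subset[OF open_dom]
      by (intro exI[of _ "{q \<in> fst c. snd c q \<in> (f \<circ> chart_inv c) -` S \<inter> chart_image c}"])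
        (auto simp: chart_inv_chart chart_in_image)
  qed
qed auto

text \<open>The set where the maximum is attained is open by \<open>loc\<close>, its complement by
  continuity, and it is nonempty by compactness; connectedness does the rest.\<close>

lemma constant_if_locally_constant_at_max:
  assumes M: "smooth_manifold M" "compact_space (mtop M)" and f: "continuous_map (mtop M) euclideanreal f"
    and loc: "\<And>p. p \<in> topspace (mtop M) \<Longrightarrow> (\<forall>q\<in>topspace (mtop M). f q \<le> f p) \<Longrightarrow>
      \<exists>T. openin (mtop M) T \<and> p \<in> T \<and> (\<forall>q\<in>T. f q = f p)"
  shows "f constant_on topspace (mtop M)"
proof -
  let ?X = "topspace (mtop M)"
  have "compactin euclideanreal (f ` ?X)"
    using M(2) unfolding compact_space_def by (rule image_compactin[OF _ f])
  then have "compact (f ` ?X)" by simp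
  moreover have "f ` ?X \<noteq> {}" using M(1) by (simp add: smooth_manifold_def)
  ultimately obtain p where p: "p \<in> ?X" "\<And>q. q \<in> ?X \<Longrightarrow> f q \<le> f p"
    using compact_attains_sup[of "f ` ?X"] by auto
  let ?E = "{q \<in> ?X. f q = f p}"
  have "openin (mtop M) ?E"
  proof (subst openin_subopen, intro ballI)
    fix q assume q: "q \<in> ?E"
    then have qX: "q \<in> ?X" and "\<forall>q'\<in>?X. f q' \<le> f q" using p(2) by auto
    from loc[OF this] obtain T where T: "openin (mtop M) T" "q \<in> T" "\<forall>q'\<in>T. f q' = f q" by blast
    have "f t = f p" if "t \<in> T" for t
      using T(3)[rule_format, OF that] q by simp
    then have "T \<subseteq> ?E" using openin_subset[OF T(1)] by blast
    then show "\<exists>T. openin (mtop M) T \<and> q \<in> T \<and> T \<subseteq> ?E"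
      using T(1,2) by blast
  qed
  moreover have "openin (mtop M) {q \<in> ?X. f q \<in> {..<f p}}"
    by (rule openin_continuous_map_preimage[OF f]) simp
  moreover have "?X \<subseteq> ?E \<union> {q \<in> ?X. f q \<in> {..<f p}}" using p(2) by force
  moreover have "?E \<inter> {q \<in> ?X. f q \<in> {..<f p}} = {}" by auto
  moreover have "?E \<noteq> {}" using p(1) by auto
  moreover have "connected_space (mtop M)" using M(1) by (simp add: smooth_manifold_def)
  ultimately have "{q \<in> ?X. f q \<in> {..<f p}} = {}" unfolding connected_space_def by blast
  then have "\<forall>q\<in>?X. f q = f p" using p(2) by force
  then show ?thesis unfolding constant_on_def by blast
qed

theorem proposition4:
  fixes M1 :: "('a, 'e::euclidean_space) manifold"
    and M2 :: "('b, 'f::euclidean_space) manifold"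
    and g1 :: "'a \<Rightarrow> 'e \<Rightarrow> 'e \<Rightarrow> real"
    and F2 :: "'b \<times> 'f \<Rightarrow> real"
    and f :: "'a \<Rightarrow> real"
    and lam :: "'a \<times> 'b \<Rightarrow> real"
  assumes "riemannian_manifold M1 g1"
    and "compact_space (mtop M1)"
    and "smooth_fun_on_manifold M1 f"
    and "\<forall>x\<in>topspace (mtop M1). f x > 0"
    and "finsler_manifold M2 F2"
    and "weakly_berwald M2 (slit_tangent_bundle M2) F2"
    and "einstein (product_manifold M1 M2) (product_slit M1 M2)
           (warped_metric f (riemannian_norm g1) F2) lam"
    and "DIM('e) = 1 \<or> DIM('f) = 1"
    and "(\<forall>p\<in>topspace (mtop (product_manifold M1 M2)). lam p \<ge> 0) \<or>
         (\<forall>p\<in>topspace (mtop (product_manifold M1 M2)). lam p \<le> 0)"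
  shows "f constant_on topspace (mtop M1) \<and>
         weakly_berwald (product_manifold M1 M2) (product_slit M1 M2)
           (warped_metric f (riemannian_norm g1) F2)"
proof
  let ?M = "product_manifold M1 M2" and ?F = "warped_metric f (riemannian_norm g1) F2" and ?X = "topspace (mtop M1)"
  have M1: "smooth_manifold M1" using assms(1) by (simp add: riemannian_manifold_def)
  have M2: "smooth_manifold M2" using assms(5) by (simp add: finsler_manifold_def)
  have warped: "warped_chart (chart_image c) (local_sq M1 (riemannian_norm g1) c) (chart_image d) (local_sq M2 F2 d)
      (f \<circ> chart_inv c) (riemannian_chart.ginv (local_metric M1 g1 c)) (local_sq ?M ?F (product_chart c d))
      (tangent_dom ?M (product_slit M1 M2) (product_chart c d))" if "c \<in> atlas M1" "d \<in> atlas M2" for c d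
  proof -
    interpret product_manifold_chart M1 c M2 d using M1 M2 that by unfold_locales
    show ?thesis by (rule warped_chart_local_sq[OF assms(1,5,3,4)])
  qed
  show "weakly_berwald ?M (product_slit M1 M2) ?F"
    unfolding weakly_berwald_def
  proof (intro ballI)
    fix cd z i j assume cd: "cd \<in> atlas ?M" and z: "z \<in> tangent_dom ?M (product_slit M1 M2) cd"
      and ij: "i \<in> (Basis :: ('e \<times> 'f) set)" "j \<in> (Basis :: ('e \<times> 'f) set)"
    obtain c d where c: "c \<in> atlas M1" "d \<in> atlas M2" "cd = product_chart c d"
      using cd by (auto simp: product_manifold_def)
    interpret warped_chart "chart_image c" "local_sq M1 (riemannian_norm g1) c" "chart_image d" "local_sq M2 F2 d"
      "f \<circ> chart_inv c" "riemannian_chart.ginv (local_metric M1 g1 c)" "local_sq ?M ?F cd"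
      "tangent_dom ?M (product_slit M1 M2) cd"
      unfolding c(3) by (rule warped[OF c(1,2)])
    interpret d: manifold_chart M2 d using M2 c by unfold_locales
    show "mean_berwald (local_sq ?M ?F cd) i j z = 0"
    proof (rule weakly_berwald_L[OF _ z ij])
      show "mean_berwald (local_sq M2 F2 d) a b (snd_pair z) = 0" if "a \<in> Basis" "b \<in> Basis" for a b
        using assms(6) c(2) WD(2)[OF z] that unfolding weakly_berwald_def d.tangent_dom_slit[symmetric] by blast
    qed
  qed
  \<comment> \<open>A single fibre point is enough: on its slice \<open>lam\<close> becomes a
    function of the base point, and \<open>f\<close> does not depend on the fibre.\<close>
  obtain d x2 where d: "d \<in> atlas M2" "x2 \<in> chart_image d" by (rule atlas_nonempty[OF M2])
  interpret d: manifold_chart M2 d using M2 d by unfold_locales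
  have topspace: "topspace (mtop ?M) = ?X \<times> topspace (mtop M2)"
    by (simp add: product_manifold_def)
  \<comment> \<open>The factor \<open>\<sigma>\<close> makes \<open>\<sigma> * f\<close> a
    subsolution whichever sign \<open>lam\<close> has, so one argument at a maximum serves both
    cases.\<close>
  obtain \<sigma> :: real where \<sigma>: "\<sigma> \<noteq> 0" "\<And>p. p \<in> topspace (mtop ?M) \<Longrightarrow> \<sigma> * lam p \<le> 0"
    using assms(9)
  proof
    assume "\<forall>p\<in>topspace (mtop ?M). lam p \<ge> 0"
    then show thesis using that[of "-1"] by simp
  next
    assume "\<forall>p\<in>topspace (mtop ?M). lam p \<le> 0"
    then show thesis using that[of 1] by simp
  qed
  have "(\<lambda>p. \<sigma> * f p) constant_on ?X"
  proof (rule constant_if_locally_constant_at_max[OF M1 assms(2)])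
    show "continuous_map (mtop M1) euclideanreal (\<lambda>p. \<sigma> * f p)"
      by (intro continuous_map_real_mult_left continuous_map_smooth_fun[OF M1 assms(3)])
    fix p assume p: "p \<in> ?X" and max: "\<forall>q\<in>?X. \<sigma> * f q \<le> \<sigma> * f p"
    define c where "c = chart_at M1 p"
    have c: "c \<in> atlas M1" "p \<in> fst c" using M1 p by (auto simp: smooth_manifold_def c_def)
    interpret product_manifold_chart M1 c M2 d using M1 M2 c d by unfold_locales
    interpret A: riemannian_chart "chart_image c" "local_metric M1 g1 c" "local_sq M1 (riemannian_norm g1) c"
      by (rule riemannian_chart_local_sq[OF assms(1) c(1)])
    let ?L = "local_sq ?M ?F cd"
    interpret W: warped_chart "chart_image c" "local_sq M1 (riemannian_norm g1) c" "chart_image d" "local_sq M2 F2 d"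
      "f \<circ> chart_inv c" A.ginv ?L "tangent_dom ?M (product_slit M1 M2) cd"
      by (rule warped[OF c(1) d(1)])
    let ?U = "chart_image c" and ?\<phi> = "f \<circ> chart_inv c"
    define r where "r x = lam (chart_inv c x, chart_inv d x2)" for x
    have ein: "ricci_curv ?L ((x, x2), (y1, y2)) = r x * ?L ((x, x2), (y1, y2))"
      if "x \<in> ?U" "y1 \<noteq> 0" "y2 \<noteq> 0" for x y1 y2
    proof -
      have "cd \<in> atlas ?M" unfolding product_manifold_def manifold.simps using c(1) d(1) by blast
      from assms(7)[unfolded einstein_def, rule_format, OF this W.in_W[OF that(1) d(2) that(2,3)]]
      show ?thesis by (simp add: product_chart_inv[OF that(1) d(2)] r_def)
    qed
    obtain a b k where ab: "\<And>i j. i \<in> Basis \<Longrightarrow> j \<in> Basis \<Longrightarrow> continuous_on ?U (a i j)"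
      "\<And>j. j \<in> Basis \<Longrightarrow> continuous_on ?U (b j)"
      "\<And>x i j. x \<in> ?U \<Longrightarrow> i \<in> Basis \<Longrightarrow> j \<in> Basis \<Longrightarrow> a i j x = a j i x"
      "\<And>x v. x \<in> ?U \<Longrightarrow> v \<noteq> 0 \<Longrightarrow> (\<Sum>i\<in>Basis. \<Sum>j\<in>Basis. a i j x * (v \<bullet> i) * (v \<bullet> j)) > 0"
      and k: "\<And>x. x \<in> ?U \<Longrightarrow> k x > 0"
      and eq: "\<And>x. x \<in> ?U \<Longrightarrow> (\<Sum>i\<in>Basis. \<Sum>j\<in>Basis. a i j x * frechet_derivative (W.d\<phi> j) (at x) i)
        + (\<Sum>j\<in>Basis. b j x * W.d\<phi> j x) = - r x * k x"
      by (rule W.einstein_imp_elliptic[OF assms(8) d(2) A.ginv_sym A.ginv_pos ein]) blast+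
    have d1: "frechet_derivative (\<lambda>x. \<sigma> * ?\<phi> x) (at x) j = \<sigma> * W.d\<phi> j x" if "x \<in> ?U" for x j
      using frechet_derivative_mult[OF differentiable_const smooth_on_differentiable[OF W.smooth_\<phi> that], of \<sigma> j]
      by (simp only: frechet_derivative_const mult_zero_left add_0_right)
    have d2: "frechet_derivative (\<lambda>x. frechet_derivative (\<lambda>x. \<sigma> * ?\<phi> x) (at x) j) (at x) i = \<sigma> * frechet_derivative (W.d\<phi> j) (at x) i"
      if "x \<in> ?U" for x i j
    proof -
      have "frechet_derivative (\<lambda>x. frechet_derivative (\<lambda>x. \<sigma> * ?\<phi> x) (at x) j) (at x) = frechet_derivative (\<lambda>x. \<sigma> * W.d\<phi> j x) (at x)"
        by (rule frechet_derivative_cong_open[OF c.open_image that d1])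
      then show ?thesis
        using frechet_derivative_mult[OF differentiable_const
            smooth_on_differentiable[OF smooth_on_frechet_derivative[OF W.smooth_\<phi>] that], of \<sigma> j i]
        by (simp only: frechet_derivative_const mult_zero_left add_0_right)
    qed
    have "\<exists>\<rho>>0. ball (snd c p) \<rho> \<subseteq> ?U \<and> (\<forall>x\<in>ball (snd c p) \<rho>. \<sigma> * ?\<phi> x = \<sigma> * f p)"
    proof (rule strong_maximum_principle[where a = a and b = b])
      show "open ?U" by (rule c.open_image)
      show "smooth_on ?U (\<lambda>x. \<sigma> * ?\<phi> x)"
        by (rule smooth_on_mult[OF c.open_image smooth_on_const W.smooth_\<phi>])
      show "snd c p \<in> ?U" by (rule c.chart_in_image[OF c(2)])
      show "\<sigma> * ?\<phi> (snd c p) = \<sigma> * f p" by (simp add: c.chart_inv_chart[OF c(2)])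
      fix x assume x: "x \<in> ?U"
      show "\<sigma> * ?\<phi> x \<le> \<sigma> * f p" using max c.chart_inv_in_topspace[OF x] by simp
      have "\<sigma> * r x \<le> 0"
        unfolding r_def topspace using c.chart_inv_in_topspace[OF x] d.chart_inv_in_topspace[OF d(2)] topspace
        by (intro \<sigma>(2)) simp
      then have "\<sigma> * r x * k x \<le> 0" using k[OF x] by (simp add: mult_nonpos_nonneg)
      then have "0 \<le> \<sigma> * ((\<Sum>i\<in>Basis. \<Sum>j\<in>Basis. a i j x * frechet_derivative (W.d\<phi> j) (at x) i)
        + (\<Sum>j\<in>Basis. b j x * W.d\<phi> j x))"
        unfolding eq[OF x] by (simp add: mult_ac)
      then show "0 \<le> (\<Sum>i\<in>Basis. \<Sum>j\<in>Basis. a i j x * frechet_derivative (\<lambda>x. frechet_derivative (\<lambda>x. \<sigma> * ?\<phi> x) (at x) j) (at x) i)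
        + (\<Sum>j\<in>Basis. b j x * frechet_derivative (\<lambda>x. \<sigma> * ?\<phi> x) (at x) j)"
        unfolding d1[OF x] d2[OF x] by (simp add: distrib_left sum_distrib_left mult_ac)
    qed (fact ab)+
    then obtain \<rho> where \<rho>: "\<rho> > 0" "ball (snd c p) \<rho> \<subseteq> ?U" "\<And>x. x \<in> ball (snd c p) \<rho> \<Longrightarrow> \<sigma> * ?\<phi> x = \<sigma> * f p"
      by blast
    have "\<sigma> * f q = \<sigma> * f p" if "q \<in> fst c" "snd c q \<in> ball (snd c p) \<rho>" for q
      using \<rho>(3)[OF that(2)] c.chart_inv_chart[OF that(1)] by simp
    then show "\<exists>T. openin (mtop M1) T \<and> p \<in> T \<and> (\<forall>q\<in>T. \<sigma> * f q = \<sigma> * f p)"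
      using c.openin_chart_preimage[OF open_ball] c(2) \<rho>(1)
      by (intro exI[of _ "{q \<in> fst c. snd c q \<in> ball (snd c p) \<rho>}"]) auto
  qed
  then show "f constant_on ?X"
    using \<sigma>(1) unfolding constant_on_def by (metis mult_left_cancel)
qed

end
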